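(* Let $\alpha,\tau\in C^{\log}_{\mathrm{loc}}$ with $\tau^->0$, and let $p_1,p_2,q\in\mathcal{P}^{\log}_0$ with $q^+<\infty$. If $(p_2-p_1)^+\le0$, then $$B^{\alpha(\cdot)+n\tau(\cdot)+\frac{n}{p_2(\cdot)}-\frac{n}{p_1(\cdot)}}_{p_2(\cdot),q(\cdot)}\hookrightarrow\mathfrak{B}^{\alpha(\cdot),\tau(\cdot)}_{p_1(\cdot),q(\cdot)},$$ i.e. the first space is contained in the second with a continuous inclusion.
   Context: $g^\pm$: essential sup/inf. $\mathcal{P}_0$: measurable $p:\mathbb{R}^n\to(0,\infty)$ with $p^->0$. $g\in C^{\log}_{\mathrm{loc}}$: $|g(x)-g(y)|\le c/\log(e+1/|x-y|)$; $g\in C^{\log}$: additionally $|g(x)-g_\infty|\le c/\log(e+|x|)$. $\mathcal{P}_0^{\log}=\{p\in\mathcal{P}_0:1/p\in C^{\log}\}$. $\|f\|_{p(\cdot)}=\inf\{\lambda>0:\int|f/\lambda|^{p(x)}dx\le1\}$; $\|(f_v)\|_{\ell^{q(\cdot)}(L^{p(\cdot)})}=\inf\{\mu>0:\sum_v\inf\{\lambda_v>0:\int|f_v(x)/(\mu\lambda_v^{1/q(x)})|^{p(x)}dx\le1\}\le1\}$. Dyadic cubes $Q_{v,m}=\{x:m_i\le2^vx_i<m_i+1\}$ ($v\in\mathbb{Z}$) form $\mathcal{Q}$; $v_P=-\log_2l(P)$, $v_P^+=\max(v_P,0)$. Fix $\Phi,\varphi\in\mathcal{S}$ with $\operatorname{supp}\mathcal{F}\Phi\subset\overline{B(0,2)}$,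 $|\mathcal{F}\Phi(\xi)|\ge c>0$ for $|\xi|\le5/3$, $\operatorname{supp}\mathcal{F}\varphi\subset\overline{B(0,2)}\setminus B(0,1/2)$, $|\mathcal{F}\varphi(\xi)|\ge c>0$ for $3/5\le|\xi|\le5/3$; $\varphi_v=2^{vn}\varphi(2^v\cdot)$ ($v\ge1$), $\varphi_0:=\Phi$. The variable Besov space $B^{s(\cdot)}_{p(\cdot),q(\cdot)}$ is the set of $f\in\mathcal{S}'$ with $\|f\|_{B^{s(\cdot)}_{p(\cdot),q(\cdot)}}=\|(2^{vs(\cdot)}\varphi_v\ast f)_{v\in\mathbb{N}_0}\|_{\ell^{q(\cdot)}(L^{p(\cdot)})}<\infty$. $\mathfrak{B}^{\alpha(\cdot),\tau(\cdot)}_{p(\cdot),q(\cdot)}$ is the set of $f\in\mathcal{S}'$ with $\|f\|=\sup_{P\in\mathcal{Q}}\|(2^{v\alpha(\cdot)}\varphi_v\ast f\,|P|^{-\tau(\cdot)}\chi_P)_{v\ge v_P^+}\|_{\ell^{q(\cdot)}(L^{p(\cdot)})}<\infty$. *)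

theory Defs
  imports "HOL-Analysis.Analysis" "HOL-Probability.Essential_Supremum"
begin

definition ess_sup :: "(real^'n \<Rightarrow> real) \<Rightarrow> ereal" where
  "ess_sup g = esssup lebesgue (\<lambda>x. ereal (g x))"

definition ess_inf :: "(real^'n \<Rightarrow> real) \<Rightarrow> ereal" where
  "ess_inf g = - esssup lebesgue (\<lambda>x. ereal (- g x))"

definition log_hoelder_loc :: "(real^'n \<Rightarrow> real) \<Rightarrow> bool" where
  "log_hoelder_loc g \<longleftrightarrow>
     (\<exists>c. \<forall>x y. \<bar>g x - g y\<bar> \<le> c / ln (exp 1 + 1 / dist x y))"

definition log_hoelder :: "(real^'n \<Rightarrow> real) \<Rightarrow> bool" where
  "log_hoelder g \<longleftrightarrow> log_hoelder_loc g \<and>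
     (\<exists>g_inf c. \<forall>x. \<bar>g x - g_inf\<bar> \<le> c / ln (exp 1 + norm x))"

definition P0 :: "(real^'n \<Rightarrow> real) set" where
  "P0 = {p. p \<in> borel_measurable lebesgue \<and> (\<forall>x. 0 < p x) \<and> ess_inf p > 0}"

definition P0_log :: "(real^'n \<Rightarrow> real) set" where
  "P0_log = {p \<in> P0. log_hoelder (\<lambda>x. 1 / p x)}"

definition pdir :: "'n \<Rightarrow> (real^'n \<Rightarrow> complex) \<Rightarrow> (real^'n \<Rightarrow> complex)" where
  "pdir i g = (\<lambda>x. frechet_derivative g (at x) (axis i 1))"

fun pdl :: "'n list \<Rightarrow> (real^'n \<Rightarrow> complex) \<Rightarrow> (real^'n \<Rightarrow> complex)" where
  "pdl [] g = g"
| "pdl (i # is) g = pdir i (pdl is g)"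

definition schwartz :: "(real^'n::finite \<Rightarrow> complex) set" where
  "schwartz = {f. (\<forall>is x. pdl is f differentiable (at x)) \<and>
      (\<forall>k::nat. \<forall>is. bounded (range (\<lambda>x. (1 + norm x) ^ k * cmod (pdl is f x))))}"

definition schwartz_seminorm :: "nat \<Rightarrow> 'n list \<Rightarrow> (real^'n::finite \<Rightarrow> complex) \<Rightarrow> real" where
  "schwartz_seminorm k is f = (SUP x. (1 + norm x) ^ k * cmod (pdl is f x))"

definition tempered :: "((real^'n::finite \<Rightarrow> complex) \<Rightarrow> complex) set" where
  "tempered = {T.
     (\<forall>f\<in>schwartz. \<forall>g\<in>schwartz. T (\<lambda>x. f x + g x) = T f + T g) \<and>
     (\<forall>c. \<forall>f\<in>schwartz. T (\<lambda>x. c * f x) = c * T f) \<and>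
     (\<exists>C N. \<forall>f\<in>schwartz. cmod (T f) \<le>
        C * (\<Sum>k\<le>N. \<Sum>is\<in>{is::'n list. length is \<le> N}. schwartz_seminorm k is f))}"

definition fourier :: "(real^'n \<Rightarrow> complex) \<Rightarrow> (real^'n \<Rightarrow> complex)" where
  "fourier f = (\<lambda>\<xi>. LINT x|lborel. f x * cis (- 2 * pi * (x \<bullet> \<xi>)))"

definition conv :: "(real^'n \<Rightarrow> complex) \<Rightarrow> ((real^'n \<Rightarrow> complex) \<Rightarrow> complex) \<Rightarrow> real^'n \<Rightarrow> complex" where
  "conv \<phi> T = (\<lambda>x. T (\<lambda>y. \<phi> (x - y)))"

definition admissible_pair :: "(real^'n::finite \<Rightarrow> complex) \<Rightarrow> (real^'n \<Rightarrow> complex) \<Rightarrow> bool" where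
  "admissible_pair Phi phi \<longleftrightarrow> Phi \<in> schwartz \<and> phi \<in> schwartz \<and>
     (\<forall>\<xi>. fourier Phi \<xi> \<noteq> 0 \<longrightarrow> norm \<xi> \<le> 2) \<and>
     (\<exists>c>0. \<forall>\<xi>. norm \<xi> \<le> 5/3 \<longrightarrow> c \<le> cmod (fourier Phi \<xi>)) \<and>
     (\<forall>\<xi>. fourier phi \<xi> \<noteq> 0 \<longrightarrow> 1/2 \<le> norm \<xi> \<and> norm \<xi> \<le> 2) \<and>
     (\<exists>c>0. \<forall>\<xi>. 3/5 \<le> norm \<xi> \<and> norm \<xi> \<le> 5/3 \<longrightarrow> c \<le> cmod (fourier phi \<xi>))"

definition phi_v :: "(real^'n::finite \<Rightarrow> complex) \<Rightarrow> (real^'n \<Rightarrow> complex) \<Rightarrow> nat \<Rightarrow> real^'n \<Rightarrow> complex" where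
  "phi_v Phi phi v = (if v = 0 then Phi
     else (\<lambda>x. complex_of_real ((2::real) ^ (v * CARD('n))) * phi ((2::real) ^ v *\<^sub>R x)))"

text \<open>The norm of (g_v)_{v in V} in l^{q(.)}(L^{p(.)}); value in [0,\<infinity>].\<close>
definition mixed_norm :: "(real^'n \<Rightarrow> real) \<Rightarrow> (real^'n \<Rightarrow> real) \<Rightarrow> nat set \<Rightarrow> (nat \<Rightarrow> real^'n \<Rightarrow> complex) \<Rightarrow> ennreal" where
  "mixed_norm p q V g = Inf (ennreal ` {\<mu>::real. 0 < \<mu> \<and>
     (\<Sum>v. if v \<in> V then
        Inf (ennreal ` {lam::real. 0 < lam \<and>
          (\<integral>\<^sup>+ x. ennreal ((cmod (g v x) / (\<mu> * lam powr (1 / q x))) powr p x) \<partial>lebesgue) \<le> 1})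
      else 0) \<le> 1})"

definition besov_norm :: "(real^'n::finite \<Rightarrow> real) \<Rightarrow> (real^'n \<Rightarrow> real) \<Rightarrow> (real^'n \<Rightarrow> real)
    \<Rightarrow> (real^'n \<Rightarrow> complex) \<Rightarrow> (real^'n \<Rightarrow> complex) \<Rightarrow> ((real^'n \<Rightarrow> complex) \<Rightarrow> complex) \<Rightarrow> ennreal" where
  "besov_norm s p q Phi phi f = mixed_norm p q UNIV
     (\<lambda>v x. complex_of_real (2 powr (real v * s x)) * conv (phi_v Phi phi v) f x)"

definition besov_space :: "(real^'n::finite \<Rightarrow> real) \<Rightarrow> (real^'n \<Rightarrow> real) \<Rightarrow> (real^'n \<Rightarrow> real)
    \<Rightarrow> (real^'n \<Rightarrow> complex) \<Rightarrow> (real^'n \<Rightarrow> complex) \<Rightarrow> ((real^'n \<Rightarrow> complex) \<Rightarrow> complex) set" where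
  "besov_space s p q Phi phi = {f \<in> tempered. besov_norm s p q Phi phi f < \<infinity>}"

text \<open>Dyadic cube Q_{v,m}; its side length is 2^{-v}, so v_P = v.\<close>
definition dyadic_cube :: "int \<Rightarrow> ('n \<Rightarrow> int) \<Rightarrow> (real^'n) set" where
  "dyadic_cube v m = {x. \<forall>i. real_of_int (m i) \<le> 2 powr v * x $ i \<and> 2 powr v * x $ i < real_of_int (m i) + 1}"

definition btype_norm :: "(real^'n::finite \<Rightarrow> real) \<Rightarrow> (real^'n \<Rightarrow> real) \<Rightarrow> (real^'n \<Rightarrow> real) \<Rightarrow> (real^'n \<Rightarrow> real)
    \<Rightarrow> (real^'n \<Rightarrow> complex) \<Rightarrow> (real^'n \<Rightarrow> complex) \<Rightarrow> ((real^'n \<Rightarrow> complex) \<Rightarrow> complex) \<Rightarrow> ennreal" where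
  "btype_norm \<alpha> \<tau> p q Phi phi f = (SUP vm \<in> (UNIV :: (int \<times> ('n \<Rightarrow> int)) set).
     mixed_norm p q {nat (fst vm)..}
       (\<lambda>v x. complex_of_real (2 powr (real v * \<alpha> x)
              * measure lborel (dyadic_cube (fst vm) (snd vm)) powr (- \<tau> x)
              * indicator (dyadic_cube (fst vm) (snd vm)) x)
            * conv (phi_v Phi phi v) f x))"

definition btype_space :: "(real^'n::finite \<Rightarrow> real) \<Rightarrow> (real^'n \<Rightarrow> real) \<Rightarrow> (real^'n \<Rightarrow> real) \<Rightarrow> (real^'n \<Rightarrow> real)
    \<Rightarrow> (real^'n \<Rightarrow> complex) \<Rightarrow> (real^'n \<Rightarrow> complex) \<Rightarrow> ((real^'n \<Rightarrow> complex) \<Rightarrow> complex) set" where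
  "btype_space \<alpha> \<tau> p q Phi phi = {f \<in> tempered. btype_norm \<alpha> \<tau> p q Phi phi f < \<infinity>}"

end

theory Submission
  imports Defs "HOL-Probability.Sinc_Integral" "HOL-Probability.Characteristic_Functions"
begin

text \<open>
  For \<open>v \<ge> v_P^+\<close> the factor \<open>|P|^(-\<tau>)\<close> is at most \<open>2^(v n \<tau>)\<close>, so everything reduces to a Sobolev
  embedding at each level \<open>v\<close>. Let \<open>u = \<phi>_v * f\<close>, let \<open>L\<close> be the inner infimum in the Besov norm at level \<open>v\<close>
  and \<open>\<delta> = L + 2^(-v)\<close>. Then \<open>\<delta>\<close> lies in \<open>[2^(-v), 2]\<close>, so that by log-Hoelder continuity the weight
  \<open>w = 2^(v (\<alpha> + n \<tau> - n / p1)) \<delta>^(-1 / q)\<close> varies at most polynomially at scale \<open>2^(-v)\<close>. The hypothesis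
  says that \<open>2^(v n)\<close> times the integral of \<open>(w |u|)^p2\<close> is at most 1. A Nikolskii inequality yields
  \<open>w |u| \<le> C\<close> everywhere, and then the \<open>p1\<close>-integrand is pointwise at most the \<open>p2\<close>-integrand because
  \<open>p2 \<le> p1\<close>.

  The Nikolskii inequality comes from oversampling: the band-limited function \<open>u\<close> satisfies
  \<open>u(x + 2^(-v) t) = \<Sum>j. c_j(t) u(x + 2^(-v) y_j)\<close> with rapidly decaying coefficients and fixed nodes
  \<open>y_j\<close>, for all \<open>t\<close> in a small cube. Taking \<open>r\<close>-th powers with \<open>r \<le> min 1 p2\<close> and averaging over \<open>t\<close>
  gives the bound.
\<close>

section \<open>Fourier series with rapidly decaying coefficients\<close>

text \<open>Two obstacles shape the proof. The exponent \<open>p2\<close> may drop below 1, so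
  Hoelder or Jensen against a convolution kernel is not at hand; a discrete reproducing formula
  still works, because powers with exponent \<open>r \<le> 1\<close> are subadditive over a series.
  And the order of the tempered distribution is arbitrary, while the embedding constant must not see
  it: the coefficients therefore carry two decay bounds, one with a constant fixed in advance, which
  enters the estimate, and one of any prescribed order, whose constant only serves to make the
  series converge when the distribution is applied to it. The summand \<open>2^(-v)\<close> in
  \<delta> is there because \<open>L\<close> may be 0 or not attained: \<delta> is always
  admissible, and \<open>|ln \<delta>|\<close> is of order \<open>v\<close>, which is what
  log-Hoelder continuity of \<open>1 / q\<close> absorbs at scale \<open>2^(-v)\<close>. These
  summands add up to 2, so the \<delta> add up to at most 3 instead of 1; the normalisation costs a
  factor \<open>3^Q\<close>, where \<open>Q\<close> bounds \<open>1 / q\<close>.\<close>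

lemma set_integral_cis:
  fixes b r :: real assumes "0 < r"
  shows "(LINT \<theta>:{-r..r}|lborel. cis (b * \<theta>)) = complex_of_real (2 * r * sinc (b * r))"
proof -
  have int: "set_integrable lborel {-r..r} (\<lambda>\<theta>. cis (b * \<theta>))"
    by (intro borel_integrable_atLeastAtMost' continuous_intros)
  have "((\<lambda>\<theta>. cis (b * \<theta>)) has_integral complex_of_real (2 * r * sinc (b * r))) {-r..r}"
  proof (cases "b = 0")
    case True
    then show ?thesis
      using has_integral_const_real[of "1::complex" "-r" r] assms by (simp add: scaleR_conv_of_real)
  next
    case False
    have d: "((\<lambda>\<theta>. - \<i> * cis (b * \<theta>) / of_real b) has_vector_derivative cis (b * \<theta>)) (at \<theta> within {-r..r})" for \<theta>
      unfolding cis_conv_exp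
      by (auto intro!: derivative_eq_intros has_vector_derivative_real_field simp: False)
    have e: "- \<i> * cis (b * r) / of_real b - (- \<i> * cis (b * (- r)) / of_real b)
          = complex_of_real (2 * r * sinc (b * r))"
      using False assms by (simp add: complex_eq_iff cis.ctr field_simps)
    show ?thesis
      using fundamental_theorem_of_calculus[OF _ d] assms e by simp
  qed
  then show ?thesis
    using set_borel_integral_eq_integral(2)[OF int] integral_unique by metis
qed

lemma cmod_diff_sq: "(cmod (g - h))\<^sup>2 = (cmod g)\<^sup>2 - 2 * Re (g * cnj h) + (cmod h)\<^sup>2"
  unfolding cmod_power2 by (simp add: power2_eq_square algebra_simps)

lemma borel_measurable_cnj [measurable (raw)]:
  "f \<in> borel_measurable M \<Longrightarrow> (\<lambda>x. cnj (f x)) \<in> borel_measurable M"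
  by (rule measurable_compose[of f M borel cnj]) (auto intro!: borel_measurable_continuous_onI continuous_intros)

text \<open>Positivity of the integral of \<open>|V * g - h|^2\<close>, where \<open>h\<close> is
  the sum of the \<open>c k * e k\<close>. The \<open>e k\<close> have squared norm
  \<open>V\<close>, the total mass, instead of 1; scaling \<open>g\<close> by \<open>V\<close>
  postpones the division by \<open>V\<close> to the end, and mass zero is treated apart.\<close>

lemma bessel_ineq:
  fixes e :: "'k \<Rightarrow> 'a \<Rightarrow> complex" and g :: "'a \<Rightarrow> complex"
  assumes "finite_measure M" and [measurable]: "g \<in> borel_measurable M" "\<And>k. e k \<in> borel_measurable M"
    and B: "\<And>x. x \<in> space M \<Longrightarrow> cmod (g x) \<le> B"
    and e: "\<And>k x. x \<in> space M \<Longrightarrow> cmod (e k x) = 1"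
    and orth: "\<And>j k. j \<noteq> k \<Longrightarrow> (LINT x|M. e j x * cnj (e k x)) = 0"
    and "finite S"
  shows "(\<Sum>k\<in>S. (cmod (LINT x|M. g x * cnj (e k x)))\<^sup>2) \<le> (B * measure M (space M))\<^sup>2"
proof -
  interpret finite_measure M by fact
  define V where "V = measure M (space M)"
  have bnd: "integrable M f" if "f \<in> borel_measurable M" "\<And>x. x \<in> space M \<Longrightarrow> norm (f x) \<le> C"
    for f :: "'a \<Rightarrow> 'b::{banach,second_countable_topology}" and C
    using that by (intro integrable_const_bound[of _ C] AE_I2) auto
  have [simp]: "integrable M (\<lambda>x. g x * cnj (e k x))" for k
    by (rule bnd[of _ B], measurable) (use B e in \<open>auto simp: norm_mult\<close>)
  have ee [simp]: "integrable M (\<lambda>x. e j x * cnj (e k x))" for j k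
    by (rule bnd[of _ 1], measurable) (use B e in \<open>auto simp: norm_mult\<close>)
  define c where "c k = (LINT x|M. g x * cnj (e k x))" for k
  define h where "h x = (\<Sum>k\<in>S. c k * e k x)" for x
  have [measurable]: "h \<in> borel_measurable M"
    unfolding h_def by measurable
  have hb: "cmod (h x) \<le> (\<Sum>k\<in>S. cmod (c k))" if "x \<in> space M" for x
    unfolding h_def using e[OF that] by (intro order_trans[OF norm_sum]) (simp add: norm_mult)
  have B0: "0 \<le> B" if "space M \<noteq> {}" using B that norm_ge_zero order_trans by blast
  show ?thesis
  proof (cases "V = 0")
    case True
    have "c k = 0" for k
    proof -
      have "emeasure M (space M) = 0" using True by (simp add: V_def measure_eq_emeasure_eq_ennreal emeasure_eq_measure)
      then have "AE x in M. False" by (simp add: AE_iff_measurable[of "space M"])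
      then have "AE x in M. g x * cnj (e k x) = 0" by auto
      then show ?thesis unfolding c_def by (simp add: integral_eq_zero_AE)
    qed
    then show ?thesis by (simp add: c_def)
  next
    case False
    then have V: "0 < V" unfolding V_def by (simp add: less_le measure_nonneg)
    have gi: "integrable M (\<lambda>x. (cmod (V * g x))\<^sup>2)"
      by (rule bnd[of _ "(V * B)\<^sup>2"], measurable) (use B V in \<open>auto simp: norm_mult power_mult_distrib intro!: mult_left_mono power_mono\<close>)
    have hi: "integrable M (\<lambda>x. (cmod (h x))\<^sup>2)"
      by (rule bnd[of _ "(\<Sum>k\<in>S. cmod (c k))\<^sup>2"], measurable) (use hb in \<open>auto intro!: power_mono\<close>)
    have hi': "integrable M (\<lambda>x. h x * cnj (h x))"
      by (rule bnd[of _ "(\<Sum>k\<in>S. cmod (c k))\<^sup>2"], measurable) (use hb in \<open>auto simp: norm_mult power2_eq_square intro!: mult_mono sum_nonneg\<close>)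
    have gh: "integrable M (\<lambda>x. g x * cnj (h x))"
      by (rule bnd[of _ "B * (\<Sum>k\<in>S. cmod (c k))"], measurable) (use hb B in \<open>auto simp: norm_mult intro!: mult_mono order_trans[OF norm_ge_zero B] sum_nonneg\<close>)
    have 1: "(LINT x|M. g x * cnj (h x)) = (\<Sum>k\<in>S. complex_of_real ((cmod (c k))\<^sup>2))"
    proof -
      have "(LINT x|M. g x * cnj (h x)) = (LINT x|M. (\<Sum>k\<in>S. cnj (c k) * (g x * cnj (e k x))))"
        by (simp add: h_def sum_distrib_left mult_ac)
      also have "\<dots> = (\<Sum>k\<in>S. cnj (c k) * c k)"
        by (simp add: c_def)
      finally show ?thesis unfolding complex_norm_square by (simp add: mult.commute)
    qed
    have 2: "(LINT x|M. h x * cnj (h x)) = (\<Sum>k\<in>S. complex_of_real (V * (cmod (c k))\<^sup>2))"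
    proof -
      have "(LINT x|M. h x * cnj (h x)) = (LINT x|M. (\<Sum>k\<in>S. \<Sum>j\<in>S. c j * cnj (c k) * (e j x * cnj (e k x))))"
        unfolding h_def cnj_sum sum_distrib_left sum_distrib_right
        by (intro Bochner_Integration.integral_cong refl sum.cong) (simp add: mult_ac)
      also have "\<dots> = (\<Sum>k\<in>S. \<Sum>j\<in>S. c j * cnj (c k) * (LINT x|M. e j x * cnj (e k x)))"
        by simp
      also have "\<dots> = (\<Sum>k\<in>S. \<Sum>j\<in>S. if j = k then c k * cnj (c k) * V else 0)"
      proof (intro sum.cong refl)
        fix k j
        have "(LINT x|M. e k x * cnj (e k x)) = (LINT x|M. 1)"
          by (intro Bochner_Integration.integral_cong refl) (simp add: complex_norm_square[symmetric] e)
        then show "c j * cnj (c k) * (LINT x|M. e j x * cnj (e k x)) = (if j = k then c k * cnj (c k) * V else 0)"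
          using orth[of j k] by (simp add: V_def scaleR_conv_of_real)
      qed
      also have "\<dots> = (\<Sum>k\<in>S. complex_of_real (V * (cmod (c k))\<^sup>2))"
        using \<open>finite S\<close> unfolding of_real_mult complex_norm_square by (simp add: mult_ac)
      finally show ?thesis .
    qed
    have "0 \<le> (LINT x|M. (cmod (V * g x - h x))\<^sup>2)"
      by simp
    also have "\<dots> = (LINT x|M. (cmod (V * g x))\<^sup>2 - 2 * V * Re (g x * cnj (h x)) + Re (h x * cnj (h x)))"
      unfolding cmod_diff_sq
      by (intro Bochner_Integration.integral_cong refl) (simp add: complex_norm_square[symmetric] del: Re_complex_of_real, simp add: cmod_power2 algebra_simps power2_eq_square)
    also have "\<dots> = (LINT x|M. (cmod (V * g x))\<^sup>2) - 2 * V * Re (LINT x|M. g x * cnj (h x)) + Re (LINT x|M. h x * cnj (h x))"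
    proof -
      have "(LINT x|M. p x - c * q x + r x) = (LINT x|M. p x) - c * (LINT x|M. q x) + (LINT x|M. r x)"
        if "integrable M p" "integrable M q" "integrable M r" for p q r :: "'a \<Rightarrow> real" and c
        using that by simp
      from this[OF gi integrable_Re[OF gh] integrable_Re[OF hi']] show ?thesis
        using integral_Re[OF gh] integral_Re[OF hi'] by simp
    qed
    also have "\<dots> = (LINT x|M. (cmod (V * g x))\<^sup>2) - V * (\<Sum>k\<in>S. (cmod (c k))\<^sup>2)"
      by (simp add: 1 2 sum_distrib_left mult.assoc flip: of_real_sum)
    also have "(LINT x|M. (cmod (V * g x))\<^sup>2) \<le> (LINT x|M. (V * B)\<^sup>2)"
      by (rule integral_mono[OF gi]) (use B V in \<open>auto simp: norm_mult intro!: power_mono mult_left_mono\<close>)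
    also have "\<dots> = V * (B * V)\<^sup>2"
      by (simp add: V_def power2_eq_square mult_ac)
    finally show ?thesis using V by (simp add: c_def V_def)
  qed
qed

text \<open>By Bessel's inequality the squared coefficients at distinct frequencies are summable,
  hence tend to 0. An arbitrary injective sequence of frequencies covers both ends
  \<open>int K + 1\<close> and \<open>- int K\<close> that remain of a symmetric partial
  sum.\<close>

lemma riemann_lebesgue_interval:
  fixes g :: "real \<Rightarrow> complex" and k :: "nat \<Rightarrow> int"
  assumes [measurable]: "g \<in> borel_measurable borel" and B: "\<And>x. x \<in> {-pi..pi} \<Longrightarrow> cmod (g x) \<le> B" and "inj k"
  shows "(\<lambda>n. LINT \<theta>:{-pi..pi}|lborel. g \<theta> * cis (k n * \<theta>)) \<longlonglongrightarrow> 0"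
proof -
  define M where "M = restrict_space lborel {-pi..pi}"
  have fin: "finite_measure M"
    by (rule finite_measureI) (simp add: M_def emeasure_restrict_space space_restrict_space)
  have meas [measurable]: "f \<in> borel_measurable M" if "f \<in> borel_measurable borel" for f :: "real \<Rightarrow> complex"
    using that unfolding M_def by (intro measurable_restrict_space1) simp
  have LI: "(LINT x|M. f x) = (LINT x:{-pi..pi}|lborel. f x)" for f :: "real \<Rightarrow> complex"
    unfolding M_def set_lebesgue_integral_def by (subst integral_restrict_space) auto
  have orth: "(LINT x|M. cis (- real_of_int j * x) * cnj (cis (- real_of_int l * x))) = 0" if "j \<noteq> l" for j l :: int
  proof -
    have "(LINT x|M. cis (- real_of_int j * x) * cnj (cis (- real_of_int l * x))) = (LINT x:{-pi..pi}|lborel. cis ((l - j) * x))"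
      unfolding LI by (simp add: cis_cnj cis_mult algebra_simps)
    also have "\<dots> = 0"
      unfolding set_integral_cis[OF pi_gt_zero] using that by (simp add: sin_zero_iff_int2) (metis of_int_diff)
    finally show ?thesis .
  qed
  define t where "t n = (LINT \<theta>|M. g \<theta> * cnj (cis (- k n * \<theta>)))" for n
  have "(\<Sum>n<m. (cmod (t n))\<^sup>2) \<le> (B * measure M (space M))\<^sup>2" for m
  proof -
    have "(\<Sum>j\<in>k ` {..<m}. (cmod (LINT \<theta>|M. g \<theta> * cnj (cis (- real_of_int j * \<theta>))))\<^sup>2) \<le> (B * measure M (space M))\<^sup>2"
    proof (rule bessel_ineq[OF fin, of g "\<lambda>j x. cis (- real_of_int j * x)"])
      show "g \<in> borel_measurable M" by measurable
      show "(\<lambda>x. cis (- real_of_int j * x)) \<in> borel_measurable M" for j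
        by (intro meas borel_measurable_continuous_onI continuous_intros)
    qed (use B orth in \<open>simp_all add: M_def space_restrict_space\<close>)
    then show ?thesis
      using \<open>inj k\<close> by (subst (asm) sum.reindex) (auto simp: t_def inj_on_def)
  qed
  then have "summable (\<lambda>n. (cmod (t n))\<^sup>2)"
    by (intro summableI_nonneg_bounded) auto
  then have "(\<lambda>n. (cmod (t n))\<^sup>2) \<longlonglongrightarrow> 0"
    by (rule summable_LIMSEQ_zero)
  then have "(\<lambda>n. sqrt ((cmod (t n))\<^sup>2)) \<longlonglongrightarrow> sqrt 0"
    by (rule tendsto_real_sqrt)
  then have "t \<longlonglongrightarrow> 0"
    by (simp add: tendsto_norm_zero_iff)
  then show ?thesis
    by (simp add: t_def[abs_def] LI cis_cnj)
qed

lemma set_integral_Icc_norm_le: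
  fixes f :: "real \<Rightarrow> complex"
  assumes "set_integrable lborel {u..v} f" "\<And>x. x \<in> {u..v} \<Longrightarrow> cmod (f x) \<le> C" "u \<le> v"
  shows "cmod (LINT x:{u..v}|lborel. f x) \<le> C * (v - u)"
proof -
  have "cmod (LINT x:{u..v}|lborel. f x) \<le> (LINT x:{u..v}|lborel. cmod (f x))"
    by (rule set_integral_norm_bound[OF assms(1)])
  also have "\<dots> \<le> (LINT x:{u..v}|lborel. C)"
  proof (rule set_integral_mono)
    show "set_integrable lborel {u..v} (\<lambda>x. C)"
      by (intro borel_integrable_atLeastAtMost' continuous_intros)
  qed (use assms set_integrable_norm in auto)
  finally show ?thesis using assms(3) by (simp add: set_lebesgue_integral_def mult.commute)
qed

section \<open>Symmetric Fourier series of an exponential on a short interval\<close>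

definition sym_sum :: "(int \<Rightarrow> complex) \<Rightarrow> real \<Rightarrow> nat \<Rightarrow> complex" where
  "sym_sum s \<theta> K = (\<Sum>k\<in>{- int K..int K}. s k * cis (real_of_int k * \<theta>))"

text \<open>The uniform bound on the symmetric partial sums is what permits averaging over a short
  interval under the limit.\<close>
definition represents :: "(int \<Rightarrow> complex) \<Rightarrow> real \<Rightarrow> real \<Rightarrow> bool" where
  "represents s a \<rho> \<longleftrightarrow> (\<exists>B. \<forall>\<theta>. \<bar>\<theta>\<bar> \<le> \<rho> \<longrightarrow>
     (\<forall>K. cmod (sym_sum s \<theta> K) \<le> B) \<and> sym_sum s \<theta> \<longlonglongrightarrow> cis (a * \<theta>))"

text \<open>The Dirichlet kernel in multiplied-out form, so that zeros of
  \<open>cis \<phi> - 1\<close> need no separate treatment.\<close>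

lemma dirichlet_telescope:
  "(\<Sum>k\<in>{- int K..int K}. cis (real_of_int k * \<phi>)) * (cis \<phi> - 1) = cis ((real K + 1) * \<phi>) - cis (- real K * \<phi>)"
proof (induction K)
  case 0
  then show ?case by simp
next
  case (Suc K)
  have "{- int (Suc K)..int (Suc K)} = insert (- int (Suc K)) (insert (int (Suc K)) {- int K..int K})"
    by auto
  then have "(\<Sum>k\<in>{- int (Suc K)..int (Suc K)}. cis (real_of_int k * \<phi>)) * (cis \<phi> - 1)
     = cis (- (real K + 1) * \<phi>) * (cis \<phi> - 1) + cis ((real K + 1) * \<phi>) * (cis \<phi> - 1)
        + (cis ((real K + 1) * \<phi>) - cis (- real K * \<phi>))"
    using Suc by (simp add: algebra_simps)
  moreover have "cis (- (real K + 1) * \<phi>) * cis \<phi> = cis (- real K * \<phi>)"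
      "cis ((real K + 1) * \<phi>) * cis \<phi> = cis ((real (Suc K) + 1) * \<phi>)"
      "cis (- (real K + 1) * \<phi>) = cis (- real (Suc K) * \<phi>)"
    by (simp_all add: cis_mult algebra_simps)
  ultimately show ?case
    by (simp add: right_diff_distrib)
qed

text \<open>The form with \<open>sinc\<close> splits off the linear factor \<open>|\<phi>|\<close>;
  what remains has no zero for \<open>|\<phi>| < 2 * pi\<close>, so difference quotients over
  \<open>cis \<phi> - 1\<close> are bounded there.\<close>

lemma cis_diff_norm: "cmod (cis \<phi> - 1) = \<bar>\<phi>\<bar> * \<bar>sinc (\<phi> / 2)\<bar>"
proof -
  have "cis \<phi> - 1 = cis (\<phi> / 2) * (2 * \<i> * sin (\<phi> / 2))"
    by (simp add: complex_eq_iff cos_double_sin[of "\<phi>/2", simplified] sin_double[of "\<phi>/2", simplified] power2_eq_square)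
  then have "cmod (cis \<phi> - 1) = 2 * \<bar>sin (\<phi> / 2)\<bar>"
    by (simp add: norm_mult)
  then show ?thesis by (auto simp: abs_mult)
qed

lemma cis_diff_le: "cmod (cis x - cis y) \<le> \<bar>x - y\<bar>"
proof -
  have "cis x - cis y = cis y * (cis (x - y) - 1)"
    by (simp add: right_diff_distrib cis_mult)
  then have "cmod (cis x - cis y) = cmod (cis (x - y) - 1)"
    by (simp add: norm_mult)
  also have "\<dots> = \<bar>x - y\<bar> * \<bar>sinc ((x - y) / 2)\<bar>"
    by (rule cis_diff_norm)
  also have "\<dots> \<le> \<bar>x - y\<bar> * 1"
    using abs_sin_x_le_abs_x[of "(x - y) / 2"] by (intro mult_left_mono) (auto simp: divide_le_eq)
  finally show ?thesis by simp
qed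

text \<open>Chernoff's argument: after subtracting the value at \<open>\<theta>\<^sub>0\<close> and dividing by
  \<open>cis (\<theta> - \<theta>\<^sub>0) - 1\<close> the symmetric partial sums telescope to two Fourier coefficients of a
  bounded function, which vanish by Riemann-Lebesgue.\<close>
lemma represents_sinc:
  fixes a \<rho> :: real
  assumes "0 < \<rho>" "\<rho> < pi"
  shows "represents (\<lambda>k. complex_of_real (sinc (pi * (a - k)))) a \<rho>"
proof -
  \<comment> \<open>The differences \<open>\<theta> - \<theta>0\<close> lie in
    \<open>[-(pi + \<rho>), pi + \<rho>]\<close>. As \<open>\<rho> < pi\<close>, this interval stays
    inside the zero-free range of \<open>sinc (\<phi> / 2)\<close>, so the minimum \<open>m\<close>
    is positive and bounds the quotient \<open>G\<close> uniformly in
    \<open>\<theta>0\<close>.\<close>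
  define f where "f \<phi> = \<bar>sinc (\<phi> / 2)\<bar>" for \<phi>
  have "continuous_on {-(pi + \<rho>)..pi + \<rho>} f"
    unfolding f_def by (intro continuous_intros) auto
  then obtain \<phi>0 where \<phi>0: "\<phi>0 \<in> {-(pi + \<rho>)..pi + \<rho>}"
    and min0: "\<forall>\<phi>\<in>{-(pi + \<rho>)..pi + \<rho>}. f \<phi>0 \<le> f \<phi>"
    using continuous_attains_inf[of "{-(pi + \<rho>)..pi + \<rho>}" f] assms by auto
  have min: "\<bar>sinc (\<phi>0 / 2)\<bar> \<le> \<bar>sinc (\<phi> / 2)\<bar>" if "\<phi> \<in> {-(pi + \<rho>)..pi + \<rho>}" for \<phi>
    using min0[rule_format, OF that] unfolding f_def .
  have two_pi_pos: "0 < 2 * pi" by simp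
  define m where "m = \<bar>sinc (\<phi>0 / 2)\<bar>"
  have "sin (\<phi>0 / 2) \<noteq> 0" if "\<phi>0 \<noteq> 0"
    using sin_gt_zero[of "\<phi>0 / 2"] sin_gt_zero[of "- \<phi>0 / 2"] \<phi>0 assms that
    by (cases "\<phi>0 > 0") auto
  then have m: "0 < m" by (auto simp: m_def)
  \<comment> \<open>At \<open>\<theta> = \<theta>0\<close> this is \<open>0 / 0 = 0\<close>. Both
    \<open>Gb\<close> and \<open>G0\<close> hold there as well, and Riemann-Lebesgue asks only for a
    bounded measurable function, so no continuous extension is made.\<close>
  define G where "G \<theta>0 \<theta> = (cis (a * \<theta>) - cis (a * \<theta>0)) / (cis (\<theta> - \<theta>0) - 1)" for \<theta>0 \<theta>
  have Gb: "cmod (G \<theta>0 \<theta>) \<le> \<bar>a\<bar> / m" if "\<bar>\<theta>0\<bar> \<le> \<rho>" "\<theta> \<in> {-pi..pi}" for \<theta>0 \<theta>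
  proof (cases "\<theta> = \<theta>0")
    case True then show ?thesis using m by (simp add: G_def)
  next
    case False
    have "m \<le> \<bar>sinc ((\<theta> - \<theta>0) / 2)\<bar>"
      unfolding m_def using that by (intro min) auto
    then have "\<bar>\<theta> - \<theta>0\<bar> * m \<le> cmod (cis (\<theta> - \<theta>0) - 1)"
      unfolding cis_diff_norm by (intro mult_left_mono) auto
    moreover have "cmod (cis (a * \<theta>) - cis (a * \<theta>0)) \<le> \<bar>a\<bar> * \<bar>\<theta> - \<theta>0\<bar>"
      using cis_diff_le[of "a * \<theta>" "a * \<theta>0"] by (simp add: abs_mult[symmetric] algebra_simps)
    ultimately have "cmod (G \<theta>0 \<theta>) \<le> (\<bar>a\<bar> * \<bar>\<theta> - \<theta>0\<bar>) / (\<bar>\<theta> - \<theta>0\<bar> * m)"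
      unfolding G_def norm_divide using False m by (intro frac_le) auto
    then show ?thesis using False by simp
  qed
  have Gm [measurable]: "G \<theta>0 \<in> borel_measurable borel" for \<theta>0
  proof -
    have "(\<lambda>\<theta>. cis (a * \<theta>) - cis (a * \<theta>0)) \<in> borel_measurable borel"
         "(\<lambda>\<theta>. cis (\<theta> - \<theta>0) - 1) \<in> borel_measurable borel"
      by (auto intro!: borel_measurable_continuous_onI continuous_intros)
    then show ?thesis unfolding G_def[abs_def] by (rule borel_measurable_divide)
  qed
  have G0: "G \<theta>0 \<theta> * (cis (\<theta> - \<theta>0) - 1) = cis (a * \<theta>) - cis (a * \<theta>0)"
    if "\<bar>\<theta>0\<bar> \<le> \<rho>" "\<theta> \<in> {-pi..pi}" for \<theta>0 \<theta>
  proof (cases "\<theta> = \<theta>0")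
    case False
    have "m \<le> \<bar>sinc ((\<theta> - \<theta>0) / 2)\<bar>"
      unfolding m_def using that by (intro min) auto
    then have "0 < \<bar>\<theta> - \<theta>0\<bar> * \<bar>sinc ((\<theta> - \<theta>0) / 2)\<bar>" using False m by (intro mult_pos_pos) auto
    then have "cis (\<theta> - \<theta>0) - 1 \<noteq> 0"
      unfolding cis_diff_norm[symmetric] by simp
    then show ?thesis by (simp add: G_def)
  qed simp
  define E where "E \<theta>0 n = (LINT \<theta>:{-pi..pi}|lborel. G \<theta>0 \<theta> * cis (real_of_int n * \<theta>))" for \<theta>0 and n :: int
  have si: "set_integrable lborel {-pi..pi} (\<lambda>\<theta>. G \<theta>0 \<theta> * cis (real_of_int n * \<theta>))" if "\<bar>\<theta>0\<bar> \<le> \<rho>" for \<theta>0 and n :: int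
    unfolding set_integrable_def
  proof (rule integrableI_bounded_set_indicator[of _ _ _ "\<bar>a\<bar> / m"])
    show "(\<lambda>\<theta>. G \<theta>0 \<theta> * cis (real_of_int n * \<theta>)) \<in> borel_measurable lborel"
      by (intro borel_measurable_times) (auto intro!: borel_measurable_continuous_onI continuous_intros)
  qed (use Gb that in \<open>auto simp: norm_mult\<close>)
  have Eb: "cmod (E \<theta>0 n) \<le> \<bar>a\<bar> / m * (2 * pi)" if "\<bar>\<theta>0\<bar> \<le> \<rho>" for \<theta>0 n
    using set_integral_Icc_norm_le[OF si[OF that, of n], of "\<bar>a\<bar> / m"] Gb[OF that]
    by (simp add: E_def norm_mult)
  have key: "sym_sum (\<lambda>k. complex_of_real (sinc (pi * (a - k)))) \<theta>0 K - cis (a * \<theta>0)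
     = (cis (- (real K + 1) * \<theta>0) * E \<theta>0 (int K + 1) - cis (real K * \<theta>0) * E \<theta>0 (- int K)) / (2 * pi)"
    if "\<bar>\<theta>0\<bar> \<le> \<rho>" for \<theta>0 K
  proof -
    let ?I = "{-pi..pi}"
    have c [simp]: "set_integrable lborel ?I (\<lambda>\<theta>. C * cis (b * \<theta> + d))" for b d C
      by (intro borel_integrable_atLeastAtMost' continuous_intros)
    have 1: "(LINT \<theta>:?I|lborel. cis (b * \<theta> + d)) = 2 * pi * sinc (pi * b) * cis d" for b d
      using set_integral_cis[OF pi_gt_zero, of b]
      by (simp add: cis_mult[symmetric] mult_ac)
    have 2: "complex_of_real (2 * pi * sinc (pi * (a - real_of_int k))) * cis (real_of_int k * \<theta>0)
         = (LINT \<theta>:?I|lborel. cis (real_of_int k * (\<theta>0 - \<theta>)) * cis (a * \<theta>))" for k :: int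
      using 1[of "a - k" "k * \<theta>0"] by (simp add: cis_mult algebra_simps)
    \<comment> \<open>A constant has only its zeroth Fourier coefficient. This brings the limit
      \<open>cis (a * \<theta>0)\<close> under the same kernel as the partial sum, so that their
      difference contains the factor divisible by
      \<open>cis (\<theta> - \<theta>0) - 1\<close>.\<close>
    have 3: "(LINT \<theta>:?I|lborel. cis (real_of_int k * (\<theta>0 - \<theta>)) * cis (a * \<theta>0))
        = (if k = 0 then 2 * pi * cis (a * \<theta>0) else 0)" for k :: int
      using 1[of "- k" "k * \<theta>0 + a * \<theta>0"] sin_zero_iff_int2[of "pi * k"]
      by (auto simp add: cis_mult algebra_simps)
    have "2 * pi * (sym_sum (\<lambda>k. complex_of_real (sinc (pi * (a - k)))) \<theta>0 K - cis (a * \<theta>0))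
       = (\<Sum>k\<in>{- int K..int K}. (LINT \<theta>:?I|lborel. cis (real_of_int k * (\<theta>0 - \<theta>)) * cis (a * \<theta>))
             - (if k = 0 then 2 * pi * cis (a * \<theta>0) else 0))"
      unfolding 2[symmetric] by (simp add: sym_sum_def sum_subtractf sum_distrib_left right_diff_distrib mult_ac)
    also have "\<dots> = (\<Sum>k\<in>{- int K..int K}. LINT \<theta>:?I|lborel. cis (real_of_int k * (\<theta>0 - \<theta>)) * (cis (a * \<theta>) - cis (a * \<theta>0)))"
      unfolding 3[symmetric] right_diff_distrib
      by (intro sum.cong refl set_integral_diff(2)[symmetric] borel_integrable_atLeastAtMost' continuous_intros)
    also have "\<dots> = (LINT \<theta>:?I|lborel. (\<Sum>k\<in>{- int K..int K}. cis (real_of_int k * (\<theta>0 - \<theta>)) * (cis (a * \<theta>) - cis (a * \<theta>0))))"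
      unfolding set_lebesgue_integral_def scaleR_sum_right
      by (rule Bochner_Integration.integral_sum[symmetric], unfold set_integrable_def[symmetric])
        (intro borel_integrable_atLeastAtMost' continuous_intros)
    also have "\<dots> = (LINT \<theta>:?I|lborel. cis (- (real K + 1) * \<theta>0) * (G \<theta>0 \<theta> * cis (real_of_int (int K + 1) * \<theta>))
            - cis (real K * \<theta>0) * (G \<theta>0 \<theta> * cis (real_of_int (- int K) * \<theta>)))"
    proof (rule set_lebesgue_integral_cong, simp, safe)
      fix \<theta> assume t: "\<theta> \<in> ?I"
      have "(\<Sum>k\<in>{- int K..int K}. cis (real_of_int k * (\<theta>0 - \<theta>))) = (\<Sum>k\<in>{- int K..int K}. cis (real_of_int k * (\<theta> - \<theta>0)))"
        by (rule sum.reindex_bij_witness[of _ uminus uminus]) (auto simp: algebra_simps)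
      then have "(\<Sum>k\<in>{- int K..int K}. cis (real_of_int k * (\<theta>0 - \<theta>)) * (cis (a * \<theta>) - cis (a * \<theta>0)))
          = (\<Sum>k\<in>{- int K..int K}. cis (real_of_int k * (\<theta> - \<theta>0))) * (cis (\<theta> - \<theta>0) - 1) * G \<theta>0 \<theta>"
        using G0[OF that t] by (simp add: sum_distrib_right[symmetric] mult_ac)
      also have "\<dots> = (cis ((real K + 1) * (\<theta> - \<theta>0)) - cis (- real K * (\<theta> - \<theta>0))) * G \<theta>0 \<theta>"
        unfolding dirichlet_telescope ..
      also have "\<dots> = cis (- (real K + 1) * \<theta>0) * (G \<theta>0 \<theta> * cis (real_of_int (int K + 1) * \<theta>))
            - cis (real K * \<theta>0) * (G \<theta>0 \<theta> * cis (real_of_int (- int K) * \<theta>))"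
      proof -
        have "cis ((real K + 1) * (\<theta> - \<theta>0)) = cis (- (real K + 1) * \<theta>0) * cis (real_of_int (int K + 1) * \<theta>)"
          "cis (- real K * (\<theta> - \<theta>0)) = cis (real K * \<theta>0) * cis (real_of_int (- int K) * \<theta>)"
          by (simp_all add: cis_mult algebra_simps)
        then show ?thesis by (simp add: algebra_simps)
      qed
      finally show "(\<Sum>k\<in>{- int K..int K}. cis (real_of_int k * (\<theta>0 - \<theta>)) * (cis (a * \<theta>) - cis (a * \<theta>0)))
          = cis (- (real K + 1) * \<theta>0) * (G \<theta>0 \<theta> * cis (real_of_int (int K + 1) * \<theta>))
            - cis (real K * \<theta>0) * (G \<theta>0 \<theta> * cis (real_of_int (- int K) * \<theta>))" .
    qed
    also have "\<dots> = cis (- (real K + 1) * \<theta>0) * E \<theta>0 (int K + 1) - cis (real K * \<theta>0) * E \<theta>0 (- int K)"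
      unfolding E_def
      by (subst set_integral_diff(2)) (use si[OF that] in \<open>auto intro!: set_integrable_mult_right simp del: of_int_add of_int_minus\<close>)
    finally show ?thesis by (simp add: field_simps)
  qed
  show ?thesis
    unfolding represents_def
  proof (intro exI[of _ "1 + 2 * (\<bar>a\<bar> / m)"] allI impI conjI)
    fix \<theta>0 K assume t: "\<bar>\<theta>0\<bar> \<le> \<rho>"
    let ?S = "sym_sum (\<lambda>k. complex_of_real (sinc (pi * (a - k)))) \<theta>0"
    have "cmod (?S K - cis (a * \<theta>0)) \<le> (cmod (E \<theta>0 (int K + 1)) + cmod (E \<theta>0 (- int K))) / (2 * pi)"
      unfolding key[OF t] norm_divide norm_of_real abs_of_pos[OF two_pi_pos]
      by (intro divide_right_mono order_trans[OF norm_triangle_ineq4]) (auto simp: norm_mult)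
    also have "\<dots> \<le> (\<bar>a\<bar> / m * (2 * pi) + \<bar>a\<bar> / m * (2 * pi)) / (2 * pi)"
      by (intro divide_right_mono add_mono Eb[OF t]) auto
    also have "\<dots> = 2 * (\<bar>a\<bar> / m)" by (simp add: field_simps)
    finally have "cmod (?S K - cis (a * \<theta>0)) \<le> 2 * (\<bar>a\<bar> / m)" .
    then show "cmod (?S K) \<le> 1 + 2 * (\<bar>a\<bar> / m)"
      using norm_triangle_ineq2[of "?S K" "cis (a * \<theta>0)"] by simp
  next
    fix \<theta>0 assume t: "\<bar>\<theta>0\<bar> \<le> \<rho>"
    let ?S = "sym_sum (\<lambda>k. complex_of_real (sinc (pi * (a - k)))) \<theta>0"
    have "(\<lambda>K. E \<theta>0 (int K + 1)) \<longlonglongrightarrow> 0"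
      unfolding E_def by (rule riemann_lebesgue_interval[OF Gm Gb[OF t], of "\<lambda>K. int K + 1"]) (auto simp: inj_def)
    then have 1: "(\<lambda>K. cis (- (real K + 1) * \<theta>0) * E \<theta>0 (int K + 1)) \<longlonglongrightarrow> 0"
      by (subst tendsto_norm_zero_iff[symmetric]) (simp add: norm_mult tendsto_norm_zero_iff)
    have "(\<lambda>K. E \<theta>0 (- int K)) \<longlonglongrightarrow> 0"
      unfolding E_def by (rule riemann_lebesgue_interval[OF Gm Gb[OF t], of "\<lambda>K. - int K"]) (auto simp: inj_def)
    then have 2: "(\<lambda>K. cis (real K * \<theta>0) * E \<theta>0 (- int K)) \<longlonglongrightarrow> 0"
      by (subst tendsto_norm_zero_iff[symmetric]) (simp add: norm_mult tendsto_norm_zero_iff)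
    have "(\<lambda>K. ?S K - cis (a * \<theta>0)) \<longlonglongrightarrow> (0 - 0) / complex_of_real (2 * pi)"
      unfolding key[OF t] by (intro tendsto_intros 1 2) auto
    then show "?S \<longlonglongrightarrow> cis (a * \<theta>0)"
      by (simp add: LIM_zero_iff)
  qed
qed

text \<open>Averaging over \<open>[-\<epsilon>, \<epsilon>]\<close> multiplies the \<open>k\<close>-th coefficient by \<open>sinc (k \<epsilon>)\<close>, whereas
  \<open>cis (a \<theta>)\<close> is an eigenfunction with eigenvalue \<open>sinc (a \<epsilon>)\<close>; so decay is gained at the cost of
  a slightly shorter interval.\<close>
lemma represents_smooth:
  fixes a \<rho> \<epsilon> :: real
  assumes "represents s a \<rho>" "0 < \<epsilon>" and nz: "sinc (a * \<epsilon>) \<noteq> 0"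
  shows "represents (\<lambda>k. s k * complex_of_real (sinc (k * \<epsilon>) / sinc (a * \<epsilon>))) a (\<rho> - \<epsilon>)"
proof -
  from assms(1) obtain B where B: "\<And>\<theta> K. \<bar>\<theta>\<bar> \<le> \<rho> \<Longrightarrow> cmod (sym_sum s \<theta> K) \<le> B"
    and lim: "\<And>\<theta>. \<bar>\<theta>\<bar> \<le> \<rho> \<Longrightarrow> sym_sum s \<theta> \<longlonglongrightarrow> cis (a * \<theta>)"
    unfolding represents_def by blast
  \<comment> \<open>The average is not normalised by its length: \<open>D\<close> is the integral of
    \<open>cis (a * u)\<close> over the window, so division by \<open>D\<close> reproduces
    \<open>cis (a * \<theta>)\<close> exactly.\<close>
  define D where "D = complex_of_real (2 * \<epsilon> * sinc (a * \<epsilon>))"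
  have D: "D \<noteq> 0" using assms nz by (auto simp: D_def)
  let ?s = "\<lambda>k. s k * complex_of_real (sinc (real_of_int k * \<epsilon>) / sinc (a * \<epsilon>))"
  have avg: "(LINT u:{-\<epsilon>..\<epsilon>}|lborel. cis (b * (\<theta> + u))) = complex_of_real (2 * \<epsilon> * sinc (b * \<epsilon>)) * cis (b * \<theta>)" for b \<theta>
    using set_integral_cis[OF \<open>0 < \<epsilon>\<close>, of b]
    by (simp add: distrib_left cis_mult[symmetric])
  have S: "sym_sum ?s \<theta> K = (LINT u:{-\<epsilon>..\<epsilon>}|lborel. sym_sum s (\<theta> + u) K) / D" for \<theta> K
  proof -
    have "(LINT u:{-\<epsilon>..\<epsilon>}|lborel. sym_sum s (\<theta> + u) K)
        = (\<Sum>k\<in>{- int K..int K}. LINT u:{-\<epsilon>..\<epsilon>}|lborel. s k * cis (real_of_int k * (\<theta> + u)))"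
      unfolding set_lebesgue_integral_def scaleR_sum_right sym_sum_def
      by (rule Bochner_Integration.integral_sum, unfold set_integrable_def[symmetric])
        (intro borel_integrable_atLeastAtMost' continuous_intros)
    also have "\<dots> = (\<Sum>k\<in>{- int K..int K}. ?s k * cis (real_of_int k * \<theta>)) * D"
      unfolding sum_distrib_right set_integral_mult_right avg using nz
      by (intro sum.cong refl) (simp add: D_def)
    finally show ?thesis using D by (simp add: sym_sum_def)
  qed
  have si: "set_integrable lborel {-\<epsilon>..\<epsilon>} (\<lambda>u. sym_sum s (\<theta> + u) K)" for \<theta> K
    unfolding sym_sum_def by (intro borel_integrable_atLeastAtMost' continuous_intros)
  show ?thesis
    unfolding represents_def
  proof (intro exI[of _ "2 * \<epsilon> * B / cmod D"] allI impI conjI)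
    fix \<theta> K assume t: "\<bar>\<theta>\<bar> \<le> \<rho> - \<epsilon>"
    have "cmod (LINT u:{-\<epsilon>..\<epsilon>}|lborel. sym_sum s (\<theta> + u) K) \<le> B * (\<epsilon> - (- \<epsilon>))"
      by (rule set_integral_Icc_norm_le[OF si]) (use t assms in \<open>auto intro!: B\<close>)
    also have "\<dots> = 2 * \<epsilon> * B" by simp
    finally show "cmod (sym_sum ?s \<theta> K) \<le> 2 * \<epsilon> * B / cmod D"
      unfolding S norm_divide by (intro divide_right_mono) auto
  next
    fix \<theta> assume t: "\<bar>\<theta>\<bar> \<le> \<rho> - \<epsilon>"
    have "(\<lambda>K. LINT u:{-\<epsilon>..\<epsilon>}|lborel. sym_sum s (\<theta> + u) K) \<longlonglongrightarrow> (LINT u:{-\<epsilon>..\<epsilon>}|lborel. cis (a * (\<theta> + u)))"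
      unfolding set_lebesgue_integral_def
    proof (rule integral_dominated_convergence[where w="\<lambda>u. indicator {-\<epsilon>..\<epsilon>} u *\<^sub>R B"])
      show "(\<lambda>u. indicator {-\<epsilon>..\<epsilon>} u *\<^sub>R cis (a * (\<theta> + u))) \<in> borel_measurable lborel"
        by (intro borel_measurable_scaleR) (auto intro!: borel_measurable_continuous_onI continuous_intros)
      show "(\<lambda>u. indicator {-\<epsilon>..\<epsilon>} u *\<^sub>R sym_sum s (\<theta> + u) K) \<in> borel_measurable lborel" for K
        using si[of \<theta> K] unfolding set_integrable_def by (rule borel_measurable_integrable)
      show "integrable lborel (\<lambda>u. indicator {-\<epsilon>..\<epsilon>} u *\<^sub>R B)"
        using borel_integrable_atLeastAtMost'[of "-\<epsilon>" \<epsilon> "\<lambda>_. B"] unfolding set_integrable_def by simp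
      show "AE u in lborel. (\<lambda>K. indicator {-\<epsilon>..\<epsilon>} u *\<^sub>R sym_sum s (\<theta> + u) K)
               \<longlonglongrightarrow> indicator {-\<epsilon>..\<epsilon>} u *\<^sub>R cis (a * (\<theta> + u))"
        using t by (auto intro!: AE_I2 lim simp: indicator_def)
      show "AE u in lborel. norm (indicator {-\<epsilon>..\<epsilon>} u *\<^sub>R sym_sum s (\<theta> + u) K) \<le> indicator {-\<epsilon>..\<epsilon>} u *\<^sub>R B" for K
        using t by (auto intro!: AE_I2 B simp: indicator_def)
    qed
    then show "sym_sum ?s \<theta> \<longlonglongrightarrow> cis (a * \<theta>)"
      unfolding S avg using D by (intro tendsto_eq_intros refl | assumption | simp add: D_def)+
  qed
qed

text \<open>One averaging factor yields one power of decay in \<open>k\<close>. For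
  \<open>k = 0\<close> the condition \<open>\<epsilon> \<le> 1\<close> makes the right-hand side at
  least 1; otherwise \<open>|sin| \<le> 1\<close>, and the 2 comes from
  \<open>1 + |k| \<le> 2 * |k|\<close>.\<close>

lemma sinc_le: 
  fixes k :: int and \<epsilon> :: real
  assumes "0 < \<epsilon>" "\<epsilon> \<le> 1"
  shows "\<bar>sinc (k * \<epsilon>)\<bar> \<le> (2 / \<epsilon>) / (1 + \<bar>real_of_int k\<bar>)"
proof (cases "k = 0")
  case False
  then have k: "1 \<le> \<bar>real_of_int k\<bar>" by linarith
  have "\<bar>sin (k * \<epsilon>)\<bar> / (\<bar>real_of_int k\<bar> * \<epsilon>) \<le> 1 / (\<bar>real_of_int k\<bar> * \<epsilon>)"
    using assms by (intro divide_right_mono) auto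
  also have "\<dots> \<le> (2 / \<epsilon>) / (1 + \<bar>real_of_int k\<bar>)"
  proof -
    have "1 / \<bar>real_of_int k\<bar> \<le> 2 / (1 + \<bar>real_of_int k\<bar>)"
      using k by (simp add: field_simps)
    from mult_right_mono[OF this, of "1 / \<epsilon>"] show ?thesis using assms by (simp add: field_simps)
  qed
  finally show ?thesis using False assms by (simp add: abs_mult)
qed (use assms in simp)

lemma abs_sinc_le_1: "\<bar>sinc x\<bar> \<le> 1"
  using abs_sin_x_le_abs_x[of x] by (auto simp: divide_le_eq)

text \<open>By the mean value theorem \<open>sinc x\<close> equals \<open>cos z\<close> for some
  \<open>z\<close> below \<open>x\<close>, and \<open>1 - cos z \<le> z\<close>. This crude bound is
  enough for small arguments.\<close>

lemma sinc_ge: 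
  fixes x :: real
  assumes "0 \<le> x" "x \<le> 1" shows "1 - x \<le> sinc x"
proof (cases "x = 0")
  case False
  then have "0 < x" using assms by simp
  from MVT2[OF this, of sin cos] obtain z where z: "0 < z" "z < x" "sin x - sin 0 = (x - 0) * cos z"
    by auto
  have "\<bar>Re (cis z - cis 0)\<bar> \<le> \<bar>z - 0\<bar>"
    by (rule order_trans[OF abs_Re_le_cmod cis_diff_le])
  then have "1 - x \<le> cos z" using z by simp
  then show ?thesis using z False by simp
qed simp

text \<open>The width \<open>1 / (2 * (M + 1))\<close> keeps \<open>M\<close> times the argument
  below \<open>1 / 2\<close>, so Bernoulli's inequality bounds the product of all \<open>M\<close>
  denominators below, independently of \<open>M\<close>.\<close>

lemma sinc_power_ge:
  assumes "0 \<le> a" "a \<le> 1"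
  shows "1 / 2 \<le> (sinc (a * (1 / (2 * (real M + 1))))) ^ M"
proof -
  define x where "x = a * (1 / (2 * (real M + 1)))"
  have "1 / (2 * (real M + 1)) \<le> 1" by (simp add: field_simps)
  then have x: "0 \<le> x" "x \<le> 1" "x \<le> 1 / (2 * (real M + 1))"
    unfolding x_def using assms mult_left_le_one_le[of "1 / (2 * (real M + 1))" a] by auto
  have "real M * x \<le> real M * (1 / (2 * (real M + 1)))" using x by (intro mult_left_mono) auto
  also have "\<dots> \<le> 1 / 2" by (simp add: field_simps)
  finally have "1 / 2 \<le> 1 + real M * (- x)" by simp
  also have "\<dots> \<le> (1 + (- x)) ^ M" by (rule Bernoulli_inequality) (use x in auto)
  also have "\<dots> \<le> (sinc x) ^ M" using sinc_ge[OF x(1,2)] x by (intro power_mono) auto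
  finally show ?thesis by (simp only: x_def)
qed

lemma represents_smooth_power:
  fixes a \<rho> \<epsilon> :: real
  assumes "represents s a \<rho>" "0 < \<epsilon>" and nz: "sinc (a * \<epsilon>) \<noteq> 0"
  shows "represents (\<lambda>k. s k * complex_of_real (sinc (k * \<epsilon>) / sinc (a * \<epsilon>)) ^ M) a (\<rho> - M * \<epsilon>)"
proof (induction M)
  case 0
  then show ?case using assms by simp
next
  case (Suc M)
  have "(\<lambda>k. s k * complex_of_real (sinc (real_of_int k * \<epsilon>) / sinc (a * \<epsilon>)) ^ Suc M)
     = (\<lambda>k. s k * complex_of_real (sinc (real_of_int k * \<epsilon>) / sinc (a * \<epsilon>)) ^ M * complex_of_real (sinc (real_of_int k * \<epsilon>) / sinc (a * \<epsilon>)))"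
    by (simp only: power_Suc2 mult.assoc)
  moreover have "\<rho> - real (Suc M) * \<epsilon> = \<rho> - real M * \<epsilon> - \<epsilon>"
    by (simp add: algebra_simps)
  ultimately show ?case
    using represents_smooth[OF Suc assms(2,3)] by (simp only:)
qed

lemma summable_on_int_bracket: "(\<lambda>k::int. 1 / (1 + \<bar>real_of_int k\<bar>)\<^sup>2) summable_on UNIV"
proof -
  have "summable (\<lambda>n::nat. 1 / (1 + real n)\<^sup>2)"
    using summable_Suc_iff[of "\<lambda>n. inverse ((real n)\<^sup>2)"] inverse_power_summable[of 2, where 'a=real]
    by (simp add: inverse_eq_divide add.commute)
  then have 1: "(\<lambda>n::nat. 1 / (1 + real n)\<^sup>2) summable_on UNIV"
    by (subst summable_on_UNIV_nonneg_real_iff) auto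
  have "(\<lambda>k::int. 1 / (1 + \<bar>real_of_int k\<bar>)\<^sup>2) summable_on range int"
    by (subst summable_on_reindex) (use 1 in \<open>auto simp: o_def inj_on_def\<close>)
  moreover have "(\<lambda>k::int. 1 / (1 + \<bar>real_of_int k\<bar>)\<^sup>2) summable_on range (\<lambda>n. - int n)"
    by (subst summable_on_reindex) (use 1 in \<open>auto simp: o_def inj_on_def\<close>)
  moreover have "range int \<union> range (\<lambda>n. - int n) = UNIV"
  proof -
    have "x \<in> range int \<union> range (\<lambda>n. - int n)" for x
      by (cases x rule: int_cases2) auto
    then show ?thesis by blast
  qed
  ultimately show ?thesis
    using summable_on_union by metis
qed

text \<open>Quadratic decay makes the series absolutely summable; its unconditional sum is then
  identified along the intervals \<open>{- K..K}\<close>, which are cofinal among the finite sets of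
  integers.\<close>

lemma represents_imp_has_sum:
  assumes "represents s a \<rho>" "\<bar>\<theta>\<bar> \<le> \<rho>" and s: "\<And>k. cmod (s k) \<le> B / (1 + \<bar>real_of_int k\<bar>)\<^sup>2"
  shows "((\<lambda>k. s k * cis (real_of_int k * \<theta>)) has_sum cis (a * \<theta>)) UNIV"
proof -
  have "(\<lambda>k. norm (s k * cis (real_of_int k * \<theta>))) summable_on UNIV"
    by (rule Infinite_Sum.abs_summable_on_comparison_test'[OF summable_on_cmult_right[OF summable_on_int_bracket, of B]])
      (use s in \<open>auto simp: norm_mult\<close>)
  then have "(\<lambda>k. s k * cis (real_of_int k * \<theta>)) summable_on UNIV"
    by (rule abs_summable_summable)
  then obtain S where S: "((\<lambda>k. s k * cis (real_of_int k * \<theta>)) has_sum S) UNIV"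
    by (auto simp: summable_on_def)
  have "filterlim (\<lambda>K::nat. {- int K..int K}) (finite_subsets_at_top UNIV) sequentially"
    unfolding filterlim_finite_subsets_at_top
  proof (intro allI impI)
    fix X :: "int set" assume "finite X \<and> X \<subseteq> UNIV"
    then obtain N where N: "\<And>x. x \<in> X \<Longrightarrow> nat \<bar>x\<bar> \<le> N"
      using finite_nat_set_iff_bounded_le[of "(\<lambda>x. nat \<bar>x\<bar>) ` X"] by auto
    show "\<forall>\<^sub>F K in sequentially. finite {- int K..int K} \<and> X \<subseteq> {- int K..int K} \<and> {- int K..int K} \<subseteq> UNIV"
      unfolding eventually_sequentially using N by (intro exI[of _ N]) force
  qed
  then have "sym_sum s \<theta> \<longlonglongrightarrow> S"
    using filterlim_compose[OF S[unfolded has_sum_def]] by (simp add: sym_sum_def[abs_def])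
  moreover have "sym_sum s \<theta> \<longlonglongrightarrow> cis (a * \<theta>)"
    using assms unfolding represents_def by blast
  ultimately show ?thesis using S LIMSEQ_unique by blast
qed

text \<open>Two groups of smoothing factors: \<open>M\<close> of fixed width fix the constant \<open>A\<close>, while further
  \<open>L + 2\<close> of width \<open>O(1 / L)\<close> improve the decay and cost only a factor 2. Thus \<open>A\<close> does not depend
  on \<open>L\<close>, which will have to exceed the order of the distribution.\<close>
lemma sampling_1d:
  fixes M :: nat
  obtains A where "0 < A" "\<And>L. \<exists>c :: int \<Rightarrow> real \<Rightarrow> complex. (\<forall>k. c k \<in> borel_measurable borel) \<and>
    (\<forall>k. \<forall>a\<in>{0..1}. cmod (c k a) \<le> A / (1 + \<bar>real_of_int k\<bar>) ^ M) \<and>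
    (\<exists>B\<ge>0. \<forall>k. \<forall>a\<in>{0..1}. cmod (c k a) \<le> B / (1 + \<bar>real_of_int k\<bar>) ^ L) \<and>
    (\<forall>a\<in>{0..1}. \<forall>\<theta>. \<bar>\<theta>\<bar> \<le> 2 \<longrightarrow> ((\<lambda>k. c k a * cis (real_of_int k * \<theta>)) has_sum cis (a * \<theta>)) UNIV)"
proof
  define w where "w M = 1 / (2 * (real M + 1))" for M
  have w: "0 < w M" "w M \<le> 1" "M * w M \<le> 1 / 2" for M
    by (auto simp: w_def field_simps)
  define d where "d M (k::int) a = (sinc (k * w M) / sinc (a * w M)) ^ M" for M k and a :: real
  have d_le: "\<bar>d M k a\<bar> \<le> 2 * \<bar>sinc (k * w M)\<bar> ^ M" if "a \<in> {0..1}" for M k a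
  proof -
    have "1 / 2 \<le> (sinc (a * w M)) ^ M"
      using sinc_power_ge[of a M] that by (simp only: w_def atLeastAtMost_iff)
    then have "1 / 2 \<le> \<bar>sinc (a * w M)\<bar> ^ M"
      unfolding power_abs[symmetric] by (rule order_trans[OF _ abs_ge_self])
    moreover have "s / x \<le> 2 * s" if "1 / 2 \<le> x" "0 \<le> s" for s x :: real
      using divide_left_mono[of "1 / 2" x s] that by simp
    ultimately have "\<bar>sinc (k * w M)\<bar> ^ M / \<bar>sinc (a * w M)\<bar> ^ M \<le> 2 * \<bar>sinc (k * w M)\<bar> ^ M"
      using zero_le_power_abs by blast
    then show ?thesis
      unfolding d_def power_abs abs_divide power_divide .
  qed
  have d1: "\<bar>d M k a\<bar> \<le> 2" if "a \<in> {0..1}" for M k a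
  proof -
    have "\<bar>sinc (k * w M)\<bar> ^ M \<le> 1"
      by (rule power_le_one[OF abs_ge_zero abs_sinc_le_1])
    then show ?thesis using d_le[OF that, of M k] by linarith
  qed
  have d2: "\<bar>d M k a\<bar> \<le> 2 * (2 / w M) ^ M / (1 + \<bar>real_of_int k\<bar>) ^ M" if "a \<in> {0..1}" for M k a
  proof -
    have "\<bar>sinc (k * w M)\<bar> ^ M \<le> ((2 / w M) / (1 + \<bar>real_of_int k\<bar>)) ^ M"
      by (rule power_mono[OF sinc_le[OF w(1,2)] abs_ge_zero])
    also have "\<dots> = (2 / w M) ^ M / (1 + \<bar>real_of_int k\<bar>) ^ M"
      by (rule power_divide)
    finally show ?thesis
      using d_le[OF that, of M k] unfolding times_divide_eq_right[symmetric] by linarith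
  qed
  \<comment> \<open>One factor 2 bounds the \<open>M\<close> denominators of the first group, the
    other bounds the whole second group through \<open>d1\<close>.\<close>
  show "0 < 4 * (2 / w M) ^ M" using w by simp
  fix L
  \<comment> \<open>The two powers of decay beyond \<open>L\<close> guarantee absolute summability
    even for \<open>L = 0\<close>.\<close>
  define c where "c k a = complex_of_real (sinc (pi * (a - real_of_int k))) * complex_of_real (d M k a) * complex_of_real (d (L + 2) k a)"
    for k a
  have n: "cmod (c k a) \<le> \<bar>d M k a\<bar> * \<bar>d (L + 2) k a\<bar>" for k a
  proof -
    have "\<bar>sinc (pi * (a - real_of_int k))\<bar> * (\<bar>d M k a\<bar> * \<bar>d (L + 2) k a\<bar>) \<le> 1 * (\<bar>d M k a\<bar> * \<bar>d (L + 2) k a\<bar>)"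
      by (rule mult_right_mono[OF abs_sinc_le_1]) simp
    then show ?thesis
      by (simp only: c_def norm_mult norm_of_real mult.assoc mult_1)
  qed
  define B where "B = 2 * (2 * (2 / w (L + 2)) ^ (L + 2))"
  have B0: "0 \<le> B" using w[of "L+2"] by (simp add: B_def)
  have cB: "cmod (c k a) \<le> B / (1 + \<bar>real_of_int k\<bar>) ^ (L + 2)" if "a \<in> {0..1}" for k a
  proof -
    have "\<bar>d M k a\<bar> * \<bar>d (L + 2) k a\<bar> \<le> 2 * (2 * (2 / w (L + 2)) ^ (L + 2) / (1 + \<bar>real_of_int k\<bar>) ^ (L + 2))"
      by (intro mult_mono d1 d2 that) auto
    then show ?thesis using n[of k a] by (simp add: B_def)
  qed
  have pow: "B / (1 + \<bar>real_of_int k\<bar>) ^ (i + j) \<le> B / (1 + \<bar>real_of_int k\<bar>) ^ i" for i j k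
    using B0 by (intro divide_left_mono power_increasing) auto
  show "\<exists>c :: int \<Rightarrow> real \<Rightarrow> complex. (\<forall>k. c k \<in> borel_measurable borel) \<and>
    (\<forall>k. \<forall>a\<in>{0..1}. cmod (c k a) \<le> 4 * (2 / w M) ^ M / (1 + \<bar>real_of_int k\<bar>) ^ M) \<and>
    (\<exists>B\<ge>0. \<forall>k. \<forall>a\<in>{0..1}. cmod (c k a) \<le> B / (1 + \<bar>real_of_int k\<bar>) ^ L) \<and>
    (\<forall>a\<in>{0..1}. \<forall>\<theta>. \<bar>\<theta>\<bar> \<le> 2 \<longrightarrow> ((\<lambda>k. c k a * cis (real_of_int k * \<theta>)) has_sum cis (a * \<theta>)) UNIV)"
  proof (intro exI[of _ c] conjI allI ballI impI)
    fix k
    show "c k \<in> borel_measurable borel"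
      unfolding c_def[abs_def] d_def by measurable
  next
    fix k and a :: real assume a: "a \<in> {0..1}"
    have "\<bar>d M k a\<bar> * \<bar>d (L + 2) k a\<bar> \<le> (2 * (2 / w M) ^ M / (1 + \<bar>real_of_int k\<bar>) ^ M) * 2"
      using w[of M] by (intro mult_mono d1 d2 a) auto
    then show "cmod (c k a) \<le> 4 * (2 / w M) ^ M / (1 + \<bar>real_of_int k\<bar>) ^ M"
      using n[of k a] by simp
  next
    show "\<exists>B\<ge>0. \<forall>k. \<forall>a\<in>{0..1}. cmod (c k a) \<le> B / (1 + \<bar>real_of_int k\<bar>) ^ L"
      using B0 cB order_trans[OF cB pow[of _ L 2]] by blast
  next
    fix a \<theta> :: real assume a: "a \<in> {0..1}" and t: "\<bar>\<theta>\<bar> \<le> 2"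
    have nz: "sinc (a * w j) \<noteq> 0" for j
    proof -
      have "1 - a * w j \<le> sinc (a * w j)"
        using a w[of j] mult_le_one[of a "w j"] by (intro sinc_ge) auto
      moreover have "a * w j \<le> 1 * (1/2)"
        unfolding w_def using a by (intro mult_mono) (auto simp: field_simps)
      ultimately show ?thesis by linarith
    qed
    \<comment> \<open>The start value 3 is below pi, and each group of smoothings shortens the
      interval by at most \<open>1 / 2\<close>. What is left contains \<open>[-2, 2]\<close>, the
      range of each coordinate of a frequency in the spectrum.\<close>
    have "represents (\<lambda>k. complex_of_real (sinc (pi * (a - real_of_int k)))) a 3"
      using pi_gt3 by (intro represents_sinc) auto
    note r1 = represents_smooth_power[OF this w(1) nz, where M = M]
    from represents_smooth_power[OF r1 w(1) nz, where M = "L + 2"]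
    have r: "represents (\<lambda>k. c k a) a (3 - M * w M - real (L + 2) * w (L + 2))"
      by (simp only: c_def d_def of_real_power)
    show "((\<lambda>k. c k a * cis (real_of_int k * \<theta>)) has_sum cis (a * \<theta>)) UNIV"
    proof (rule represents_imp_has_sum[OF r])
      show "\<bar>\<theta>\<bar> \<le> 3 - M * w M - real (L + 2) * w (L + 2)"
        using t w(3)[of M] w(3)[of "L + 2"] by linarith
      show "cmod (c k a) \<le> B / (1 + \<bar>real_of_int k\<bar>)\<^sup>2" for k
        using order_trans[OF cB[OF a, of k] pow[of k 2 L, unfolded add.commute[of 2 L]]] .
    qed
  qed
qed

section \<open>Several variables: products of one-dimensional coefficients\<close>

lemma one_plus_sum_le_prod:
  fixes f :: "'a \<Rightarrow> real"
  assumes "finite I" "\<And>i. i \<in> I \<Longrightarrow> 0 \<le> f i"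
  shows "1 + (\<Sum>i\<in>I. f i) \<le> (\<Prod>i\<in>I. 1 + f i)"
  using assms
proof (induction rule: finite_induct)
  case (insert i I)
  have "1 \<le> (\<Prod>i\<in>I. 1 + f i)"
    using insert by (intro prod_ge_1) auto
  then have "1 + f i + (\<Sum>i\<in>I. f i) \<le> (\<Prod>i\<in>I. 1 + f i) + f i * (\<Prod>i\<in>I. 1 + f i)"
    using insert mult_left_mono[of 1 "\<Prod>i\<in>I. 1 + f i" "f i"] by fastforce
  then show ?case using insert by (simp add: algebra_simps)
qed simp

lemma prod_cis: "finite I \<Longrightarrow> (\<Prod>i\<in>I. cis (f i)) = cis (\<Sum>i\<in>I. f i)"
  by (induction rule: finite_induct) (auto simp: cis_mult)

lemma abs_summable_on_fun_prod:
  fixes f :: "'n::finite \<Rightarrow> int \<Rightarrow> 'c::{real_normed_field,banach,second_countable_topology}"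
  assumes "\<And>i. (\<lambda>k. norm (f i k)) summable_on UNIV"
  shows "(\<lambda>k. norm (\<Prod>i\<in>UNIV. f i (k i))) summable_on UNIV"
proof -
  have "Infinite_Set_Sum.abs_summable_on (\<lambda>k. \<Prod>i\<in>UNIV. f i (k i)) (PiE UNIV (\<lambda>_. UNIV))"
    using assms by (intro abs_summable_on_prod_PiE) (auto simp: abs_summable_equivalent[symmetric])
  then show ?thesis
    by (simp add: abs_summable_equivalent[symmetric])
qed

text \<open>With the \<open>2 * pi\<close> in the convention of \<open>fourier\<close>, a shift by
  \<open>t\<close> acts through \<open>2 * pi * t\<close>. Side \<open>1 / (2 * pi)\<close> lets
  each coordinate of that run through \<open>[0, 1]\<close>, the parameter range of
  \<open>sampling_1d\<close>.\<close>

definition sampling_cube :: "(real^'n::finite) set" where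
  "sampling_cube = cbox 0 (\<chi> i. 1 / (2 * pi))"

lemma sampling_cube_iff: "t \<in> sampling_cube \<longleftrightarrow> (\<forall>i. 2 * pi * (t $ i) \<in> {0..1})"
proof -
  have "0 \<le> s \<and> s \<le> 1 / (2 * pi) \<longleftrightarrow> 2 * pi * s \<in> {0..1}" for s :: real
    using pi_gt_zero by (auto simp: field_simps zero_le_mult_iff simp del: pi_gt_zero)
  then show ?thesis
    unfolding sampling_cube_def mem_box_cart by (simp only: zero_index vec_lambda_beta)
qed

text \<open>The coefficients are products of those of \<open>sampling_1d\<close>, one per
  coordinate. The weight \<open>b\<close> is the product of the one-dimensional weights: decay in
  each coordinate then becomes decay in \<open>b\<close>, the sum of \<open>1 / b^2\<close>
  factorises, and \<open>b\<close> still dominates \<open>1 + norm (y j)\<close>. The lattice is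
  enumerated by naturals; absolute convergence makes the order immaterial.\<close>

lemma sampling_nd:
  fixes M :: nat
  obtains A and y :: "nat \<Rightarrow> real^'n::finite" and b where
    "0 < A" "\<And>j. 1 + norm (y j) \<le> b j" "summable (\<lambda>j. 1 / (b j)\<^sup>2)"
    "\<And>L. \<exists>c :: nat \<Rightarrow> real^'n \<Rightarrow> complex. (\<forall>j. c j \<in> borel_measurable borel) \<and>
      (\<forall>j. \<forall>t\<in>sampling_cube. cmod (c j t) \<le> A / b j ^ M) \<and>
      (\<exists>B\<ge>0. \<forall>j. \<forall>t\<in>sampling_cube. cmod (c j t) \<le> B / b j ^ L) \<and>
      (\<forall>t\<in>sampling_cube. \<forall>\<xi>. norm \<xi> \<le> 2 \<longrightarrow> (\<lambda>j. c j t * cis (2 * pi * (y j \<bullet> \<xi>))) sums cis (2 * pi * (t \<bullet> \<xi>)))"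
proof -
  obtain A1 where A1: "0 < A1" and ex: "\<And>L. \<exists>c :: int \<Rightarrow> real \<Rightarrow> complex. (\<forall>k. c k \<in> borel_measurable borel) \<and>
    (\<forall>k. \<forall>a\<in>{0..1}. cmod (c k a) \<le> A1 / (1 + \<bar>real_of_int k\<bar>) ^ M) \<and>
    (\<exists>B\<ge>0. \<forall>k. \<forall>a\<in>{0..1}. cmod (c k a) \<le> B / (1 + \<bar>real_of_int k\<bar>) ^ L) \<and>
    (\<forall>a\<in>{0..1}. \<forall>\<theta>. \<bar>\<theta>\<bar> \<le> 2 \<longrightarrow> ((\<lambda>k. c k a * cis (real_of_int k * \<theta>)) has_sum cis (a * \<theta>)) UNIV)"
    using sampling_1d[of M] by blast
  define K where "K = from_nat_into (UNIV :: ('n \<Rightarrow> int) set)"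
  have "infinite (range (\<lambda>m::int. (\<lambda>_::'n. m)))"
    by (auto dest!: finite_imageD simp: inj_on_def fun_eq_iff)
  then have inf: "infinite (UNIV :: ('n \<Rightarrow> int) set)"
    using finite_subset subset_UNIV by blast
  have K: "bij_betw K UNIV UNIV"
    unfolding K_def by (rule bij_betw_from_nat_into) (use inf in auto)
  \<comment> \<open>Dividing by \<open>2 * pi\<close> makes
    \<open>2 * pi * (y j \<bullet> \<xi>)\<close> the pairing of \<xi> with an integer vector, hence
    a sum of the phases \<open>k * \<theta>\<close> of the one-dimensional series.\<close>
  define y :: "nat \<Rightarrow> real^'n" where "y j = (\<chi> i. real_of_int (K j i) / (2 * pi))" for j
  define b where "b j = (\<Prod>i\<in>UNIV. 1 + \<bar>real_of_int (K j i)\<bar>)" for j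
  show ?thesis
  proof (rule that[of "A1 ^ CARD('n)" y b])
    show "0 < A1 ^ CARD('n)" using A1 by simp
    show "1 + norm (y j) \<le> b j" for j
    proof -
      have "norm (y j) \<le> (\<Sum>i\<in>UNIV. \<bar>y j $ i\<bar>)" by (rule norm_le_l1_cart)
      also have "\<dots> \<le> (\<Sum>i\<in>UNIV. \<bar>real_of_int (K j i)\<bar>)"
      proof (rule sum_mono)
        fix i
        have "\<bar>real_of_int (K j i)\<bar> * 1 \<le> \<bar>real_of_int (K j i)\<bar> * (2 * pi)"
          using pi_gt3 by (intro mult_left_mono) auto
        then show "\<bar>y j $ i\<bar> \<le> \<bar>real_of_int (K j i)\<bar>"
          by (simp add: y_def divide_le_eq abs_mult)
      qed
      finally show ?thesis
        using one_plus_sum_le_prod[of UNIV "\<lambda>i. \<bar>real_of_int (K j i)\<bar>"] by (simp add: b_def)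
    qed
    have "(\<lambda>k :: 'n \<Rightarrow> int. norm (\<Prod>i\<in>UNIV. 1 / (1 + \<bar>real_of_int (k i)\<bar>)\<^sup>2)) summable_on UNIV"
      by (rule abs_summable_on_fun_prod[where f = "\<lambda>i k. 1 / (1 + \<bar>real_of_int k\<bar>)\<^sup>2"])
        (use summable_on_int_bracket in simp)
    then have "(\<lambda>j. norm (\<Prod>i\<in>UNIV. 1 / (1 + \<bar>real_of_int (K j i)\<bar>)\<^sup>2)) summable_on UNIV"
      using summable_on_reindex_bij_betw[OF K] by fastforce
    then have "(\<lambda>j. 1 / (b j)\<^sup>2) summable_on UNIV"
      by (simp add: b_def prod_dividef prod_power_distrib abs_of_nonneg prod_nonneg)
    then show "summable (\<lambda>j. 1 / (b j)\<^sup>2)"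
      by (rule summable_on_imp_summable)
    fix L
    \<comment> \<open>Two powers more than requested, so that each one-dimensional series converges
      absolutely and the product of the sums may be expanded.\<close>
    from ex[of "L + 2"] obtain c B where meas: "\<And>k. c k \<in> borel_measurable borel"
      and cA: "\<And>k a. a \<in> {0..1} \<Longrightarrow> cmod (c k a) \<le> A1 / (1 + \<bar>real_of_int k\<bar>) ^ M"
      and B: "0 \<le> B" and cB: "\<And>k a. a \<in> {0..1} \<Longrightarrow> cmod (c k a) \<le> B / (1 + \<bar>real_of_int k\<bar>) ^ (L + 2)"
      and sum: "\<And>a \<theta>. a \<in> {0..1} \<Longrightarrow> \<bar>\<theta>\<bar> \<le> 2 \<Longrightarrow> ((\<lambda>k. c k a * cis (real_of_int k * \<theta>)) has_sum cis (a * \<theta>)) UNIV"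
      by blast
    define C where "C j t = (\<Prod>i\<in>UNIV. c (K j i) (2 * pi * (t $ i)))" for j and t :: "real^'n"
    have prod_le: "cmod (C j t) \<le> D ^ CARD('n) / b j ^ P"
      if "t \<in> sampling_cube" "\<And>k a. a \<in> {0..1} \<Longrightarrow> cmod (c k a) \<le> D / (1 + \<bar>real_of_int k\<bar>) ^ P" for j t D P
    proof -
      have "cmod (C j t) \<le> (\<Prod>i\<in>(UNIV::'n set). D / (1 + \<bar>real_of_int (K j i)\<bar>) ^ P)"
        unfolding C_def prod_norm[symmetric]
        using that by (intro prod_mono) (auto simp: sampling_cube_iff)
      then show ?thesis by (simp add: b_def prod_dividef prod_power_distrib)
    qed
    have cB': "cmod (c k a) \<le> B / (1 + \<bar>real_of_int k\<bar>) ^ L" if "a \<in> {0..1}" for k a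
    proof -
      have "B / (1 + \<bar>real_of_int k\<bar>) ^ (L + 2) \<le> B / (1 + \<bar>real_of_int k\<bar>) ^ L"
        using B by (intro divide_left_mono power_increasing) auto
      then show ?thesis using cB[OF that, of k] by linarith
    qed
    show "\<exists>c :: nat \<Rightarrow> real^'n \<Rightarrow> complex. (\<forall>j. c j \<in> borel_measurable borel) \<and>
      (\<forall>j. \<forall>t\<in>sampling_cube. cmod (c j t) \<le> A1 ^ CARD('n) / b j ^ M) \<and>
      (\<exists>B\<ge>0. \<forall>j. \<forall>t\<in>sampling_cube. cmod (c j t) \<le> B / b j ^ L) \<and>
      (\<forall>t\<in>sampling_cube. \<forall>\<xi>. norm \<xi> \<le> 2 \<longrightarrow> (\<lambda>j. c j t * cis (2 * pi * (y j \<bullet> \<xi>))) sums cis (2 * pi * (t \<bullet> \<xi>)))"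
    proof (intro exI[of _ C] conjI allI ballI impI)
      fix j
      show "C j \<in> borel_measurable borel"
        unfolding C_def[abs_def]
      proof (rule borel_measurable_prod)
        fix i
        have "(\<lambda>t::real^'n. 2 * pi * (t $ i)) \<in> borel_measurable borel"
          by (intro borel_measurable_continuous_onI continuous_intros)
        from measurable_compose[OF this meas]
        show "(\<lambda>t::real^'n. c (K j i) (2 * pi * (t $ i))) \<in> borel_measurable borel" .
      qed
    next
      show "cmod (C j t) \<le> A1 ^ CARD('n) / b j ^ M" if "t \<in> sampling_cube" for j t
        by (rule prod_le[OF that cA])
    next
      show "\<exists>B\<ge>0. \<forall>j. \<forall>t\<in>sampling_cube. cmod (C j t) \<le> B / b j ^ L"
        using prod_le[OF _ cB'] B zero_le_power[of B "CARD('n)"] by blast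
    next
      fix t \<xi> :: "real^'n" assume t: "t \<in> sampling_cube" and \<xi>: "norm \<xi> \<le> 2"
      define f where "f i k = c k (2 * pi * (t $ i)) * cis (real_of_int k * (\<xi> $ i))" for i k
      have t': "2 * pi * (t $ i) \<in> {0..1}" for i using t by (simp add: sampling_cube_iff)
      have \<xi>': "\<bar>\<xi> $ i\<bar> \<le> 2" for i using component_le_norm_cart[of \<xi> i] \<xi> by linarith
      have fs: "(f i has_sum cis (2 * pi * (t $ i) * (\<xi> $ i))) UNIV" for i
        unfolding f_def by (rule sum[OF t' \<xi>'])
      have fa: "(\<lambda>k. norm (f i k)) summable_on UNIV" for i
      proof (rule Infinite_Sum.abs_summable_on_comparison_test'[OF summable_on_cmult_right[OF summable_on_int_bracket, of B]])
        fix k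
        have "B / (1 + \<bar>real_of_int k\<bar>) ^ (L + 2) \<le> B / (1 + \<bar>real_of_int k\<bar>)\<^sup>2"
          using B by (intro divide_left_mono power_increasing) auto
        then show "norm (f i k) \<le> B * (1 / (1 + \<bar>real_of_int k\<bar>)\<^sup>2)"
          using cB[OF t', of k i] by (simp add: f_def norm_mult)
      qed
      have sm: "(\<lambda>k. \<Prod>i\<in>UNIV. f i (k i)) summable_on UNIV"
        by (rule abs_summable_summable[OF abs_summable_on_fun_prod[OF fa]])
      have "infsum (\<lambda>k. \<Prod>i\<in>UNIV. f i (k i)) (PiE UNIV (\<lambda>_. UNIV)) = (\<Prod>i\<in>UNIV. infsum (f i) UNIV)"
        by (rule infsum_prod_PiE) (use fs sm in \<open>auto simp: summable_on_def\<close>)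
      also have "\<dots> = (\<Prod>i\<in>UNIV. cis (2 * pi * (t $ i) * (\<xi> $ i)))"
        by (intro prod.cong refl infsumI fs)
      also have "\<dots> = cis (2 * pi * (t \<bullet> \<xi>))"
        by (simp add: prod_cis inner_vec_def sum_distrib_left mult.assoc)
      finally have "((\<lambda>k. \<Prod>i\<in>UNIV. f i (k i)) has_sum cis (2 * pi * (t \<bullet> \<xi>))) UNIV"
        using sm by (simp add: has_sum_iff)
      then have "((\<lambda>j. \<Prod>i\<in>UNIV. f i (K j i)) has_sum cis (2 * pi * (t \<bullet> \<xi>))) UNIV"
        by (subst has_sum_reindex_bij_betw[OF K])
      then have "(\<lambda>j. \<Prod>i\<in>UNIV. f i (K j i)) sums cis (2 * pi * (t \<bullet> \<xi>))"
        by (rule has_sum_imp_sums)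
      moreover have "(\<Prod>i\<in>UNIV. f i (K j i)) = C j t * cis (2 * pi * (y j \<bullet> \<xi>))" for j
        by (simp add: f_def C_def prod.distrib prod_cis y_def inner_vec_def sum_distrib_left)
      ultimately show "(\<lambda>j. C j t * cis (2 * pi * (y j \<bullet> \<xi>))) sums cis (2 * pi * (t \<bullet> \<xi>))" by simp
    qed
  qed
qed

section \<open>Schwartz functions and Fourier uniqueness\<close>

lemma pdl_append: "pdl (is @ js) f = pdl is (pdl js f)"
  by (induction "is") auto

lemma schwartz_pdl: "f \<in> schwartz \<Longrightarrow> pdl is f \<in> schwartz"
  unfolding schwartz_def mem_Collect_eq pdl_append[symmetric] by blast

lemma schwartz_differentiable: "f \<in> schwartz \<Longrightarrow> pdl is f differentiable (at x)"
  unfolding schwartz_def by blast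

lemma schwartz_continuous_on: "f \<in> schwartz \<Longrightarrow> continuous_on S f"
  using schwartz_differentiable[of f "[]"]
  by (simp add: continuous_at_imp_continuous_on differentiable_imp_continuous_within)

lemma schwartz_seminorm_bdd:
  "f \<in> schwartz \<Longrightarrow> bdd_above (range (\<lambda>x. (1 + norm x) ^ k * cmod (pdl is f x)))"
  by (rule bounded_imp_bdd_above) (simp add: schwartz_def)

lemma schwartz_seminorm_upper:
  "f \<in> schwartz \<Longrightarrow> (1 + norm x) ^ k * cmod (pdl is f x) \<le> schwartz_seminorm k is f"
  unfolding schwartz_seminorm_def by (rule cSUP_upper[OF UNIV_I schwartz_seminorm_bdd])

lemma schwartz_seminorm_nonneg: "f \<in> schwartz \<Longrightarrow> 0 \<le> schwartz_seminorm k is f"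
  using schwartz_seminorm_upper[of f 0 k "is"] by (rule order_trans[rotated]) simp_all

lemma schwartz_seminorm_least:
  "(\<And>x. (1 + norm x) ^ k * cmod (pdl is f x) \<le> C) \<Longrightarrow> schwartz_seminorm k is f \<le> C"
  unfolding schwartz_seminorm_def by (rule cSUP_least) auto

lemma schwartz_decay:
  assumes "f \<in> schwartz"
  shows "cmod (f x) \<le> schwartz_seminorm k [] f / (1 + norm x) ^ k"
  using schwartz_seminorm_upper[OF assms, of x k "[]"]
  by (subst pos_le_divide_eq) (auto intro!: zero_less_power add_pos_nonneg simp: mult.commute)

lemma pdir_sum:
  assumes "finite J" "\<And>j. j \<in> J \<Longrightarrow> f j differentiable (at x)"
  shows "pdir i (\<lambda>x. \<Sum>j\<in>J. c j * f j x) x = (\<Sum>j\<in>J. c j * pdir i (f j) x)"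
proof -
  have "((\<lambda>x. \<Sum>j\<in>J. c j * f j x) has_derivative (\<lambda>h. \<Sum>j\<in>J. c j * frechet_derivative (f j) (at x) h)) (at x)"
    using assms(2) by (intro has_derivative_sum has_derivative_mult_right) (simp add: frechet_derivative_works)
  from frechet_derivative_at[OF this] show ?thesis
    unfolding pdir_def by (rule fun_cong[OF sym])
qed

lemma pdl_sum:
  assumes "finite J" "\<And>j. j \<in> J \<Longrightarrow> f j \<in> schwartz"
  shows "pdl is (\<lambda>x. \<Sum>j\<in>J. c j * f j x) = (\<lambda>x. \<Sum>j\<in>J. c j * pdl is (f j) x)"
proof (induction "is")
  case (Cons i "is")
  show ?case
  proof
    fix x
    show "pdl (i # is) (\<lambda>x. \<Sum>j\<in>J. c j * f j x) x = (\<Sum>j\<in>J. c j * pdl (i # is) (f j) x)"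
      unfolding pdl.simps Cons.IH
      by (rule pdir_sum[OF assms(1) schwartz_differentiable[OF assms(2)]])
  qed
qed simp

lemma schwartz_sum:
  fixes f :: "'a \<Rightarrow> real^'b::finite \<Rightarrow> complex"
  assumes "finite J" "\<And>j. j \<in> J \<Longrightarrow> f j \<in> schwartz"
  shows "(\<lambda>x. \<Sum>j\<in>J. c j * f j x) \<in> schwartz"
  unfolding schwartz_def mem_Collect_eq
proof (intro conjI allI)
  fix "is" and x :: "real^'b"
  have "(\<lambda>x. \<Sum>j\<in>J. c j * pdl is (f j) x) differentiable (at x)"
    using assms schwartz_differentiable
    by (intro differentiable_sum) (auto intro!: differentiable_mult)
  then show "pdl is (\<lambda>x. \<Sum>j\<in>J. c j * f j x) differentiable (at x)"
    by (subst pdl_sum[OF assms])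
next
  fix k "is"
  have "norm ((1 + norm x) ^ k * cmod (\<Sum>j\<in>J. c j * pdl is (f j) x))
      \<le> (\<Sum>j\<in>J. cmod (c j) * schwartz_seminorm k is (f j))" for x
  proof -
    have "(1 + norm x) ^ k * cmod (\<Sum>j\<in>J. c j * pdl is (f j) x)
       \<le> (1 + norm x) ^ k * (\<Sum>j\<in>J. cmod (c j) * cmod (pdl is (f j) x))"
      by (intro mult_left_mono order_trans[OF norm_sum]) (auto simp: norm_mult)
    also have "\<dots> = (\<Sum>j\<in>J. cmod (c j) * ((1 + norm x) ^ k * cmod (pdl is (f j) x)))"
      by (simp add: sum_distrib_left mult_ac)
    also have "\<dots> \<le> (\<Sum>j\<in>J. cmod (c j) * schwartz_seminorm k is (f j))"
      using assms by (intro sum_mono mult_left_mono schwartz_seminorm_upper) auto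
    finally show ?thesis by simp
  qed
  then show "bounded (range (\<lambda>x. (1 + norm x) ^ k * cmod (pdl is (\<lambda>x. \<Sum>j\<in>J. c j * f j x) x)))"
    unfolding bounded_iff by (subst pdl_sum[OF assms]) (auto simp del: norm_mult)
qed

text \<open>The slope \<open>s\<close> may be negative: \<open>conv\<close> reflects its kernel, so
  at level \<open>v\<close> this is applied with \<open>s = - (2 ^ v)\<close>.\<close>

lemma pdl_affine:
  fixes f :: "real^'n::finite \<Rightarrow> complex"
  assumes "f \<in> schwartz"
  shows "pdl is (\<lambda>y. f (b + s *\<^sub>R y)) = (\<lambda>y. complex_of_real (s ^ length is) * pdl is f (b + s *\<^sub>R y))"
    and "(\<lambda>y. complex_of_real (s ^ length is) * pdl is f (b + s *\<^sub>R y)) differentiable (at x)"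
proof -
  have d: "((\<lambda>y. C * pdl is f (b + s *\<^sub>R y)) has_derivative
         (\<lambda>h. C * frechet_derivative (pdl is f) (at (b + s *\<^sub>R x)) (s *\<^sub>R h))) (at x)" for C x "is"
  proof -
    have 1: "(pdl is f has_derivative frechet_derivative (pdl is f) (at (b + s *\<^sub>R x))) (at (b + s *\<^sub>R x))"
      using schwartz_differentiable[OF assms] frechet_derivative_works by blast
    have 2: "((\<lambda>y. b + s *\<^sub>R y) has_derivative (\<lambda>h. s *\<^sub>R h)) (at x)"
      by (auto intro!: derivative_eq_intros)
    show ?thesis
      using has_derivative_mult_right[OF has_derivative_compose[OF 2 1], of C] .
  qed
  show "(\<lambda>y. complex_of_real (s ^ length is) * pdl is f (b + s *\<^sub>R y)) differentiable (at x)"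
    using d differentiable_def by blast
  show "pdl is (\<lambda>y. f (b + s *\<^sub>R y)) = (\<lambda>y. complex_of_real (s ^ length is) * pdl is f (b + s *\<^sub>R y))"
  proof (induction "is")
    case (Cons i "is")
    show ?case
    proof
      fix x
      have "linear (frechet_derivative (pdl is f) (at (b + s *\<^sub>R x)))"
        using linear_frechet_derivative[OF schwartz_differentiable[OF assms]] .
      then have "frechet_derivative (pdl is f) (at (b + s *\<^sub>R x)) (s *\<^sub>R axis i 1)
          = s *\<^sub>R frechet_derivative (pdl is f) (at (b + s *\<^sub>R x)) (axis i 1)"
        by (rule linear_scale)
      then show "pdl (i # is) (\<lambda>y. f (b + s *\<^sub>R y)) x = complex_of_real (s ^ length (i # is)) * pdl (i # is) f (b + s *\<^sub>R x)"
        unfolding pdl.simps Cons.IH pdir_def frechet_derivative_at[OF d, symmetric]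
        by (simp add: scaleR_conv_of_real)
    qed
  qed simp
qed

lemma norm_bracket_affine_le:
  fixes b y :: "'a::real_normed_vector"
  assumes "s \<noteq> 0"
  shows "1 + norm y \<le> (1 + 1 / \<bar>s\<bar>) * (1 + norm b) * (1 + norm (b + s *\<^sub>R y))"
proof -
  have "\<bar>s\<bar> * norm y = norm ((b + s *\<^sub>R y) - b)" by simp
  also have "\<dots> \<le> norm (b + s *\<^sub>R y) + norm b" by (rule norm_triangle_ineq4)
  also have "\<dots> \<le> (1 + norm b) * (1 + norm (b + s *\<^sub>R y))" by (simp add: algebra_simps)
  finally have "norm y \<le> (1 / \<bar>s\<bar>) * ((1 + norm b) * (1 + norm (b + s *\<^sub>R y)))"
    using assms by (simp add: field_simps)
  moreover have "1 * 1 \<le> (1 + norm b) * (1 + norm (b + s *\<^sub>R y))" by (intro mult_mono) auto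
  ultimately have "1 + norm y \<le> 1 * ((1 + norm b) * (1 + norm (b + s *\<^sub>R y))) + (1 / \<bar>s\<bar>) * ((1 + norm b) * (1 + norm (b + s *\<^sub>R y)))"
    by linarith
  then show ?thesis by (simp only: distrib_right mult.assoc)
qed

text \<open>The dependence on the shift \<open>b\<close> is polynomial of degree \<open>k\<close>. A
  distribution of finite order tested on translates thus grows at most polynomially, and this growth
  is what the sampling coefficients have to beat.\<close>

lemma schwartz_affine_bound:
  fixes f :: "real^'n::finite \<Rightarrow> complex"
  assumes "f \<in> schwartz" "s \<noteq> 0"
  shows "(1 + norm y) ^ k * cmod (pdl is f (b + s *\<^sub>R y))
           \<le> ((1 + 1 / \<bar>s\<bar>) * (1 + norm b)) ^ k * schwartz_seminorm k is f"
proof -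
  have "(1 + norm y) ^ k * cmod (pdl is f (b + s *\<^sub>R y))
     \<le> ((1 + 1 / \<bar>s\<bar>) * (1 + norm b) * (1 + norm (b + s *\<^sub>R y))) ^ k * cmod (pdl is f (b + s *\<^sub>R y))"
    by (intro mult_right_mono power_mono norm_bracket_affine_le[OF assms(2)]) auto
  also have "\<dots> = ((1 + 1 / \<bar>s\<bar>) * (1 + norm b)) ^ k * ((1 + norm (b + s *\<^sub>R y)) ^ k * cmod (pdl is f (b + s *\<^sub>R y)))"
    by (simp add: power_mult_distrib mult_ac)
  also have "\<dots> \<le> ((1 + 1 / \<bar>s\<bar>) * (1 + norm b)) ^ k * schwartz_seminorm k is f"
    by (intro mult_left_mono schwartz_seminorm_upper assms) simp
  finally show ?thesis .
qed

lemma schwartz_affine: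
  fixes f :: "real^'n::finite \<Rightarrow> complex"
  assumes "f \<in> schwartz" "s \<noteq> 0"
  shows "(\<lambda>y. f (b + s *\<^sub>R y)) \<in> schwartz"
  unfolding schwartz_def mem_Collect_eq
proof (intro conjI allI)
  fix k "is"
  have "norm ((1 + norm x) ^ k * cmod (complex_of_real (s ^ length is) * pdl is f (b + s *\<^sub>R x)))
     \<le> \<bar>s\<bar> ^ length is * (((1 + 1 / \<bar>s\<bar>) * (1 + norm b)) ^ k * schwartz_seminorm k is f)" for x
    using mult_left_mono[OF schwartz_affine_bound[OF assms, of x k "is" b], of "\<bar>s\<bar> ^ length is"]
    by (simp add: norm_mult norm_power mult_ac)
  then show "bounded (range (\<lambda>x. (1 + norm x) ^ k * cmod (pdl is (\<lambda>y. f (b + s *\<^sub>R y)) x)))"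
    unfolding bounded_iff by (subst pdl_affine(1)[OF assms(1)]) (auto simp del: norm_mult)
qed (subst pdl_affine(1)[OF assms(1)], rule pdl_affine(2)[OF assms(1)])

text \<open>Comparison with a tensor product of the functions \<open>1 / (1 + s^2)\<close>, each
  integrable on the line; the \<open>n\<close> quadratic factors explain the exponent
  \<open>2 * n\<close>.\<close>

lemma integrable_inverse_bracket:
  "integrable lborel (\<lambda>x::real^'n::finite. 1 / (1 + norm x) ^ (2 * CARD('n)))"
proof (rule Bochner_Integration.integrable_bound)
  have "(\<integral>\<^sup>+ x. (\<Prod>b\<in>Basis. ennreal (1 / (1 + (x \<bullet> b)\<^sup>2))) \<partial>(lborel :: (real^'n) measure))
     = (\<Prod>b\<in>(Basis::(real^'n) set). (\<integral>\<^sup>+ x. ennreal (1 / (1 + x\<^sup>2)) \<partial>lborel))"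
    by (rule nn_integral_lborel_prod) auto
  also have "(\<integral>\<^sup>+ x. ennreal (1 / (1 + x\<^sup>2)) \<partial>lborel) < \<infinity>"
    using integrable_inverse_1_plus_square
    by (simp add: set_integrable_def integrable_iff_bounded inverse_eq_divide)
  then have "(\<Prod>b\<in>(Basis::(real^'n) set). (\<integral>\<^sup>+ x. ennreal (1 / (1 + x\<^sup>2)) \<partial>lborel)) < \<infinity>"
    by (simp add: power_less_top_ennreal)
  finally have "(\<integral>\<^sup>+ x. ennreal (\<Prod>b\<in>Basis. 1 / (1 + (x \<bullet> b)\<^sup>2)) \<partial>(lborel :: (real^'n) measure)) < \<infinity>"
    by (simp add: prod_ennreal)
  then show "integrable lborel (\<lambda>x::real^'n. \<Prod>b\<in>Basis. 1 / (1 + (x \<bullet> b)\<^sup>2))"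
    by (intro integrableI_nonneg) (auto intro!: prod_nonneg)
  show "(\<lambda>x::real^'n. 1 / (1 + norm x) ^ (2 * CARD('n))) \<in> borel_measurable lborel"
    by (intro borel_measurable_divide) auto
  have "1 / (1 + norm x) ^ (2 * CARD('n)) \<le> (\<Prod>b\<in>Basis. 1 / (1 + (x \<bullet> b)\<^sup>2))" for x :: "real^'n"
  proof -
    have "(\<Prod>b\<in>(Basis::(real^'n) set). 1 + (x \<bullet> b)\<^sup>2) \<le> (\<Prod>b\<in>(Basis::(real^'n) set). (1 + norm x)\<^sup>2)"
    proof (rule prod_mono)
      fix b :: "real^'n" assume "b \<in> Basis"
      have "\<bar>x \<bullet> b\<bar>\<^sup>2 \<le> (norm x)\<^sup>2"
        by (intro power_mono Basis_le_norm \<open>b \<in> Basis\<close>) auto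
      then have "(x \<bullet> b)\<^sup>2 \<le> (norm x)\<^sup>2 + 2 * norm x"
        using norm_ge_zero[of x] unfolding power2_abs by linarith
      then show "0 \<le> 1 + (x \<bullet> b)\<^sup>2 \<and> 1 + (x \<bullet> b)\<^sup>2 \<le> (1 + norm x)\<^sup>2"
        by (simp add: power2_sum)
    qed
    also have "\<dots> = (1 + norm x) ^ (2 * CARD('n))"
      by (simp add: power_mult)
    finally have "1 / (1 + norm x) ^ (2 * CARD('n)) \<le> 1 / (\<Prod>b\<in>(Basis::(real^'n) set). 1 + (x \<bullet> b)\<^sup>2)"
      by (intro divide_left_mono mult_pos_pos prod_pos zero_less_power) (auto intro: add_pos_nonneg)
    then show ?thesis by (simp add: prod_dividef)
  qed
  then show "AE x::real^'n in lborel. norm (1 / (1 + norm x) ^ (2 * CARD('n))) \<le> norm (\<Prod>b\<in>Basis. 1 / (1 + (x \<bullet> b)\<^sup>2))"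
    by (intro AE_I2) (simp add: abs_of_nonneg prod_nonneg)
qed

lemma schwartz_integrable:
  fixes f :: "real^'n::finite \<Rightarrow> complex"
  assumes "f \<in> schwartz"
  shows "integrable lborel f"
proof (rule Bochner_Integration.integrable_bound[OF integrable_mult_right[OF integrable_inverse_bracket]])
  show "f \<in> borel_measurable lborel"
    using borel_measurable_continuous_onI[OF schwartz_continuous_on[OF assms]] by simp
  show "AE x in lborel. norm (f x) \<le> norm (schwartz_seminorm (2 * CARD('n)) [] f * (1 / (1 + norm x) ^ (2 * CARD('n))))"
  proof (rule AE_I2)
    fix x
    show "norm (f x) \<le> norm (schwartz_seminorm (2 * CARD('n)) [] f * (1 / (1 + norm x) ^ (2 * CARD('n))))"
      using schwartz_decay[OF assms, of x "2 * CARD('n)"] unfolding times_divide_eq_right mult_1_right real_norm_def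
      by (rule order_trans[OF _ abs_ge_self])
  qed
qed

lemma schwartz_bounded: "f \<in> schwartz \<Longrightarrow> cmod (f x) \<le> schwartz_seminorm 0 [] f"
  using schwartz_decay[of f x 0] by simp

section \<open>Gaussian integrals and uniqueness of the Fourier transform\<close>

lemma integral_lborel_prod_vec:
  fixes f :: "'n::finite \<Rightarrow> real \<Rightarrow> 'c::{real_normed_field,banach,second_countable_topology}"
  assumes "\<And>i. integrable lborel (f i)"
  shows "(LINT x|(lborel :: (real^'n) measure). (\<Prod>i\<in>UNIV. f i (x $ i))) = (\<Prod>i\<in>UNIV. integral\<^sup>L lborel (f i))"
    and "integrable (lborel :: (real^'n) measure) (\<lambda>x. \<Prod>i\<in>UNIV. f i (x $ i))"
proof -
  interpret product_sigma_finite "\<lambda>b :: real^'n. lborel :: real measure"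
    by unfold_locales
  have bij: "bij_betw (\<lambda>i. axis i (1::real)) UNIV (Basis :: (real^'n) set)"
    by (auto simp: bij_betw_def inj_on_def axis_eq_axis Basis_vec_def)
  \<comment> \<open>The product measure behind \<open>lborel\<close> is indexed by basis vectors, so
    the factors are transported from coordinates along \<open>axis i 1\<close>.\<close>
  define g where "g b = f (THE i. b = axis i 1)" for b :: "real^'n"
  have g [simp]: "g (axis i 1) = f i" for i
    unfolding g_def by (rule arg_cong[where f = f]) (auto simp: axis_eq_axis)
  have gi: "integrable lborel (g b)" for b
    using assms by (simp add: g_def)
  have prod: "(\<Prod>i\<in>UNIV. h (axis i 1)) = (\<Prod>b\<in>Basis. h b)" for h :: "real^'n \<Rightarrow> 'c"
    by (rule prod.reindex_bij_betw[OF bij])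
  have fg: "(\<Prod>i\<in>UNIV. f i (x $ i)) = (\<Prod>b\<in>Basis. g b (x \<bullet> b))" for x :: "real^'n"
    unfolding prod[symmetric] by (simp add: inner_axis)
  have meas: "(\<lambda>x :: real^'n. \<Prod>i\<in>UNIV. f i (x $ i)) \<in> borel_measurable borel"
  proof (rule borel_measurable_prod)
    fix i
    have "(\<lambda>x::real^'n. x $ i) \<in> borel_measurable borel"
      by (intro borel_measurable_continuous_onI continuous_intros)
    moreover have "f i \<in> borel_measurable borel" using borel_measurable_integrable[OF assms] by simp
    ultimately show "(\<lambda>x::real^'n. f i (x $ i)) \<in> borel_measurable borel"
      by (rule measurable_compose)
  qed
  have T: "(\<lambda>f. \<Sum>b\<in>Basis. f b *\<^sub>R b) \<in> measurable (\<Pi>\<^sub>M b\<in>(Basis :: (real^'n) set). lborel) borel"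
    by measurable
  have in': "(\<Sum>b\<in>Basis. w b *\<^sub>R b) \<bullet> c = w c" if "c \<in> Basis" for w and c :: "real^'n"
    using that by (simp add: inner_sum_left inner_Basis if_distrib cong: if_cong)
  have 1: "(LINT w|(\<Pi>\<^sub>M b\<in>(Basis :: (real^'n) set). lborel). (\<Prod>b\<in>Basis. g b (w b))) = (\<Prod>b\<in>(Basis :: (real^'n) set). integral\<^sup>L lborel (g b))"
    using gi by (intro product_integral_prod) auto
  have 2: "integrable (\<Pi>\<^sub>M b\<in>(Basis :: (real^'n) set). lborel) (\<lambda>w. \<Prod>b\<in>Basis. g b (w b))"
    using gi by (intro product_integrable_prod) auto
  show "(LINT x|(lborel :: (real^'n) measure). (\<Prod>i\<in>UNIV. f i (x $ i))) = (\<Prod>i\<in>UNIV. integral\<^sup>L lborel (f i))"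
  proof (subst lborel_eq, subst integral_distr[OF T meas])
    show "(LINT w|(\<Pi>\<^sub>M b\<in>(Basis :: (real^'n) set). lborel). (\<Prod>i\<in>UNIV. f i ((\<Sum>b\<in>Basis. w b *\<^sub>R b) $ i))) = (\<Prod>i\<in>UNIV. integral\<^sup>L lborel (f i))"
      unfolding fg using 1 prod[of "\<lambda>b. integral\<^sup>L lborel (g b)"] by (simp add: in' cong: prod.cong)
  qed
  show "integrable (lborel :: (real^'n) measure) (\<lambda>x. \<Prod>i\<in>UNIV. f i (x $ i))"
    unfolding fg
    by (subst lborel_eq, subst integrable_distr_eq[OF T]) (use meas 2 in \<open>simp_all add: fg in' cong: prod.cong\<close>)
qed

lemma std_normal_fourier:
  "(LINT s|lborel. complex_of_real (std_normal_density s) * cis (b * s)) = complex_of_real (exp (- (b\<^sup>2) / 2))"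
proof -
  have "char std_normal_distribution b = (LINT s|lborel. std_normal_density s *\<^sub>R iexp (b * s))"
    unfolding char_def by (rule integral_density) (auto intro: borel_measurable_continuous_onI continuous_intros)
  then show ?thesis
    by (simp add: char_std_normal_distribution scaleR_conv_of_real cis_conv_exp)
qed

lemma integrable_std_normal_cis: "integrable lborel (\<lambda>s. complex_of_real (std_normal_density s) * cis (b * s))"
proof (rule Bochner_Integration.integrable_bound[of lborel std_normal_density])
  show "integrable lborel std_normal_density"
    using integrable_normal_density[of 1 0] by simp
  show "(\<lambda>s. complex_of_real (std_normal_density s) * cis (b * s)) \<in> borel_measurable lborel"
    by (intro borel_measurable_times borel_measurable_of_real) (auto intro!: borel_measurable_continuous_onI continuous_intros)
qed (simp add: norm_mult)

definition gauss :: "real^'n::finite \<Rightarrow> real" where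
  "gauss x = exp (- (norm x)\<^sup>2 / 2)"

text \<open>The normalised Gaussian, kept as a product so that its Fourier integral splits into
  characteristic functions of the standard normal law. The result is the unnormalised
  \<open>gauss\<close>, whence the two functions.\<close>

definition gauss_density :: "real^'n::finite \<Rightarrow> real" where
  "gauss_density \<xi> = (\<Prod>i\<in>UNIV. std_normal_density (\<xi> $ i))"

lemma gauss_density_nonneg: "0 \<le> gauss_density \<xi>"
  by (simp add: gauss_density_def prod_nonneg)

lemma gauss_fourier:
  fixes x :: "real^'n::finite"
  shows "(LINT \<xi>|lborel. complex_of_real (gauss_density \<xi>) * cis (x \<bullet> \<xi>)) = complex_of_real (gauss x)"
proof -
  have "(LINT \<xi>|(lborel :: (real^'n) measure). complex_of_real (gauss_density \<xi>) * cis (x \<bullet> \<xi>))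
      = (LINT \<xi>|(lborel :: (real^'n) measure). (\<Prod>i\<in>UNIV. complex_of_real (std_normal_density (\<xi> $ i)) * cis (x $ i * \<xi> $ i)))"
    by (simp add: gauss_density_def prod.distrib prod_cis inner_vec_def)
  also have "\<dots> = (\<Prod>i\<in>UNIV. complex_of_real (exp (- ((x $ i)\<^sup>2) / 2)))"
    using integral_lborel_prod_vec(1)[of "\<lambda>i s. complex_of_real (std_normal_density s) * cis (x $ i * s)"]
      integrable_std_normal_cis std_normal_fourier by simp
  also have "\<dots> = complex_of_real (gauss x)"
    by (simp add: gauss_def norm_vec_def L2_set_def sum_nonneg exp_sum[symmetric] sum_divide_distrib sum_negf
        flip: of_real_prod)
  finally show ?thesis .
qed

lemma gauss_density_integrable: "integrable lborel (gauss_density :: real^'n::finite \<Rightarrow> real)"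
  unfolding gauss_density_def[abs_def]
  using integrable_normal_density[of 1 0] by (intro integral_lborel_prod_vec(2)) simp

lemma gauss_integral_pos:
  shows "integrable lborel (gauss :: real^'n::finite \<Rightarrow> real)" and "0 < (LINT x|lborel. gauss (x :: real^'n))"
proof -
  have g: "gauss x = (\<Prod>i\<in>UNIV. exp (- ((x $ i)\<^sup>2) / 2))" for x :: "real^'n"
    by (simp add: gauss_def norm_vec_def L2_set_def sum_nonneg exp_sum[symmetric] sum_divide_distrib sum_negf)
  have e: "exp (- (s\<^sup>2) / 2) = sqrt (2 * pi) * std_normal_density s" for s :: real
    by (simp add: std_normal_density_def)
  have i: "integrable lborel (\<lambda>s::real. exp (- (s\<^sup>2) / 2))"
    unfolding e using integrable_normal_density[of 1 0] by simp
  have "(LINT s|lborel. exp (- (s\<^sup>2) / 2)) = sqrt (2 * pi)"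
    unfolding e using integral_normal_density[of 1 0] by simp
  then show "integrable lborel (gauss :: real^'n \<Rightarrow> real)" "0 < (LINT x|lborel. gauss (x :: real^'n))"
    unfolding g using integral_lborel_prod_vec[of "\<lambda>_::'n. \<lambda>s. exp (- (s\<^sup>2) / 2)"] i
    by (auto simp: prod_pos)
qed

lemma lborel_integral_affine_vec:
  fixes f :: "real^'n::finite \<Rightarrow> complex"
  assumes [measurable]: "f \<in> borel_measurable borel" and "c \<noteq> 0"
  shows "(LINT x|lborel. f x) = \<bar>c\<bar> ^ CARD('n) *\<^sub>R (LINT x|lborel. f (t + c *\<^sub>R x))"
proof -
  have T: "(\<lambda>x::real^'n. t + c *\<^sub>R x) \<in> measurable lborel borel" by simp
  show ?thesis
    by (subst lborel_affine[OF \<open>c \<noteq> 0\<close>, of t])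
      (simp add: integral_density integral_distr[OF T])
qed

text \<open>Integrating \<open>fourier \<psi>\<close> against modulated Gaussian densities shows that all Gaussian averages
  of \<open>\<psi>\<close> around \<open>x0\<close> vanish; then let the width tend to 0.\<close>
lemma fourier_eq_0_imp_eq_0:
  fixes \<psi> :: "real^'n::finite \<Rightarrow> complex"
  assumes cont: "continuous_on UNIV \<psi>" and bnd: "\<And>x. cmod (\<psi> x) \<le> B" and int: "integrable lborel \<psi>"
    and F: "\<And>\<xi>. fourier \<psi> \<xi> = 0"
  shows "\<psi> x0 = 0"
proof -
  have meas [measurable]: "\<psi> \<in> borel_measurable borel"
    using cont by (rule borel_measurable_continuous_onI)
  have gd [measurable]: "(gauss_density :: real^'n \<Rightarrow> real) \<in> borel_measurable borel"
    using borel_measurable_integrable[OF gauss_density_integrable] by simp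
  have gm [measurable]: "(gauss :: real^'n \<Rightarrow> real) \<in> borel_measurable borel"
    using borel_measurable_integrable[OF gauss_integral_pos(1)] by simp
  have zero: "(LINT z|lborel. \<psi> (x0 + \<epsilon> *\<^sub>R z) * complex_of_real (gauss z)) = 0" if "0 < \<epsilon>" for \<epsilon>
  proof -
    \<comment> \<open>Integrated over \<xi>, this is \<psi> times a Gaussian of width \<epsilon>
      centred at \<open>x0\<close>; integrated over \<open>x\<close>, it is a multiple of
      \<open>fourier \<psi>\<close> at \<open>- \<xi> / (2 * pi * \<epsilon>)\<close>, hence 0.
      Fubini equates the two.\<close>
    define k where "k x \<xi> = \<psi> x * (complex_of_real (gauss_density \<xi>) * cis (((x - x0) /\<^sub>R \<epsilon>) \<bullet> \<xi>))" for x \<xi>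
    have km: "(\<lambda>(x, \<xi>). k x \<xi>) \<in> borel_measurable (lborel \<Otimes>\<^sub>M lborel)"
    proof -
      have "(\<lambda>p :: (real^'n) \<times> (real^'n). cis (((fst p - x0) /\<^sub>R \<epsilon>) \<bullet> snd p)) \<in> borel_measurable borel"
        by (intro borel_measurable_continuous_onI continuous_intros)
      then have [measurable]: "(\<lambda>p :: (real^'n) \<times> (real^'n). cis (((fst p - x0) /\<^sub>R \<epsilon>) \<bullet> snd p)) \<in> borel_measurable (lborel \<Otimes>\<^sub>M lborel)"
        by (simp add: lborel_prod)
      show ?thesis unfolding k_def case_prod_beta by measurable
    qed
    have ki: "integrable (lborel \<Otimes>\<^sub>M lborel) (\<lambda>(x, \<xi>). k x \<xi>)"
    proof (rule lborel_pair.Fubini_integrable[OF km])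
      have n: "norm (k x \<xi>) = cmod (\<psi> x) * gauss_density \<xi>" for x \<xi>
        by (simp add: k_def norm_mult gauss_density_nonneg)
      show "integrable lborel (\<lambda>x. LINT \<xi>|lborel. norm (case (x, \<xi>) of (x, \<xi>) \<Rightarrow> k x \<xi>))"
        unfolding prod.case n using int by simp
      show "AE x in lborel. integrable lborel (\<lambda>\<xi>. case (x, \<xi>) of (x, \<xi>) \<Rightarrow> k x \<xi>)"
      proof (rule AE_I2)
        fix x
        have "integrable lborel (\<lambda>\<xi>. norm (k x \<xi>))"
          unfolding n by (intro integrable_mult_right gauss_density_integrable)
        moreover have "k x \<in> borel_measurable lborel"
          using measurable_Pair2[OF km, of x] by simp
        ultimately show "integrable lborel (\<lambda>\<xi>. case (x, \<xi>) of (x, \<xi>) \<Rightarrow> k x \<xi>)"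
          unfolding prod.case by (simp add: integrable_norm_iff)
      qed
    qed
    have "(LINT x|lborel. (LINT \<xi>|lborel. k x \<xi>)) = (LINT \<xi>|lborel. (LINT x|lborel. k x \<xi>))"
      by (rule lborel_pair.Fubini_integral[OF ki, symmetric])
    moreover have "(LINT x|lborel. k x \<xi>) = 0" for \<xi>
    proof -
      define \<eta> where "\<eta> = (- 1 / (2 * pi * \<epsilon>)) *\<^sub>R \<xi>"
      have "k x \<xi> = (complex_of_real (gauss_density \<xi>) * cis (- (x0 /\<^sub>R \<epsilon>) \<bullet> \<xi>)) * (\<psi> x * cis (- 2 * pi * (x \<bullet> \<eta>)))" for x
      proof -
        have "cis (((x - x0) /\<^sub>R \<epsilon>) \<bullet> \<xi>) = cis (- (x0 /\<^sub>R \<epsilon>) \<bullet> \<xi>) * cis (- 2 * pi * (x \<bullet> \<eta>))"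
          using \<open>0 < \<epsilon>\<close> by (simp add: cis_mult \<eta>_def inner_diff_left divide_simps right_diff_distrib)
        then show ?thesis by (simp add: k_def mult_ac)
      qed
      then have "(LINT x|lborel. k x \<xi>) = (complex_of_real (gauss_density \<xi>) * cis (- (x0 /\<^sub>R \<epsilon>) \<bullet> \<xi>)) * fourier \<psi> \<eta>"
        by (simp add: fourier_def)
      then show ?thesis by (simp add: F)
    qed
    moreover have "(LINT \<xi>|lborel. k x \<xi>) = \<psi> x * complex_of_real (gauss ((x - x0) /\<^sub>R \<epsilon>))" for x
      unfolding k_def by (subst integral_mult_right_zero) (simp only: gauss_fourier)
    ultimately have "(LINT x|lborel. \<psi> x * complex_of_real (gauss ((x - x0) /\<^sub>R \<epsilon>))) = 0"
      by simp
    then have "\<bar>\<epsilon>\<bar> ^ CARD('n) *\<^sub>R (LINT z|lborel. \<psi> (x0 + \<epsilon> *\<^sub>R z) * complex_of_real (gauss ((x0 + \<epsilon> *\<^sub>R z - x0) /\<^sub>R \<epsilon>))) = 0"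
      using that by (subst (asm) lborel_integral_affine_vec[of _ \<epsilon> x0]) auto
    then show ?thesis using that by simp
  qed
  define e where "e n = 1 / (real n + 1)" for n
  have e: "0 < e n" "e \<longlonglongrightarrow> 0" for n
    unfolding e_def using LIMSEQ_inverse_real_of_nat by (simp_all add: inverse_eq_divide add.commute)
  have "(\<lambda>n. LINT z|lborel. \<psi> (x0 + e n *\<^sub>R z) * complex_of_real (gauss z)) \<longlonglongrightarrow> (LINT z|lborel. \<psi> x0 * complex_of_real (gauss (z :: real^'n)))"
  proof (rule integral_dominated_convergence[where w = "\<lambda>z. B * gauss z"])
    show "integrable lborel (\<lambda>z :: real^'n. B * gauss z)"
      by (intro integrable_mult_right gauss_integral_pos(1))
    show "AE z in lborel. (\<lambda>n. \<psi> (x0 + e n *\<^sub>R z) * complex_of_real (gauss z)) \<longlonglongrightarrow> \<psi> x0 * complex_of_real (gauss z)"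
    proof (rule AE_I2)
      fix z :: "real^'n"
      have "(\<lambda>n. x0 + e n *\<^sub>R z) \<longlonglongrightarrow> x0 + 0 *\<^sub>R z"
        by (intro tendsto_intros e)
      then have "(\<lambda>n. \<psi> (x0 + e n *\<^sub>R z)) \<longlonglongrightarrow> \<psi> x0"
        using continuous_on_tendsto_compose[OF cont, of _ x0] by simp
      then show "(\<lambda>n. \<psi> (x0 + e n *\<^sub>R z) * complex_of_real (gauss z)) \<longlonglongrightarrow> \<psi> x0 * complex_of_real (gauss z)"
        by (intro tendsto_intros)
    qed
    show "AE z in lborel. norm (\<psi> (x0 + e n *\<^sub>R z) * complex_of_real (gauss z)) \<le> B * gauss z" for n
      using bnd by (intro AE_I2) (auto simp: norm_mult gauss_def intro!: mult_right_mono)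
  qed measurable
  then have "(LINT z|lborel. \<psi> x0 * complex_of_real (gauss (z :: real^'n))) = 0"
    unfolding zero[OF e(1)] using LIMSEQ_unique tendsto_const by metis
  then show ?thesis
    using gauss_integral_pos(2)[where 'n='n] by (simp add: integral_complex_of_real)
qed

lemma lborel_integral_shift:
  fixes f :: "real^'n::finite \<Rightarrow> complex"
  assumes "f \<in> borel_measurable borel"
  shows "(LINT x|lborel. f (x + a)) = (LINT x|lborel. f x)"
  using lborel_integral_affine_vec[OF assms, of 1 a] by (simp add: add.commute)

lemma fourier_shift:
  fixes f :: "real^'n::finite \<Rightarrow> complex"
  assumes [measurable]: "f \<in> borel_measurable borel"
  shows "(LINT x|lborel. f (x + a) * cis (- 2 * pi * (x \<bullet> \<xi>))) = cis (2 * pi * (a \<bullet> \<xi>)) * fourier f \<xi>"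
proof -
  have m: "(\<lambda>x. f x * cis (- 2 * pi * (x \<bullet> \<xi>))) \<in> borel_measurable borel"
    by (intro borel_measurable_times assms) (auto intro!: borel_measurable_continuous_onI continuous_intros)
  have "(LINT x|lborel. f (x + a) * cis (- 2 * pi * (x \<bullet> \<xi>)))
      = (LINT x|lborel. cis (2 * pi * (a \<bullet> \<xi>)) * (f (x + a) * cis (- 2 * pi * ((x + a) \<bullet> \<xi>))))"
  proof (rule Bochner_Integration.integral_cong[OF refl])
    fix x
    have "cis (- 2 * pi * (x \<bullet> \<xi>)) = cis (2 * pi * (a \<bullet> \<xi>)) * cis (- 2 * pi * ((x + a) \<bullet> \<xi>))"
      by (simp add: cis_mult inner_add_left algebra_simps)
    then show "f (x + a) * cis (- 2 * pi * (x \<bullet> \<xi>)) = cis (2 * pi * (a \<bullet> \<xi>)) * (f (x + a) * cis (- 2 * pi * ((x + a) \<bullet> \<xi>)))"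
      by simp
  qed
  also have "\<dots> = cis (2 * pi * (a \<bullet> \<xi>)) * (LINT x|lborel. f (x + a) * cis (- 2 * pi * ((x + a) \<bullet> \<xi>)))"
    by simp
  also have "\<dots> = cis (2 * pi * (a \<bullet> \<xi>)) * fourier f \<xi>"
    unfolding fourier_def lborel_integral_shift[OF m] ..
  finally show ?thesis .
qed

lemma continuous_on_suminf_bounded:
  fixes f :: "nat \<Rightarrow> 'a::topological_space \<Rightarrow> 'b::banach"
  assumes "\<And>j. continuous_on S (f j)" "\<And>j x. x \<in> S \<Longrightarrow> norm (f j x) \<le> M j" "summable M"
  shows "continuous_on S (\<lambda>x. \<Sum>j. f j x)"
  by (rule uniform_limit_theorem[OF _ Weierstrass_m_test[OF assms(2,3)]])
    (auto intro!: always_eventually continuous_on_sum assms(1))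

text \<open>The difference of the two sides has Fourier transform 0: on the spectrum of
  \<open>f\<close> the identity for exponentials applies, elsewhere every term vanishes. Absolute
  summability of \<open>c\<close> makes the difference continuous, bounded and integrable, as
  uniqueness demands.\<close>

lemma sampling_schwartz:
  fixes f :: "real^'n::finite \<Rightarrow> complex" and c :: "nat \<Rightarrow> complex"
  assumes f: "f \<in> schwartz" and supp: "\<And>\<xi>. fourier f \<xi> \<noteq> 0 \<Longrightarrow> norm \<xi> \<le> 2"
    and c: "summable (\<lambda>j. cmod (c j))"
    and id: "\<And>\<xi>. norm \<xi> \<le> 2 \<Longrightarrow> (\<lambda>j. c j * cis (2 * pi * (y j \<bullet> \<xi>))) sums cis (2 * pi * (t \<bullet> \<xi>))"
  shows "(\<lambda>j. c j * f (x + y j)) sums f (x + t)"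
proof -
  define K where "K = schwartz_seminorm 0 [] f"
  have K: "cmod (f x) \<le> K" for x
    unfolding K_def by (rule schwartz_bounded[OF f])
  have fm [measurable]: "f \<in> borel_measurable borel"
    using schwartz_continuous_on[OF f] by (rule borel_measurable_continuous_onI)
  have fc: "continuous_on UNIV (\<lambda>x. f (x + a))" for a
    by (rule continuous_on_compose2[OF schwartz_continuous_on[OF f, of UNIV]]) (auto intro!: continuous_intros)
  have fi: "integrable lborel (\<lambda>x. f (x + a))" for a
    using schwartz_integrable[OF schwartz_affine[OF f, of 1 a]] by (simp add: add.commute)
  have bnd: "cmod (c j * f (x + y j)) \<le> cmod (c j) * K" for j x
    using K by (simp add: norm_mult mult_left_mono)
  have sK: "summable (\<lambda>j. cmod (c j) * K)"
    using c by (rule summable_mult2)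
  have snorm: "summable (\<lambda>j. cmod (c j * f (x + y j)))" for x
    by (rule summable_comparison_test'[OF sK, of 0]) (use bnd in auto)
  have summ: "summable (\<lambda>j. c j * f (x + y j))" for x
    using snorm by (rule summable_norm_cancel)
  define \<psi> where "\<psi> x = f (x + t) - (\<Sum>j. c j * f (x + y j))" for x
  have normint: "(LINT x|lborel. cmod (f (x + a))) = (LINT x|lborel. cmod (f x))" for a
    using lborel_integral_shift[of "\<lambda>x. complex_of_real (cmod (f x))" a] by simp
  define h where "h j \<xi> x = c j * f (x + y j) * cis (- 2 * pi * (x \<bullet> \<xi>))" for j \<xi> x
  have cism [measurable]: "(\<lambda>x::real^'n. cis (- 2 * pi * (x \<bullet> \<xi>))) \<in> borel_measurable borel" for \<xi>
    by (auto intro!: borel_measurable_continuous_onI continuous_intros)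
  have mulcis: "integrable lborel (\<lambda>x. g x * cis (- 2 * pi * (x \<bullet> \<xi>)))" if "integrable lborel g" for g :: "real^'n \<Rightarrow> complex" and \<xi>
  proof (rule Bochner_Integration.integrable_bound[OF that])
    show "(\<lambda>x. g x * cis (- 2 * pi * (x \<bullet> \<xi>))) \<in> borel_measurable lborel"
      using cism[of \<xi>] borel_measurable_integrable[OF that] by (intro borel_measurable_times) simp_all
  qed (simp add: norm_mult)
  have hi: "integrable lborel (h j \<xi>)" for j \<xi>
    unfolding h_def by (intro mulcis integrable_mult_right fi)
  have hs: "AE x in lborel. summable (\<lambda>j. norm (h j \<xi> x))" for \<xi>
    using snorm by (intro AE_I2) (simp add: h_def norm_mult)
  have hs': "summable (\<lambda>j. LINT x|lborel. norm (h j \<xi> x))" for \<xi>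
    using summable_mult2[OF c, of "LINT x|lborel. cmod (f x)"] by (simp add: h_def norm_mult normint)
  have int_sum: "integrable lborel (\<lambda>x. \<Sum>j. c j * f (x + y j))"
    using integrable_suminf[OF hi hs hs', of 0] by (simp add: h_def)
  have "\<psi> x = 0" for x
  proof (rule fourier_eq_0_imp_eq_0[where B = "K + (\<Sum>j. cmod (c j) * K)"])
    show "continuous_on UNIV \<psi>"
      unfolding \<psi>_def[abs_def]
      by (intro continuous_on_diff fc continuous_on_suminf_bounded[OF _ bnd sK] continuous_on_mult continuous_on_const)
    show "cmod (\<psi> x) \<le> K + (\<Sum>j. cmod (c j) * K)" for x
      unfolding \<psi>_def
      by (intro order_trans[OF norm_triangle_ineq4] add_mono K order_trans[OF summable_norm[OF snorm]] suminf_le bnd snorm sK)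
    show "integrable lborel \<psi>"
      unfolding \<psi>_def[abs_def] by (intro Bochner_Integration.integrable_diff fi int_sum)
    show "fourier \<psi> \<xi> = 0" for \<xi>
    proof -
      have "fourier \<psi> \<xi> = (LINT x|lborel. f (x + t) * cis (- 2 * pi * (x \<bullet> \<xi>)) - (\<Sum>j. h j \<xi> x))"
        unfolding fourier_def \<psi>_def h_def
        by (intro Bochner_Integration.integral_cong refl) (simp add: left_diff_distrib suminf_mult2[OF summ])
      also have "\<dots> = (LINT x|lborel. f (x + t) * cis (- 2 * pi * (x \<bullet> \<xi>))) - (LINT x|lborel. (\<Sum>j. h j \<xi> x))"
        by (intro Bochner_Integration.integral_diff mulcis fi integrable_suminf[OF hi hs hs'])
      also have "(LINT x|lborel. (\<Sum>j. h j \<xi> x)) = (\<Sum>j. LINT x|lborel. h j \<xi> x)"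
        by (rule integral_suminf[OF hi hs hs'])
      also have "(\<lambda>j. LINT x|lborel. h j \<xi> x) = (\<lambda>j. c j * cis (2 * pi * (y j \<bullet> \<xi>)) * fourier f \<xi>)"
        using fourier_shift[OF fm] by (simp add: h_def mult.assoc)
      also have "(LINT x|lborel. f (x + t) * cis (- 2 * pi * (x \<bullet> \<xi>))) = cis (2 * pi * (t \<bullet> \<xi>)) * fourier f \<xi>"
        by (rule fourier_shift[OF fm])
      finally have F: "fourier \<psi> \<xi> = cis (2 * pi * (t \<bullet> \<xi>)) * fourier f \<xi> - (\<Sum>j. c j * cis (2 * pi * (y j \<bullet> \<xi>)) * fourier f \<xi>)" .
      show ?thesis
      proof (cases "fourier f \<xi> = 0")
        case False
        with supp have "norm \<xi> \<le> 2" by blast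
        from sums_mult2[OF id[OF this], of "fourier f \<xi>"] show ?thesis
          unfolding F by (simp add: sums_iff)
      qed (simp add: F)
    qed
  qed
  then have "f (x + t) = (\<Sum>j. c j * f (x + y j))"
    by (simp add: \<psi>_def)
  with summ[of x] show ?thesis by (simp add: sums_iff)
qed

lemma pdir_line_derivative:
  assumes "f differentiable (at (z + s *\<^sub>R axis i 1))"
  shows "((\<lambda>s. f (z + s *\<^sub>R axis i 1)) has_derivative (\<lambda>h. of_real h * pdir i f (z + s *\<^sub>R axis i 1))) (at s)"
proof -
  let ?w = "z + s *\<^sub>R axis i 1"
  have 1: "(f has_derivative frechet_derivative f (at ?w)) (at ?w)"
    using assms frechet_derivative_works by blast
  have 2: "((\<lambda>s. z + s *\<^sub>R axis i 1) has_derivative (\<lambda>h. h *\<^sub>R axis i 1)) (at s)"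
    by (auto intro!: derivative_eq_intros)
  have "(\<lambda>h. frechet_derivative f (at ?w) (h *\<^sub>R axis i 1)) = (\<lambda>h. of_real h * pdir i f ?w)"
    unfolding pdir_def using linear_scale[OF linear_frechet_derivative[OF assms]]
    by (simp add: fun_eq_iff scaleR_conv_of_real)
  with has_derivative_compose[OF 2 1] show ?thesis by simp
qed

text \<open>Schwartz seminorms involve all derivatives, so the identity must survive
  differentiation. The differentiated series converges uniformly, \<open>pdir i f\<close> being
  bounded and \<open>c\<close> absolutely summable, which permits termwise differentiation along the
  line in direction \<open>i\<close>.\<close>

lemma sampling_pdir:
  fixes f :: "real^'n::finite \<Rightarrow> complex" and c :: "nat \<Rightarrow> complex"
  assumes f: "f \<in> schwartz" and c: "summable (\<lambda>j. cmod (c j))"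
    and id: "\<And>x. (\<lambda>j. c j * f (x + y j)) sums f (x + t)"
  shows "(\<lambda>j. c j * pdir i f (x + y j)) sums pdir i f (x + t)"
proof -
  have g: "pdir i f \<in> schwartz" using schwartz_pdl[OF f, of "[i]"] by simp
  define K where "K = schwartz_seminorm 0 [] (pdir i f)"
  have bnd: "cmod (c j * pdir i f x) \<le> cmod (c j) * K" for j x
    using schwartz_bounded[OF g, of x] by (simp add: norm_mult mult_left_mono K_def)
  have sK: "summable (\<lambda>j. cmod (c j) * K)"
    using c by (rule summable_mult2)
  let ?z = "\<lambda>s j. x + y j + s *\<^sub>R axis i 1"
  define G where "G s = (\<Sum>j. c j * pdir i f (?z s j))" for s
  have U: "uniform_limit UNIV (\<lambda>n s. \<Sum>j<n. c j * pdir i f (?z s j)) G sequentially"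
    unfolding G_def by (rule Weierstrass_m_test[OF _ sK]) (rule bnd)
  have "\<exists>g. \<forall>s\<in>UNIV. (\<lambda>j. c j * f (?z s j)) sums (g s) \<and> (g has_derivative (\<lambda>h. of_real h * G s)) (at s within UNIV)"
  proof (rule has_derivative_series[where f' = "\<lambda>j s h. c j * (of_real h * pdir i f (?z s j))"])
    show "((\<lambda>s. c j * f (?z s j)) has_derivative (\<lambda>h. c j * (of_real h * pdir i f (?z s j)))) (at s within UNIV)" for j s
      using pdir_line_derivative[OF schwartz_differentiable[OF f, of "[]", simplified]]
      by (intro has_derivative_mult_right) simp
    show "\<forall>\<^sub>F n in sequentially. \<forall>s\<in>UNIV. \<forall>h. norm ((\<Sum>j<n. c j * (of_real h * pdir i f (?z s j))) - of_real h * G s) \<le> e * norm h"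
      if "0 < e" for e
    proof -
      from uniform_limitD[OF U that] have "\<forall>\<^sub>F n in sequentially. \<forall>s. dist (\<Sum>j<n. c j * pdir i f (?z s j)) (G s) < e"
        by simp
      then show ?thesis
      proof (rule eventually_mono, intro ballI allI)
        fix n s and h :: real assume a: "\<forall>s. dist (\<Sum>j<n. c j * pdir i f (?z s j)) (G s) < e"
        have "(\<Sum>j<n. c j * (of_real h * pdir i f (?z s j))) - of_real h * G s = of_real h * ((\<Sum>j<n. c j * pdir i f (?z s j)) - G s)"
          by (simp add: right_diff_distrib sum_distrib_left mult_ac)
        moreover have "\<bar>h\<bar> * cmod ((\<Sum>j<n. c j * pdir i f (?z s j)) - G s) \<le> \<bar>h\<bar> * e"
          using a[rule_format, of s] by (intro mult_left_mono) (auto simp: dist_norm)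
        ultimately show "norm ((\<Sum>j<n. c j * (of_real h * pdir i f (?z s j))) - of_real h * G s) \<le> e * norm h"
          by (simp only: norm_mult norm_of_real real_norm_def mult.commute[of e])
      qed
    qed
    show "(\<lambda>j. c j * f (?z 0 j)) sums f (x + t)"
      using id[of x] by simp
  qed auto
  then obtain g where g: "\<And>s. (\<lambda>j. c j * f (?z s j)) sums g s" "\<And>s. (g has_derivative (\<lambda>h. of_real h * G s)) (at s)"
    by auto
  have "g = (\<lambda>s. f (x + t + s *\<^sub>R axis i 1))"
  proof
    fix s
    have "(\<lambda>j. c j * f (?z s j)) sums f (x + t + s *\<^sub>R axis i 1)"
      using id[of "x + s *\<^sub>R axis i 1"] by (simp add: add_ac)
    then show "g s = f (x + t + s *\<^sub>R axis i 1)" using g(1)[of s] sums_unique2 by blast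
  qed
  then have "(\<lambda>h. of_real h * G 0) = (\<lambda>h. of_real h * pdir i f (x + t + 0 *\<^sub>R axis i 1))"
    using has_derivative_unique[OF _ pdir_line_derivative[OF schwartz_differentiable[OF f, of "[]", simplified], where z = "x + t" and s = 0 and i = i]] g(2)[of 0]
    by blast
  from fun_cong[OF this, of 1] have "(\<Sum>j. c j * pdir i f (x + y j)) = pdir i f (x + t)"
    by (simp add: G_def)
  moreover have "summable (\<lambda>j. c j * pdir i f (x + y j))"
    by (rule summable_comparison_test'[OF sK, of 0]) (rule bnd)
  ultimately show ?thesis by (simp add: sums_iff)
qed

lemma sampling_pdl:
  fixes f :: "real^'n::finite \<Rightarrow> complex" and c :: "nat \<Rightarrow> complex"
  assumes "f \<in> schwartz" "summable (\<lambda>j. cmod (c j))" "\<And>x. (\<lambda>j. c j * f (x + y j)) sums f (x + t)"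
  shows "(\<lambda>j. c j * pdl is f (x + y j)) sums pdl is f (x + t)"
proof (induction "is" arbitrary: x)
  case (Cons i "is")
  show ?case
    using sampling_pdir[OF schwartz_pdl[OF assms(1)] assms(2) Cons.IH] by simp
qed (use assms(3) in simp)

section \<open>Sampling for tempered distributions\<close>

lemma temperedD:
  assumes "T \<in> tempered"
  shows "f \<in> schwartz \<Longrightarrow> g \<in> schwartz \<Longrightarrow> T (\<lambda>x. f x + g x) = T f + T g"
    and "f \<in> schwartz \<Longrightarrow> T (\<lambda>x. c * f x) = c * T f"
  using assms unfolding tempered_def by blast+

lemma tempered_sum:
  fixes f :: "'a \<Rightarrow> real^'n::finite \<Rightarrow> complex"
  assumes T: "T \<in> tempered" and "finite J" "\<And>j. j \<in> J \<Longrightarrow> f j \<in> schwartz" "J \<noteq> {}"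
  shows "T (\<lambda>x. \<Sum>j\<in>J. c j * f j x) = (\<Sum>j\<in>J. c j * T (f j))"
  using assms(2,4,3)
proof (induction rule: finite_ne_induct)
  case (singleton j)
  then show ?case using temperedD(2)[OF T] by simp
next
  case (insert j J)
  have "(\<lambda>x. c j * f j x) \<in> schwartz"
    using schwartz_sum[of "{j}" f c] insert by simp
  moreover have "(\<lambda>x. \<Sum>j\<in>J. c j * f j x) \<in> schwartz"
    using schwartz_sum[of J f c] insert by simp
  ultimately show ?case
    using insert temperedD[OF T] by simp
qed

text \<open>If \<open>N\<close> is the order of \<open>T\<close>, the remainders of the series tend
  to 0 in all seminorms that control \<open>T\<close>: the translate belonging to \<open>y j\<close>
  costs \<open>b j ^ N\<close>, the coefficient gains \<open>b j ^ (N + 2)\<close>, and the tail of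
  the sum of \<open>1 / b^2\<close> is left. \<open>N\<close> depends on \<open>T\<close> alone, so
  the coefficients can be chosen after it.\<close>

lemma tempered_sampling:
  fixes T :: "(real^'n::finite \<Rightarrow> complex) \<Rightarrow> complex"
  assumes T: "T \<in> tempered"
  obtains N :: nat where
    "\<And>f s x0 t y c B b. \<lbrakk>f \<in> schwartz; s \<noteq> 0; \<And>j. 1 + norm (y j) \<le> b j; summable (\<lambda>j. 1 / (b j)\<^sup>2);
       \<And>j. cmod (c j) \<le> B / b j ^ (N + 2); \<And>x. (\<lambda>j. c j * f (x + y j)) sums f (x + t)\<rbrakk>
     \<Longrightarrow> (\<lambda>j. c j * T (\<lambda>x. f (x0 + y j + s *\<^sub>R x))) sums T (\<lambda>x. f (x0 + t + s *\<^sub>R x))"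
proof -
  let ?I = "\<lambda>N. {is::'n list. length is \<le> N}"
  from T obtain C1 N where C1: "\<forall>h\<in>schwartz. cmod (T h) \<le> C1 * (\<Sum>k\<le>N. \<Sum>is\<in>?I N. schwartz_seminorm k is h)"
    unfolding tempered_def by blast
  define C where "C = \<bar>C1\<bar>"
  have C: "cmod (T h) \<le> C * (\<Sum>k\<le>N. \<Sum>is\<in>?I N. schwartz_seminorm k is h)" if "h \<in> schwartz" for h
  proof -
    have "0 \<le> (\<Sum>k\<le>N. \<Sum>is\<in>?I N. schwartz_seminorm k is h)"
      by (intro sum_nonneg schwartz_seminorm_nonneg that)
    then have "C1 * (\<Sum>k\<le>N. \<Sum>is\<in>?I N. schwartz_seminorm k is h) \<le> C * (\<Sum>k\<le>N. \<Sum>is\<in>?I N. schwartz_seminorm k is h)"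
      unfolding C_def by (intro mult_right_mono abs_ge_self)
    with bspec[OF C1 that] show ?thesis by (rule order_trans)
  qed
  have C0: "0 \<le> C" by (simp add: C_def)
  show ?thesis
  proof (rule that[of N])
    fix f :: "real^'n \<Rightarrow> complex" and s :: real and x0 t :: "real^'n" and y :: "nat \<Rightarrow> real^'n"
      and c :: "nat \<Rightarrow> complex" and B :: real and b :: "nat \<Rightarrow> real"
    assume f: "f \<in> schwartz" and s: "s \<noteq> 0" and yb: "\<And>j. 1 + norm (y j) \<le> b j"
      and sb: "summable (\<lambda>j. 1 / (b j)\<^sup>2)" and cB: "\<And>j. cmod (c j) \<le> B / b j ^ (N + 2)"
      and id: "\<And>x. (\<lambda>j. c j * f (x + y j)) sums f (x + t)"
    have b1: "1 \<le> b j" for j using yb[of j] norm_ge_zero[of "y j"] by linarith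
    have B0: "0 \<le> B"
    proof -
      have "0 \<le> B / b 0 ^ (N + 2)" by (rule order_trans[OF norm_ge_zero cB])
      moreover have "0 < b 0 ^ (N + 2)" using b1[of 0] by (intro zero_less_power) linarith
      ultimately show ?thesis using pos_le_divide_eq[of "b 0 ^ (N + 2)" 0 B] by simp
    qed
    have "summable (\<lambda>j. cmod (c j))"
    proof (rule summable_comparison_test'[OF summable_mult[OF sb, of B], of 0])
      fix j
      have "B / b j ^ (N + 2) \<le> B / b j ^ 2"
        using B0 b1[of j] by (intro divide_left_mono power_increasing) auto
      then show "norm (cmod (c j)) \<le> B * (1 / (b j)\<^sup>2)" using cB[of j] by simp
    qed
    note pid = sampling_pdl[OF f this id]
    define G where "G w = (\<lambda>x. f (x0 + w + s *\<^sub>R x))" for w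
    have G: "G w \<in> schwartz" for w unfolding G_def by (rule schwartz_affine[OF f s])
    \<comment> \<open>Index 0 carries the target, the later indices carry the negated terms of the
      series. The remainder \<open>R J\<close> is thus one finite linear combination, to which
      linearity of \<open>T\<close> and of the derivatives applies as a whole.\<close>
    define d where "d k = (case k of 0 \<Rightarrow> 1 | Suc j \<Rightarrow> - c j)" for k
    define h where "h k = (case k of 0 \<Rightarrow> G t | Suc j \<Rightarrow> G (y j))" for k
    have h: "h k \<in> schwartz" for k by (auto simp: h_def G split: nat.split)
    define R where "R J = (\<lambda>x. \<Sum>k\<in>{..<Suc J}. d k * h k x)" for J
    have RS: "R J \<in> schwartz" for J unfolding R_def by (rule schwartz_sum) (auto simp: h)
    have TR: "T (R J) = T (G t) - (\<Sum>j<J. c j * T (G (y j)))" for J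
    proof -
      have "T (R J) = (\<Sum>k\<in>{..<Suc J}. d k * T (h k))"
        unfolding R_def by (rule tempered_sum[OF T]) (auto simp: h)
      then show ?thesis
        unfolding sum.lessThan_Suc_shift by (simp add: d_def h_def sum_negf)
    qed
    define tail where "tail J = (\<Sum>j. 1 / (b (j + J))\<^sup>2)" for J
    have st: "summable (\<lambda>j. 1 / (b (j + J))\<^sup>2)" for J
      using sb by (rule summable_ignore_initial_segment)
    have tail: "tail \<longlonglongrightarrow> 0"
    proof -
      have "tail = (\<lambda>J. (\<Sum>j. 1 / (b j)\<^sup>2) - (\<Sum>j<J. 1 / (b j)\<^sup>2))"
        unfolding tail_def by (intro ext suminf_minus_initial_segment[OF sb])
      moreover have "(\<lambda>J. (\<Sum>j. 1 / (b j)\<^sup>2) - (\<Sum>j<J. 1 / (b j)\<^sup>2)) \<longlonglongrightarrow> (\<Sum>j. 1 / (b j)\<^sup>2) - (\<Sum>j. 1 / (b j)\<^sup>2)"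
        by (intro tendsto_intros summable_LIMSEQ[OF sb])
      ultimately show ?thesis by simp
    qed
    define D where "D k is = \<bar>s\<bar> ^ length is * (((1 + 1 / \<bar>s\<bar>) * (1 + norm x0)) ^ k * schwartz_seminorm k is f) * B" for k and "is" :: "'n list"
    have D0: "0 \<le> D k is" for k "is"
      unfolding D_def using B0 schwartz_seminorm_nonneg[OF f] by (intro mult_nonneg_nonneg zero_le_power) auto
    have sn: "schwartz_seminorm k is (R J) \<le> D k is * tail J" if k: "k \<le> N" for k "is" J
    proof (rule schwartz_seminorm_least)
      fix x
      let ?p = "pdl is f"
      have "pdl is (R J) x = (\<Sum>k\<in>{..<Suc J}. d k * pdl is (h k) x)"
        unfolding R_def by (subst pdl_sum) (auto simp: h)
      also have "\<dots> = of_real (s ^ length is) * (?p (x0 + t + s *\<^sub>R x) - (\<Sum>j<J. c j * ?p (x0 + y j + s *\<^sub>R x)))"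
        unfolding sum.lessThan_Suc_shift
        by (simp add: d_def h_def G_def pdl_affine(1)[OF f] sum_negf right_diff_distrib sum_distrib_left mult_ac)
      finally have 1: "pdl is (R J) x = of_real (s ^ length is) * (?p (x0 + t + s *\<^sub>R x) - (\<Sum>j<J. c j * ?p (x0 + y j + s *\<^sub>R x)))" .
      have 2: "(\<lambda>j. c j * ?p (x0 + y j + s *\<^sub>R x)) sums ?p (x0 + t + s *\<^sub>R x)"
        using pid[of "is" "x0 + s *\<^sub>R x"] by (simp add: add_ac)
      \<comment> \<open>The sampling identity for the derivative turns the remainder into a tail,
        which can be estimated term by term.\<close>
      have 3: "?p (x0 + t + s *\<^sub>R x) - (\<Sum>j<J. c j * ?p (x0 + y j + s *\<^sub>R x)) = (\<Sum>j. c (j + J) * ?p (x0 + y (j + J) + s *\<^sub>R x))"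
        using suminf_minus_initial_segment[OF sums_summable[OF 2], of J] sums_unique[OF 2] by simp
      have 4: "(1 + norm x) ^ k * cmod (c j * ?p (x0 + y j + s *\<^sub>R x))
          \<le> ((1 + 1 / \<bar>s\<bar>) * (1 + norm x0)) ^ k * schwartz_seminorm k is f * B * (1 / (b j)\<^sup>2)" for j
      proof -
        have "1 + norm (x0 + y j) \<le> (1 + norm x0) * (1 + norm (y j))"
          using norm_triangle_ineq[of x0 "y j"] mult_nonneg_nonneg[OF norm_ge_zero[of x0] norm_ge_zero[of "y j"]]
          unfolding distrib_left distrib_right mult_1_left mult_1_right by linarith
        also have "\<dots> \<le> (1 + norm x0) * b j" by (intro mult_left_mono yb) auto
        finally have nb: "1 + norm (x0 + y j) \<le> (1 + norm x0) * b j" .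
        have "(1 + norm x) ^ k * cmod (?p (x0 + y j + s *\<^sub>R x)) \<le> ((1 + 1 / \<bar>s\<bar>) * (1 + norm (x0 + y j))) ^ k * schwartz_seminorm k is f"
          by (rule schwartz_affine_bound[OF f s])
        also have "\<dots> \<le> ((1 + 1 / \<bar>s\<bar>) * ((1 + norm x0) * b j)) ^ k * schwartz_seminorm k is f"
          by (intro mult_right_mono power_mono mult_left_mono nb schwartz_seminorm_nonneg f mult_nonneg_nonneg) auto
        also have "\<dots> = ((1 + 1 / \<bar>s\<bar>) * (1 + norm x0)) ^ k * schwartz_seminorm k is f * b j ^ k"
          by (simp add: power_mult_distrib mult_ac)
        also have "\<dots> \<le> ((1 + 1 / \<bar>s\<bar>) * (1 + norm x0)) ^ k * schwartz_seminorm k is f * b j ^ N"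
          using schwartz_seminorm_nonneg[OF f, of k "is"] k b1 by (intro mult_left_mono power_increasing) auto
        finally have 5: "(1 + norm x) ^ k * cmod (?p (x0 + y j + s *\<^sub>R x)) \<le> ((1 + 1 / \<bar>s\<bar>) * (1 + norm x0)) ^ k * schwartz_seminorm k is f * b j ^ N" .
        have "cmod (c j) * ((1 + norm x) ^ k * cmod (?p (x0 + y j + s *\<^sub>R x)))
            \<le> (B / b j ^ (N + 2)) * (((1 + 1 / \<bar>s\<bar>) * (1 + norm x0)) ^ k * schwartz_seminorm k is f * b j ^ N)"
          using B0 b1[of j] by (intro mult_mono cB 5) auto
        also have "\<dots> = ((1 + 1 / \<bar>s\<bar>) * (1 + norm x0)) ^ k * schwartz_seminorm k is f * B * (1 / (b j)\<^sup>2)"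
          using b1[of j] by (simp add: power_add power2_eq_square mult_ac)
        finally show ?thesis by (simp add: norm_mult mult_ac)
      qed
      let ?E = "((1 + 1 / \<bar>s\<bar>) * (1 + norm x0)) ^ k * schwartz_seminorm k is f * B"
      have 6: "summable (\<lambda>j. (1 + norm x) ^ k * cmod (c (j + J) * ?p (x0 + y (j + J) + s *\<^sub>R x)))"
        by (rule summable_comparison_test'[OF summable_mult[OF st[of J], of ?E], of 0]) (use 4 in \<open>simp add: abs_mult\<close>)
      have 7: "summable (\<lambda>j. cmod (c (j + J) * ?p (x0 + y (j + J) + s *\<^sub>R x)))"
      proof -
        have "(1 + norm x) ^ k \<noteq> 0" using norm_ge_zero[of x] by (simp add: add_nonneg_eq_0_iff)
        then show ?thesis using 6 summable_cmult_iff by blast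
      qed
      have "(1 + norm x) ^ k * cmod (\<Sum>j. c (j + J) * ?p (x0 + y (j + J) + s *\<^sub>R x))
          \<le> (1 + norm x) ^ k * (\<Sum>j. cmod (c (j + J) * ?p (x0 + y (j + J) + s *\<^sub>R x)))"
        by (intro mult_left_mono summable_norm 7) auto
      also have "\<dots> = (\<Sum>j. (1 + norm x) ^ k * cmod (c (j + J) * ?p (x0 + y (j + J) + s *\<^sub>R x)))"
        by (rule suminf_mult[OF 7, symmetric])
      also have "\<dots> \<le> (\<Sum>j. ?E * (1 / (b (j + J))\<^sup>2))"
        by (intro suminf_le 4 6 summable_mult st)
      also have "\<dots> = ?E * tail J"
        unfolding tail_def by (rule suminf_mult[OF st])
      finally have 8: "(1 + norm x) ^ k * cmod (\<Sum>j. c (j + J) * ?p (x0 + y (j + J) + s *\<^sub>R x)) \<le> ?E * tail J" .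
      have "(1 + norm x) ^ k * cmod (pdl is (R J) x) = \<bar>s\<bar> ^ length is * ((1 + norm x) ^ k * cmod (\<Sum>j. c (j + J) * ?p (x0 + y (j + J) + s *\<^sub>R x)))"
        unfolding 1 3 norm_mult norm_of_real power_abs by (simp only: mult_ac)
      also have "\<dots> \<le> \<bar>s\<bar> ^ length is * (?E * tail J)"
        by (intro mult_left_mono 8) auto
      finally show "(1 + norm x) ^ k * cmod (pdl is (R J) x) \<le> D k is * tail J"
        by (simp only: D_def mult_ac)
    qed
    define DD where "DD = C * (\<Sum>k\<le>N. \<Sum>is\<in>?I N. D k is)"
    have "cmod (T (R J)) \<le> DD * tail J" for J
    proof -
      have "cmod (T (R J)) \<le> C * (\<Sum>k\<le>N. \<Sum>is\<in>?I N. D k is * tail J)"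
        by (intro order_trans[OF C[OF RS]] mult_left_mono C0 sum_mono sn) auto
      then show ?thesis by (simp add: DD_def sum_distrib_right mult.assoc)
    qed
    moreover have "(\<lambda>J. DD * tail J) \<longlonglongrightarrow> 0"
      using tendsto_mult_right_zero[OF tail] .
    ultimately have "(\<lambda>J. T (R J)) \<longlonglongrightarrow> 0"
      by (intro Lim_null_comparison[of "\<lambda>J. T (R J)" "\<lambda>J. DD * tail J"]) (auto intro: always_eventually)
    then have "(\<lambda>J. T (G t) - T (R J)) \<longlonglongrightarrow> T (G t) - 0"
      by (intro tendsto_intros)
    then show "(\<lambda>j. c j * T (\<lambda>x. f (x0 + y j + s *\<^sub>R x))) sums T (\<lambda>x. f (x0 + t + s *\<^sub>R x))"
      unfolding TR sums_def G_def by simp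
  qed
qed

text \<open>Levels 0 and \<open>v \<ge> 1\<close> are brought to one form: the dilation by
  \<open>2 ^ 0\<close> is trivial, and both generators have their spectrum in the ball of radius 2,
  where the sampling identity is valid.\<close>

lemma admissible_phi_v:
  assumes "admissible_pair Phi (phi :: real^'n::finite \<Rightarrow> complex)"
  obtains f where "f \<in> schwartz" "\<And>\<xi>. fourier f \<xi> \<noteq> 0 \<Longrightarrow> norm \<xi> \<le> 2"
    "phi_v Phi phi v = (\<lambda>x. complex_of_real (2 ^ (v * CARD('n))) * f (2 ^ v *\<^sub>R x))"
proof (cases "v = 0")
  case True
  then show ?thesis using assms that[of Phi] by (auto simp: admissible_pair_def phi_v_def)
next
  case False
  then show ?thesis using assms that[of phi] by (auto simp: admissible_pair_def phi_v_def)
qed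

text \<open>The order of quantifiers is the point: \<open>A\<close>, the nodes and \<open>b\<close>
  precede \<open>v\<close> and \<open>T\<close>, whereas \<open>c\<close> may depend on both.
  Uniformity in \<open>v\<close> comes from dilation, since after scaling by \<open>2 ^ v\<close>
  every level has its spectrum in the same ball.\<close>

lemma conv_sampling:
  fixes Phi phi :: "real^'n::finite \<Rightarrow> complex" and M :: nat
  assumes adm: "admissible_pair Phi phi"
  obtains A and y :: "nat \<Rightarrow> real^'n" and b where
    "0 < A" "\<And>j. 1 + norm (y j) \<le> b j" "summable (\<lambda>j. 1 / (b j)\<^sup>2)"
    "\<And>v T. T \<in> tempered \<Longrightarrow> \<exists>c :: nat \<Rightarrow> real^'n \<Rightarrow> complex. (\<forall>j. c j \<in> borel_measurable borel) \<and>
      (\<forall>j. \<forall>t\<in>sampling_cube. cmod (c j t) \<le> A / b j ^ M) \<and>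
      (\<forall>x. \<forall>t\<in>sampling_cube. (\<lambda>j. c j t * conv (phi_v Phi phi v) T (x + (1 / 2 ^ v) *\<^sub>R y j))
          sums conv (phi_v Phi phi v) T (x + (1 / 2 ^ v) *\<^sub>R t))"
proof -
  obtain A and y :: "nat \<Rightarrow> real^'n" and b where
    A: "0 < A" and yb: "\<And>j. 1 + norm (y j) \<le> b j" and sb: "summable (\<lambda>j. 1 / (b j)\<^sup>2)" and
    ex: "\<And>L. \<exists>c :: nat \<Rightarrow> real^'n \<Rightarrow> complex. (\<forall>j. c j \<in> borel_measurable borel) \<and>
      (\<forall>j. \<forall>t\<in>sampling_cube. cmod (c j t) \<le> A / b j ^ M) \<and>
      (\<exists>B\<ge>0. \<forall>j. \<forall>t\<in>sampling_cube. cmod (c j t) \<le> B / b j ^ L) \<and>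
      (\<forall>t\<in>sampling_cube. \<forall>\<xi>. norm \<xi> \<le> 2 \<longrightarrow> (\<lambda>j. c j t * cis (2 * pi * (y j \<bullet> \<xi>))) sums cis (2 * pi * (t \<bullet> \<xi>)))"
    using sampling_nd[of M] by blast
  have b1: "1 \<le> b j" for j using yb[of j] norm_ge_zero[of "y j"] by linarith
  show ?thesis
  proof (rule that[OF A yb sb])
    fix v and T :: "(real^'n \<Rightarrow> complex) \<Rightarrow> complex" assume T: "T \<in> tempered"
    obtain f where f: "f \<in> schwartz" and supp: "\<And>\<xi>. fourier f \<xi> \<noteq> 0 \<Longrightarrow> norm \<xi> \<le> 2"
      and phi: "phi_v Phi phi v = (\<lambda>x. complex_of_real (2 ^ (v * CARD('n))) * f (2 ^ v *\<^sub>R x))"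
      using admissible_phi_v[OF adm, of v] by blast
    \<comment> \<open>A shift of \<open>x\<close> by \<open>2^(-v) * y\<close> becomes a shift of
      the argument of \<open>f\<close> by \<open>y\<close>, so one set of unscaled nodes serves all
      levels.\<close>
    have conv: "conv (phi_v Phi phi v) T x = complex_of_real (2 ^ (v * CARD('n))) * T (\<lambda>z. f (2 ^ v *\<^sub>R x + (- (2 ^ v)) *\<^sub>R z))" for x
    proof -
      have "conv (phi_v Phi phi v) T x = T (\<lambda>z. complex_of_real (2 ^ (v * CARD('n))) * f (2 ^ v *\<^sub>R x + (- (2 ^ v)) *\<^sub>R z))"
        by (simp add: conv_def phi scaleR_diff_right)
      also have "\<dots> = complex_of_real (2 ^ (v * CARD('n))) * T (\<lambda>z. f (2 ^ v *\<^sub>R x + (- (2 ^ v)) *\<^sub>R z))"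
        by (rule temperedD(2)[OF T schwartz_affine[OF f]]) simp
      finally show ?thesis .
    qed
    obtain N where N: "\<And>f s w t y c B b. \<lbrakk>f \<in> schwartz; s \<noteq> 0; \<And>j. 1 + norm (y j) \<le> b j; summable (\<lambda>j. 1 / (b j)\<^sup>2);
       \<And>j. cmod (c j) \<le> B / b j ^ (N + 2); \<And>x. (\<lambda>j. c j * f (x + y j)) sums f (x + t)\<rbrakk>
     \<Longrightarrow> (\<lambda>j. c j * T (\<lambda>x. f (w + y j + s *\<^sub>R x))) sums T (\<lambda>x. f (w + t + s *\<^sub>R x))"
      using tempered_sampling[OF T] by blast
    \<comment> \<open>\<open>N\<close> is the order of \<open>T\<close>. The constant
      \<open>B\<close> belonging to it is used for convergence only and does not appear in the
      conclusion.\<close>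
    from ex[of "N + 2"] obtain c B where c: "\<And>j. c j \<in> borel_measurable borel"
      "\<And>j t. t \<in> sampling_cube \<Longrightarrow> cmod (c j t) \<le> A / b j ^ M" and "0 \<le> B"
      and cB: "\<And>j t. t \<in> sampling_cube \<Longrightarrow> cmod (c j t) \<le> B / b j ^ (N + 2)"
      and id: "\<And>t \<xi>. t \<in> sampling_cube \<Longrightarrow> norm \<xi> \<le> 2 \<Longrightarrow> (\<lambda>j. c j t * cis (2 * pi * (y j \<bullet> \<xi>))) sums cis (2 * pi * (t \<bullet> \<xi>))"
      by blast
    have "(\<lambda>j. c j t * conv (phi_v Phi phi v) T (x + (1 / 2 ^ v) *\<^sub>R y j)) sums conv (phi_v Phi phi v) T (x + (1 / 2 ^ v) *\<^sub>R t)"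
      if t: "t \<in> sampling_cube" for x t
    proof -
      have "summable (\<lambda>j. cmod (c j t))"
      proof (rule summable_comparison_test'[OF summable_mult[OF sb, of B], of 0])
        fix j
        have "B / b j ^ (N + 2) \<le> B / b j ^ 2"
          using \<open>0 \<le> B\<close> b1[of j] by (intro divide_left_mono power_increasing) auto
        then show "norm (cmod (c j t)) \<le> B * (1 / (b j)\<^sup>2)" using cB[OF t, of j] by simp
      qed
      from sampling_schwartz[OF f supp this id[OF t]]
      have "(\<lambda>j. c j t * f (z + y j)) sums f (z + t)" for z .
      from N[OF f _ yb sb cB[OF t] this, where s = "- (2 ^ v)" and w = "2 ^ v *\<^sub>R x"]
      have "(\<lambda>j. c j t * T (\<lambda>z. f (2 ^ v *\<^sub>R x + y j + (- (2 ^ v)) *\<^sub>R z))) sums T (\<lambda>z. f (2 ^ v *\<^sub>R x + t + (- (2 ^ v)) *\<^sub>R z))"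
        by simp
      from sums_mult[OF this, of "complex_of_real (2 ^ (v * CARD('n)))"] show ?thesis
        unfolding conv by (simp add: scaleR_add_right mult.left_commute)
    qed
    with c show "\<exists>c :: nat \<Rightarrow> real^'n \<Rightarrow> complex. (\<forall>j. c j \<in> borel_measurable borel) \<and>
      (\<forall>j. \<forall>t\<in>sampling_cube. cmod (c j t) \<le> A / b j ^ M) \<and>
      (\<forall>x. \<forall>t\<in>sampling_cube. (\<lambda>j. c j t * conv (phi_v Phi phi v) T (x + (1 / 2 ^ v) *\<^sub>R y j))
          sums conv (phi_v Phi phi v) T (x + (1 / 2 ^ v) *\<^sub>R t))"
      by blast
  qed
qed

section \<open>Measurability of the convolution, and tools for powers and integrals\<close>

lemma sampling_cube_sets [measurable]: "sampling_cube \<in> sets borel"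
  by (simp add: sampling_cube_def)

text \<open>On a translate of the scaled cube, the sampling formula based at its corner writes the
  convolution as a limit of combinations of the measurable \<open>c j\<close>, with fixed values at
  the nodes as coefficients. Countably many such cubes cover the space.\<close>

lemma conv_measurable:
  fixes Phi phi :: "real^'n::finite \<Rightarrow> complex"
  assumes adm: "admissible_pair Phi phi" and T: "T \<in> tempered"
  shows "conv (phi_v Phi phi v) T \<in> borel_measurable borel"
proof -
  define u where "u = conv (phi_v Phi phi v) T"
  obtain A :: real and y :: "nat \<Rightarrow> real^'n" and b :: "nat \<Rightarrow> real" where
    ex: "\<And>v T. T \<in> tempered \<Longrightarrow> \<exists>c :: nat \<Rightarrow> real^'n \<Rightarrow> complex. (\<forall>j. c j \<in> borel_measurable borel) \<and>
      (\<forall>j. \<forall>t\<in>sampling_cube. cmod (c j t) \<le> A / b j ^ 0) \<and>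
      (\<forall>x. \<forall>t\<in>sampling_cube. (\<lambda>j. c j t * conv (phi_v Phi phi v) T (x + (1 / 2 ^ v) *\<^sub>R y j))
          sums conv (phi_v Phi phi v) T (x + (1 / 2 ^ v) *\<^sub>R t))"
    by (rule conv_sampling[OF adm, where M = 0]) blast
  from ex[OF T, of v] obtain c where c: "\<And>j. c j \<in> borel_measurable borel" and
    id: "\<And>x t. t \<in> sampling_cube \<Longrightarrow> (\<lambda>j. c j t * u (x + (1 / 2 ^ v) *\<^sub>R y j)) sums u (x + (1 / 2 ^ v) *\<^sub>R t)"
    unfolding u_def by blast
  define x0 :: "('n \<Rightarrow> int) \<Rightarrow> real^'n" where "x0 k = (\<chi> i. real_of_int (k i) / (2 * pi * 2 ^ v))" for k
  define \<Omega> where "\<Omega> k = (\<lambda>x. 2 ^ v *\<^sub>R (x - x0 k)) -` sampling_cube" for k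
  have sh: "(\<lambda>x. 2 ^ v *\<^sub>R (x - x0 k)) \<in> borel_measurable borel" for k
    by simp
  have \<Omega>: "\<Omega> k \<in> sets borel" for k
    using measurable_sets[OF sh sampling_cube_sets] by (simp add: \<Omega>_def)
  have "u \<in> borel_measurable borel"
  proof (rule measurable_piecewise_restrict[where C = "range \<Omega>"])
    show "countable (range \<Omega>)" by simp
    show "space borel \<subseteq> \<Union> (range \<Omega>)"
    proof
      fix x :: "real^'n"
      define k where "k i = \<lfloor>2 * pi * 2 ^ v * x $ i\<rfloor>" for i
      have "2 * pi * ((2 ^ v *\<^sub>R (x - x0 k)) $ i) = 2 * pi * 2 ^ v * x $ i - real_of_int (k i)" for i
        by (simp add: x0_def field_simps)
      moreover have "2 * pi * 2 ^ v * x $ i - real_of_int (k i) \<in> {0..1}" for i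
        unfolding k_def atLeastAtMost_iff by linarith
      ultimately have "2 ^ v *\<^sub>R (x - x0 k) \<in> sampling_cube"
        by (simp add: sampling_cube_iff)
      then show "x \<in> \<Union> (range \<Omega>)" by (auto simp: \<Omega>_def)
    qed
    fix X assume "X \<in> range \<Omega>"
    then obtain k where X: "X = \<Omega> k" by auto
    show "X \<inter> space borel \<in> sets borel" using \<Omega> by (simp add: X)
    define P where "P J x = (\<Sum>j<J. c j (2 ^ v *\<^sub>R (x - x0 k)) * u (x0 k + (1 / 2 ^ v) *\<^sub>R y j))" for J x
    have "P J \<in> borel_measurable borel" for J
      unfolding P_def by (intro borel_measurable_sum borel_measurable_times measurable_compose[OF sh c] borel_measurable_const)
    then have "P J \<in> borel_measurable (restrict_space borel X)" for J
      by (rule measurable_restrict_space1)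
    moreover have "(\<lambda>J. P J x) \<longlonglongrightarrow> u x" if "x \<in> space (restrict_space borel X)" for x
    proof -
      have "2 ^ v *\<^sub>R (x - x0 k) \<in> sampling_cube" using that by (simp add: space_restrict_space X \<Omega>_def)
      from id[OF this, of "x0 k"] show ?thesis by (simp add: sums_def P_def)
    qed
    ultimately show "u \<in> borel_measurable (restrict_space borel X)"
      by (rule borel_measurable_LIMSEQ_metric)
  qed
  then show ?thesis by (simp add: u_def)
qed

text \<open>For two summands divide by their sum: the quotients lie in \<open>[0, 1]\<close> and add
  up to 1, and \<open>q \<le> q powr r\<close> there.\<close>

lemma powr_sum_le:
  fixes a :: "'a \<Rightarrow> real"
  assumes "finite J" "\<And>j. j \<in> J \<Longrightarrow> 0 \<le> a j" "0 < r" "r \<le> 1"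
  shows "(\<Sum>j\<in>J. a j) powr r \<le> (\<Sum>j\<in>J. a j powr r)"
  using assms(1,2)
proof (induction rule: finite_induct)
  case (insert j J)
  have two: "(s + t) powr r \<le> s powr r + t powr r" if "0 \<le> s" "0 \<le> t" for s t :: real
  proof (cases "s + t = 0")
    case False
    then have st: "0 < s + t" using that by simp
    have le: "q \<le> q powr r" if "0 \<le> q" "q \<le> 1" for q :: real
      using powr_mono'[of r 1 q] that assms by (cases "q = 0") auto
    have "(s + t) powr r * 1 = (s + t) powr r * (s / (s + t) + t / (s + t))"
      using st by (simp add: add_divide_distrib[symmetric])
    also have "\<dots> \<le> (s + t) powr r * ((s / (s + t)) powr r + (t / (s + t)) powr r)"
      using that st by (intro mult_left_mono add_mono le) auto
    also have "\<dots> = s powr r + t powr r"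
      using that st by (simp add: powr_divide distrib_left)
    finally show ?thesis by simp
  qed (use that in simp)
  have "(\<Sum>i\<in>insert j J. a i) powr r \<le> a j powr r + (\<Sum>i\<in>J. a i) powr r"
    using insert by (simp add: two sum_nonneg)
  also have "\<dots> \<le> a j powr r + (\<Sum>i\<in>J. a i powr r)"
    using insert by (intro add_left_mono) auto
  finally show ?case using insert by simp
qed simp

text \<open>Values in \<open>ennreal\<close> because the series of powers may diverge although
  \<open>z\<close> is summable.\<close>

lemma ennreal_powr_sums_le:
  fixes z :: "nat \<Rightarrow> complex"
  assumes "z sums S" "0 < r" "r \<le> 1"
  shows "ennreal (cmod S powr r) \<le> (\<Sum>j. ennreal (cmod (z j) powr r))"
proof (rule LIMSEQ_le_const2)
  have "(\<lambda>J. cmod (\<Sum>j<J. z j) powr r) \<longlonglongrightarrow> cmod S powr r"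
    using assms by (intro tendsto_powr' tendsto_norm tendsto_const) (auto simp: sums_def)
  then show "(\<lambda>J. ennreal (cmod (\<Sum>j<J. z j) powr r)) \<longlonglongrightarrow> ennreal (cmod S powr r)"
    by (rule tendsto_ennrealI)
  have "ennreal (cmod (\<Sum>j<J. z j) powr r) \<le> (\<Sum>j. ennreal (cmod (z j) powr r))" for J
  proof -
    have "cmod (\<Sum>j<J. z j) powr r \<le> (\<Sum>j<J. cmod (z j)) powr r"
      using assms by (intro powr_mono2 norm_sum) auto
    also have "\<dots> \<le> (\<Sum>j<J. cmod (z j) powr r)"
      using assms by (intro powr_sum_le) auto
    finally have "ennreal (cmod (\<Sum>j<J. z j) powr r) \<le> (\<Sum>j<J. ennreal (cmod (z j) powr r))"
      by (simp add: sum_ennreal ennreal_leI)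
    also have "\<dots> \<le> (\<Sum>j. ennreal (cmod (z j) powr r))"
      by (rule sum_le_suminf) auto
    finally show ?thesis .
  qed
  then show "\<exists>N. \<forall>J\<ge>N. ennreal (cmod (\<Sum>j<J. z j) powr r) \<le> (\<Sum>j. ennreal (cmod (z j) powr r))"
    by blast
qed

lemma nn_integral_lborel_affine:
  fixes f :: "'a::euclidean_space \<Rightarrow> ennreal"
  assumes [measurable]: "f \<in> borel_measurable borel" and "c \<noteq> 0"
  shows "(\<integral>\<^sup>+ x. f x \<partial>lborel) = ennreal (\<bar>c\<bar> ^ DIM('a)) * (\<integral>\<^sup>+ x. f (t + c *\<^sub>R x) \<partial>lborel)"
proof -
  have T: "(\<lambda>x::'a. t + c *\<^sub>R x) \<in> measurable lborel borel" by simp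
  show ?thesis
    by (subst lborel_affine[OF \<open>c \<noteq> 0\<close>, of t])
      (simp add: nn_integral_density nn_integral_distr[OF T] nn_integral_cmult)
qed

section \<open>The Nikolskii bound with variable weights\<close>

text \<open>Slow variation at scale \<open>2^(-v)\<close>: moving the weight from a point to a
  sampling node costs a polynomial factor in the scaled distance. One parameter \<open>K\<close>
  serves as degree and, through \<open>exp K\<close>, as constant.\<close>

definition moderate_weight :: "real \<Rightarrow> nat \<Rightarrow> (real^'n::finite \<Rightarrow> real) \<Rightarrow> bool" where
  "moderate_weight K v w \<longleftrightarrow> w \<in> borel_measurable borel \<and> (\<forall>x. 0 < w x) \<and>
     (\<forall>x y. w x \<le> exp K * (1 + 2 ^ v * dist x y) powr K * w y)"

text \<open>The sampling formula gives \<open>W(X)\<^sup>r \<le> \<Sum>j. D j * W(z j t)\<^sup>r\<close> for every \<open>t\<close> in the cube; averaging over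
  \<open>t\<close> and using \<open>W\<^sup>r \<le> 1 + W\<^sup>p\<close> bounds each summand by the modular.\<close>
lemma nikolskii_sup_bound:
  fixes Phi phi :: "real^'n::finite \<Rightarrow> complex"
  assumes adm: "admissible_pair Phi phi" and K: "0 \<le> K" and r: "0 < r" "r \<le> 1"
  obtains C where "1 \<le> C"
    "\<And>v T w p x. \<lbrakk>T \<in> tempered; moderate_weight K v w; p \<in> borel_measurable borel; \<And>x. r \<le> p x;
       ennreal ((2 ^ v) ^ CARD('n)) * (\<integral>\<^sup>+ x. ennreal ((w x * cmod (conv (phi_v Phi phi v) T x)) powr p x) \<partial>lborel) \<le> 1\<rbrakk>
     \<Longrightarrow> w x * cmod (conv (phi_v Phi phi v) T x) \<le> C"
proof -
  \<comment> \<open>Of these powers of \<open>b j\<close>, \<open>K\<close> pay for moving the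
    weight to the node; the other \<open>2 / r\<close> become the summable
    \<open>1 / (b j)^2\<close> after raising to the power \<open>r\<close>.\<close>
  define M where "M = nat \<lceil>K + 2 / r\<rceil>"
  have M: "K + 2 / r \<le> real M" unfolding M_def by linarith
  obtain A :: real and y :: "nat \<Rightarrow> real^'n" and b :: "nat \<Rightarrow> real" where
    A: "0 < A" and yb: "\<And>j. 1 + norm (y j) \<le> b j" and sb: "summable (\<lambda>j. 1 / (b j)\<^sup>2)" and
    ex: "\<And>v T. T \<in> tempered \<Longrightarrow> \<exists>c :: nat \<Rightarrow> real^'n \<Rightarrow> complex. (\<forall>j. c j \<in> borel_measurable borel) \<and>
      (\<forall>j. \<forall>t\<in>sampling_cube. cmod (c j t) \<le> A / b j ^ M) \<and>
      (\<forall>x. \<forall>t\<in>sampling_cube. (\<lambda>j. c j t * conv (phi_v Phi phi v) T (x + (1 / 2 ^ v) *\<^sub>R y j))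
          sums conv (phi_v Phi phi v) T (x + (1 / 2 ^ v) *\<^sub>R t))"
    by (rule conv_sampling[OF adm, where M = M]) blast
  have b1: "1 \<le> b j" for j using yb[of j] norm_ge_zero[of "y j"] by linarith
  have "bounded (sampling_cube :: (real^'n) set)" by (simp add: sampling_cube_def)
  then obtain \<tau> where \<tau>: "0 < \<tau>" "\<And>t :: real^'n. t \<in> sampling_cube \<Longrightarrow> norm t \<le> \<tau>"
    by (auto simp: bounded_pos)
  define A' where "A' = A * exp K * (1 + \<tau>) powr K"
  have A': "0 < A'" using A \<tau> by (simp add: A'_def)
  define q where "q = measure lborel (sampling_cube :: (real^'n) set)"
  have q: "emeasure lborel (sampling_cube :: (real^'n) set) = ennreal q"
    unfolding q_def sampling_cube_def by (rule emeasure_eq_ennreal_measure) (metis emeasure_lborel_cbox_finite infinity_ennreal_def less_irrefl)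
  have q0: "0 < q"
    unfolding q_def sampling_cube_def by (subst content_pos_lt_eq) (auto simp: Basis_vec_def inner_axis)
  define S where "S = A' powr r * (\<Sum>j. 1 / (b j)\<^sup>2)"
  have S0: "0 \<le> S" unfolding S_def by (intro mult_nonneg_nonneg suminf_nonneg sb) auto
  \<comment> \<open>The second entry solves \<open>W(X)^r * q \<le> S * (q + 1)\<close> for
    \<open>W(X)\<close>. The maximum with 1 allows a later division by \<open>C\<close> that does
    not increase anything.\<close>
  define C where "C = max 1 ((S * (q + 1) / q) powr (1 / r))"
  show ?thesis
  proof (rule that[of C])
    show "1 \<le> C" by (simp add: C_def)
    fix v T w p and X :: "real^'n"
    assume T: "T \<in> tempered" and mw: "moderate_weight K v w" and pm [measurable]: "p \<in> borel_measurable borel" and rp: "\<And>x. r \<le> p x"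
      and int: "ennreal ((2 ^ v) ^ CARD('n)) * (\<integral>\<^sup>+ x. ennreal ((w x * cmod (conv (phi_v Phi phi v) T x)) powr p x) \<partial>lborel) \<le> 1"
    define u where "u = conv (phi_v Phi phi v) T"
    have um [measurable]: "u \<in> borel_measurable borel"
      unfolding u_def by (rule conv_measurable[OF adm T])
    have wm [measurable]: "w \<in> borel_measurable borel" and w0: "\<And>x. 0 < w x"
      and wle: "\<And>x y. w x \<le> exp K * (1 + 2 ^ v * dist x y) powr K * w y"
      using mw by (auto simp: moderate_weight_def)
    define W where "W x = w x * cmod (u x)" for x
    have Wm [measurable]: "W \<in> borel_measurable borel" unfolding W_def by measurable
    have W0: "0 \<le> W x" for x using w0[of x] by (simp add: W_def)
    from ex[OF T, of v] obtain c where
      cA: "\<And>j t. t \<in> sampling_cube \<Longrightarrow> cmod (c j t) \<le> A / b j ^ M" and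
      id: "\<And>x t. t \<in> sampling_cube \<Longrightarrow> (\<lambda>j. c j t * u (x + (1 / 2 ^ v) *\<^sub>R y j)) sums u (x + (1 / 2 ^ v) *\<^sub>R t)"
      unfolding u_def by blast
    \<comment> \<open>The formula is based at \<open>X - 2^(-v) * t\<close> and evaluated at
      parameter \<open>t\<close>. The left side is then the value at the fixed point
      \<open>X\<close> for every \<open>t\<close>, while all nodes move with \<open>t\<close>, which
      makes averaging over \<open>t\<close> useful.\<close>
    define z where "z j t = (X + (1 / 2 ^ v) *\<^sub>R y j) + (- (1 / 2 ^ v)) *\<^sub>R t" for j t
    define D where "D j = A' powr r / (b j)\<^sup>2" for j
    have D0: "0 \<le> D j" for j by (simp add: D_def)
    have pointwise: "ennreal (W X powr r) \<le> (\<Sum>j. ennreal (D j) * ennreal (W (z j t) powr r))"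
      if t: "t \<in> sampling_cube" for t
    proof -
      have "z j t = X + (- (1 / 2 ^ v)) *\<^sub>R t + (1 / 2 ^ v) *\<^sub>R y j" for j
        by (simp add: z_def)
      then have "(\<lambda>j. c j t * u (z j t)) sums u X"
        using id[OF t, of "X + (- (1 / 2 ^ v)) *\<^sub>R t"] by simp
      from sums_mult[OF this, of "of_real (w X)"]
      have "ennreal (cmod (of_real (w X) * u X) powr r) \<le> (\<Sum>j. ennreal (cmod (of_real (w X) * (c j t * u (z j t))) powr r))"
        using r by (rule ennreal_powr_sums_le)
      also have "\<dots> \<le> (\<Sum>j. ennreal (D j) * ennreal (W (z j t) powr r))"
      proof (rule suminf_le[OF _ summableI summableI])
        fix j
        have "2 ^ v * dist X (z j t) = norm (t - y j)"
        proof -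
          have "X - z j t = (1 / 2 ^ v) *\<^sub>R (t - y j)" by (simp add: z_def scaleR_diff_right)
          then show ?thesis by (simp add: dist_norm)
        qed
        also have "\<dots> \<le> norm t + norm (y j)" by (rule norm_triangle_ineq4)
        also have "\<dots> \<le> \<tau> + norm (y j)" using \<tau>(2)[OF t] by simp
        finally have "1 + 2 ^ v * dist X (z j t) \<le> (1 + \<tau>) * (1 + norm (y j))"
          using \<tau>(1) mult_nonneg_nonneg[of \<tau> "norm (y j)"]
          unfolding distrib_left distrib_right mult_1_left mult_1_right by (smt (verit) norm_ge_zero)
        also have "\<dots> \<le> (1 + \<tau>) * b j" using \<tau>(1) by (intro mult_left_mono yb) auto
        finally have "(1 + 2 ^ v * dist X (z j t)) powr K \<le> ((1 + \<tau>) * b j) powr K"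
          using K by (intro powr_mono2) (auto intro!: add_nonneg_nonneg)
        then have "w X \<le> exp K * ((1 + \<tau>) * b j) powr K * w (z j t)"
          using w0[of "z j t"] by (intro order_trans[OF wle[of X "z j t"]] mult_right_mono mult_left_mono) auto
        then have "cmod (of_real (w X) * (c j t * u (z j t))) \<le> (exp K * ((1 + \<tau>) * b j) powr K * w (z j t)) * ((A / b j ^ M) * cmod (u (z j t)))"
          unfolding norm_mult norm_of_real using w0[of X] w0[of "z j t"] A b1[of j]
          by (intro mult_mono cA[OF t]) (auto intro!: mult_nonneg_nonneg)
        also have "\<dots> = A' * (b j powr K / b j ^ M) * W (z j t)"
          using \<tau> b1[of j] by (simp add: A'_def W_def powr_mult)
        also have "b j powr K / b j ^ M = b j powr (K - real M)"
          using b1[of j] by (simp add: powr_diff powr_realpow)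
        finally have "cmod (of_real (w X) * (c j t * u (z j t))) powr r \<le> (A' * b j powr (K - real M) * W (z j t)) powr r"
          using r by (intro powr_mono2) auto
        also have "\<dots> = A' powr r * b j powr ((K - real M) * r) * W (z j t) powr r"
          using A' W0[of "z j t"] b1[of j] by (simp add: powr_mult powr_powr)
        also have "\<dots> \<le> A' powr r * b j powr (- 2) * W (z j t) powr r"
        proof (intro mult_right_mono mult_left_mono powr_mono)
          have "(K + 2 / r) * r \<le> real M * r" using M r by (intro mult_right_mono) auto
          then show "(K - real M) * r \<le> - 2" using r by (simp add: algebra_simps)
        qed (use b1 in auto)
        also have "\<dots> = D j * W (z j t) powr r"
          using b1[of j] by (simp add: D_def powr_minus powr_realpow[of "b j" 2, simplified] divide_inverse)
        finally show "ennreal (cmod (of_real (w X) * (c j t * u (z j t))) powr r) \<le> ennreal (D j) * ennreal (W (z j t) powr r)"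
          using D0[of j] by (simp add: ennreal_mult[symmetric] ennreal_leI)
      qed
      finally show ?thesis using w0[of X] by (simp add: W_def norm_mult)
    qed
    have cube_le: "(\<integral>\<^sup>+ t. ennreal (W (z j t) powr r) * indicator sampling_cube t \<partial>lborel) \<le> ennreal q + 1" for j
    proof -
      \<comment> \<open>The 1 pays for points with \<open>W x < 1\<close>, where
        \<open>r \<le> p x\<close> works in the wrong direction. Over the cube it costs the volume
        \<open>q\<close>.\<close>
      have le: "ennreal (W x powr r) \<le> 1 + ennreal (W x powr p x)" for x
      proof -
        have "W x powr r \<le> 1 + W x powr p x"
        proof (cases "W x \<le> 1")
          case True
          then have "W x powr r \<le> 1 powr r" using r W0 by (intro powr_mono2) auto
          then show ?thesis by (simp add: add_increasing2)
        next
          case False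
          then have "W x powr r \<le> W x powr p x" using rp by (intro powr_mono) auto
          then show ?thesis by simp
        qed
        then have "ennreal (W x powr r) \<le> ennreal (1 + W x powr p x)" by (rule ennreal_leI)
        then show ?thesis by simp
      qed
      have zm [measurable]: "z j \<in> borel_measurable borel"
        unfolding z_def by (intro borel_measurable_continuous_onI continuous_intros)
      have "(\<integral>\<^sup>+ t. ennreal (W (z j t) powr r) * indicator sampling_cube t \<partial>lborel)
         \<le> (\<integral>\<^sup>+ t. indicator sampling_cube t + ennreal (W (z j t) powr p (z j t)) \<partial>lborel)"
        using le by (intro nn_integral_mono) (auto split: split_indicator)
      also have "\<dots> = ennreal q + (\<integral>\<^sup>+ t. ennreal (W (z j t) powr p (z j t)) \<partial>lborel)"
        by (subst nn_integral_add) (simp_all add: q)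
      \<comment> \<open>The integral has been enlarged from the cube to the whole space, so the
        substitution \<open>z j\<close> gives the same value for every \<open>j\<close>; its
        Jacobian produces exactly the factor \<open>2^(v n)\<close> of the modular.\<close>
      also have "(\<integral>\<^sup>+ t. ennreal (W (z j t) powr p (z j t)) \<partial>lborel)
          = ennreal ((2 ^ v) ^ CARD('n)) * (\<integral>\<^sup>+ x. ennreal (W x powr p x) \<partial>lborel)"
      proof -
        have "(\<integral>\<^sup>+ x. ennreal (W x powr p x) \<partial>lborel) = ennreal ((1 / 2 ^ v) ^ CARD('n)) * (\<integral>\<^sup>+ t. ennreal (W (z j t) powr p (z j t)) \<partial>lborel)"
          using nn_integral_lborel_affine[of "\<lambda>x. ennreal (W x powr p x)" "- (1 / 2 ^ v)" "X + (1 / 2 ^ v) *\<^sub>R y j"]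
          by (simp add: z_def)
        then have "ennreal ((2 ^ v) ^ CARD('n)) * (\<integral>\<^sup>+ x. ennreal (W x powr p x) \<partial>lborel)
            = (ennreal ((2 ^ v) ^ CARD('n)) * ennreal ((1 / 2 ^ v) ^ CARD('n))) * (\<integral>\<^sup>+ t. ennreal (W (z j t) powr p (z j t)) \<partial>lborel)"
          by (simp only: mult.assoc)
        also have "ennreal ((2 ^ v) ^ CARD('n)) * ennreal ((1 / 2 ^ v) ^ CARD('n)) = ennreal 1"
          by (subst ennreal_mult[symmetric]) (simp_all add: power_mult_distrib[symmetric])
        finally show ?thesis by simp
      qed
      also have "\<dots> \<le> 1" using int by (simp add: W_def u_def)
      finally show ?thesis by (simp add: add_left_mono)
    qed
    have zm [measurable]: "z j \<in> borel_measurable borel" for j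
      unfolding z_def by (intro borel_measurable_continuous_onI continuous_intros)
    have "ennreal (W X powr r) * ennreal q = (\<integral>\<^sup>+ t. ennreal (W X powr r) * indicator sampling_cube t \<partial>(lborel :: (real^'n) measure))"
      by (subst nn_integral_cmult_indicator) (simp_all add: q)
    also have "\<dots> \<le> (\<integral>\<^sup>+ t. (\<Sum>j. ennreal (D j) * (ennreal (W (z j t) powr r) * indicator sampling_cube t)) \<partial>lborel)"
      by (intro nn_integral_mono) (use pointwise in \<open>auto split: split_indicator\<close>)
    also have "\<dots> = (\<Sum>j. \<integral>\<^sup>+ t. ennreal (D j) * (ennreal (W (z j t) powr r) * indicator sampling_cube t) \<partial>lborel)"
      by (rule nn_integral_suminf) measurable
    also have "\<dots> = (\<Sum>j. ennreal (D j) * (\<integral>\<^sup>+ t. ennreal (W (z j t) powr r) * indicator sampling_cube t \<partial>lborel))"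
      by (intro suminf_cong nn_integral_cmult) measurable
    also have "\<dots> \<le> (\<Sum>j. ennreal (D j) * (ennreal q + 1))"
      by (intro suminf_le mult_left_mono cube_le) auto
    also have "\<dots> = (\<Sum>j. ennreal (D j)) * (ennreal q + 1)"
      by (simp add: ennreal_suminf_multc)
    also have "(\<Sum>j. ennreal (D j)) = ennreal S"
    proof -
      have "summable D" unfolding D_def using summable_mult[OF sb, of "A' powr r"] by simp
      then have "(\<Sum>j. ennreal (D j)) = ennreal (\<Sum>j. D j)" using D0 by (rule suminf_ennreal2[rotated])
      also have "(\<Sum>j. D j) = S" unfolding D_def S_def using suminf_mult[OF sb, of "A' powr r"] by simp
      finally show ?thesis .
    qed
    also have "ennreal S * (ennreal q + 1) = ennreal (S * (q + 1))"
      using q0 S0 by (simp add: ennreal_mult)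
    finally have "W X powr r * q \<le> S * (q + 1)"
      using q0 S0 by (simp add: ennreal_mult[symmetric])
    then have "W X powr r \<le> S * (q + 1) / q" using q0 by (simp add: field_simps)
    then have "(W X powr r) powr (1 / r) \<le> (S * (q + 1) / q) powr (1 / r)" using r by (intro powr_mono2) auto
    then have "W X \<le> (S * (q + 1) / q) powr (1 / r)" using r W0[of X] by (simp add: powr_powr)
    then show "w X * cmod (conv (phi_v Phi phi v) T X) \<le> C"
      by (simp add: C_def W_def u_def)
  qed
qed

text \<open>Split at distance \<open>2^(-v / 2)\<close>. Below it, \<open>ln (1 / dist x y)\<close>
  is at least of order \<open>v\<close>, so the logarithmic modulus alone cancels the factor
  \<open>v\<close>. Above it, \<open>2^v * dist x y\<close> exceeds \<open>2^(v / 2)\<close>, so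
  \<open>v\<close> is of the order of the logarithm on the right, and bounded oscillation of
  \<open>g\<close> suffices.\<close>

lemma log_hoelder_loc_scale:
  fixes g :: "real^'n::finite \<Rightarrow> real"
  assumes "log_hoelder_loc g"
  obtains c where "0 \<le> c" "\<And>x y. \<bar>g x - g y\<bar> \<le> c"
    "\<And>v x y. real v * \<bar>g x - g y\<bar> \<le> c * (1 + ln (1 + 2 ^ v * dist x y))"
proof -
  from assms obtain c where c: "\<And>x y. \<bar>g x - g y\<bar> \<le> c / ln (exp 1 + 1 / dist x y)"
    unfolding log_hoelder_loc_def by blast
  \<comment> \<open>At coinciding points \<open>1 / 0 = 0\<close>, so the logarithm equals 1 and the
    condition reads \<open>0 \<le> c\<close>.\<close>
  have c0: "0 \<le> c" using c[of 0 0] by simp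
  have ln1: "1 \<le> ln (exp 1 + 1 / d)" if "0 \<le> d" for d :: real
    using that by (subst ln_ge_iff) (auto intro: add_pos_nonneg)
  have ln2: "0 < ln (2::real)" "ln (2::real) \<le> 1" using ln_2_less_1 by auto
  have le: "\<bar>g x - g y\<bar> \<le> c" for x y
  proof -
    have "c / ln (exp 1 + 1 / dist x y) \<le> c / 1"
      using c0 ln1[of "dist x y"] by (intro divide_left_mono) auto
    then show ?thesis using c[of x y] by simp
  qed
  have le': "c \<le> 2 * c / ln 2"
    using c0 ln2 mult_left_mono[of "ln 2" 2 c] by (simp add: field_simps)
  show ?thesis
  proof (rule that[of "2 * c / ln 2"])
    show "0 \<le> 2 * c / ln 2" using c0 ln2 by simp
    show "\<bar>g x - g y\<bar> \<le> 2 * c / ln 2" for x y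
      using le[of x y] le' by linarith
    fix v :: nat and x y :: "real^'n"
    define d where "d = dist x y"
    have d0: "0 \<le> d" by (simp add: d_def)
    have lnN: "0 \<le> ln (1 + 2 ^ v * d)" using d0 by (intro ln_ge_zero) auto
    show "real v * \<bar>g x - g y\<bar> \<le> 2 * c / ln 2 * (1 + ln (1 + 2 ^ v * dist x y))"
    proof (cases "d = 0")
      case True
      then show ?thesis using c0 ln2 by (simp add: d_def)
    next
      case False
      with d0 have d: "0 < d" by simp
      show ?thesis
      proof (cases "2 ^ v * d\<^sup>2 \<le> 1")
        case True
        define l where "l = ln (exp 1 + 1 / d)"
        have "2 ^ v \<le> (1 / d)\<^sup>2" using True d by (simp add: field_simps power2_eq_square)
        then have "ln (2 ^ v) \<le> ln ((1 / d)\<^sup>2)" using d by (subst ln_le_cancel_iff) auto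
        then have "real v * ln 2 \<le> 2 * ln (1 / d)" using d by (simp add: ln_realpow del: ln_divide_pos)
        also have "ln (1 / d) \<le> l" unfolding l_def using d by (subst ln_le_cancel_iff) (auto intro: add_pos_pos)
        finally have vl: "real v * ln 2 \<le> 2 * l" by simp
        have l: "1 \<le> l" unfolding l_def by (rule ln1[OF d0])
        have "real v * \<bar>g x - g y\<bar> \<le> real v * (c / l)"
          using c[of x y] by (intro mult_left_mono) (auto simp: l_def d_def)
        also have "\<dots> \<le> 2 * c / ln 2"
          using mult_left_mono[OF vl c0] l ln2 by (simp add: field_simps)
        also have "\<dots> \<le> 2 * c / ln 2 * (1 + ln (1 + 2 ^ v * d))"
          using c0 ln2 lnN mult_left_mono[of 1 "1 + ln (1 + 2 ^ v * d)" "2 * c / ln 2"] by simp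
        finally show ?thesis by (simp add: d_def)
      next
        case False
        have "2 ^ v \<le> (2 ^ v * d)\<^sup>2"
          using mult_left_mono[of 1 "2 ^ v * d\<^sup>2" "2 ^ v"] False by (simp add: power2_eq_square mult_ac)
        also have "\<dots> \<le> (1 + 2 ^ v * d)\<^sup>2" using d by (intro power_mono) auto
        finally have "ln (2 ^ v) \<le> ln ((1 + 2 ^ v * d)\<^sup>2)"
          using d add_pos_pos[of 1 "2 ^ v * d"] by (subst ln_le_cancel_iff) (auto intro!: zero_less_power)
        then have vl: "real v * ln 2 \<le> 2 * ln (1 + 2 ^ v * d)"
          using d by (simp add: ln_realpow add_pos_pos)
        have "real v * \<bar>g x - g y\<bar> \<le> real v * c" using le by (intro mult_left_mono) auto
        also have "\<dots> \<le> 2 * c / ln 2 * ln (1 + 2 ^ v * d)"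
          using mult_left_mono[OF vl c0] ln2 by (simp add: field_simps)
        also have "\<dots> \<le> 2 * c / ln 2 * (1 + ln (1 + 2 ^ v * d))"
          using c0 ln2 by (intro mult_left_mono) auto
        finally show ?thesis by (simp add: d_def)
      qed
    qed
  qed
qed

text \<open>Within distance \<open>2^(-v)\<close> the scaled estimate bounds the oscillation by a
  constant divided by \<open>v\<close>.\<close>

lemma log_hoelder_loc_continuous:
  fixes g :: "real^'n::finite \<Rightarrow> real"
  assumes "log_hoelder_loc g"
  shows "continuous_on UNIV g"
proof -
  obtain c where c: "0 \<le> c" "\<And>v x y. real v * \<bar>g x - g y\<bar> \<le> c * (1 + ln (1 + 2 ^ v * dist x y))"
    using log_hoelder_loc_scale[OF assms] by metis
  show ?thesis
    unfolding continuous_on_iff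
  proof (intro ballI allI impI)
    fix x and e :: real assume e: "0 < e"
    obtain v :: nat where v: "c * (1 + ln 2) / e < real v" using reals_Archimedean2 by blast
    moreover have "0 \<le> c * (1 + ln 2) / e" using c e by (intro divide_nonneg_pos mult_nonneg_nonneg) auto
    ultimately have v0: "0 < real v" by linarith
    show "\<exists>d>0. \<forall>x'\<in>UNIV. dist x' x < d \<longrightarrow> dist (g x') (g x) < e"
    proof (intro exI[of _ "1 / 2 ^ v"] conjI ballI impI)
      fix x' assume "dist x' x < 1 / 2 ^ v"
      then have "1 + 2 ^ v * dist x' x \<le> 2" by (simp add: field_simps)
      then have "ln (1 + 2 ^ v * dist x' x) \<le> ln 2" by (subst ln_le_cancel_iff) (auto intro: add_pos_nonneg)
      then have "real v * \<bar>g x' - g x\<bar> \<le> c * (1 + ln 2)"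
        using c(1) by (intro order_trans[OF c(2)] mult_left_mono) auto
      also have "\<dots> < real v * e" using v e by (simp add: field_simps)
      finally show "dist (g x') (g x) < e" using v0 by (simp add: dist_real_def)
    qed simp
  qed
qed

text \<open>Continuity of \<open>1 / p\<close> makes \<open>p\<close> Borel measurable, as
  integration over \<open>lborel\<close> requires. Its bounded oscillation yields \<open>R\<close>
  from the value at the origin, at every point and not just almost everywhere.\<close>

lemma P0_logD:
  fixes p :: "real^'n::finite \<Rightarrow> real"
  assumes "p \<in> P0_log"
  shows "0 < p x" "log_hoelder_loc (\<lambda>x. 1 / p x)" "p \<in> borel_measurable borel"
    and "\<exists>R\<ge>1. \<forall>x. 1 / p x \<le> R"
proof -
  show p0: "0 < p x" for x using assms by (auto simp: P0_log_def P0_def)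
  show lh: "log_hoelder_loc (\<lambda>x. 1 / p x)" using assms by (auto simp: P0_log_def log_hoelder_def)
  have "(\<lambda>x. 1 / p x) \<in> borel_measurable borel"
    using log_hoelder_loc_continuous[OF lh] by (rule borel_measurable_continuous_onI)
  then have "(\<lambda>x. 1 / (1 / p x)) \<in> borel_measurable borel" by measurable
  then show "p \<in> borel_measurable borel" by simp
  obtain c where c: "0 \<le> c" "\<And>x y. \<bar>1 / p x - 1 / p y\<bar> \<le> c"
    using log_hoelder_loc_scale[OF lh] by metis
  have "1 / p x \<le> 1 + 1 / p 0 + c" for x using c(2)[of x 0] by linarith
  moreover have "1 \<le> 1 + 1 / p 0 + c" using c(1) p0[of 0] by simp
  ultimately show "\<exists>R\<ge>1. \<forall>x. 1 / p x \<le> R" by blast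
qed

text \<open>With \<sigma> replaced by \<open>\<sigma> - n / p1\<close>, this is the common core of
  both integrands. They differ from it by the factors \<open>2^(v n / p2)\<close> and
  \<open>2^(v n / p1)\<close>, and each of these turns into \<open>2^(v n)\<close> under its own
  exponent.\<close>

definition level_weight :: "(real^'n::finite \<Rightarrow> real) \<Rightarrow> (real^'n \<Rightarrow> real) \<Rightarrow> nat \<Rightarrow> real \<Rightarrow> real \<Rightarrow> real^'n \<Rightarrow> real" where
  "level_weight \<sigma> q v \<delta> \<mu> x = 2 powr (real v * \<sigma> x) / (\<mu> * \<delta> powr (1 / q x))"

text \<open>Take logarithms. The exponents multiplied by \<open>v\<close> are handled by
  \<open>log_hoelder_loc_scale\<close>; the term \<open>ln \<delta> / q\<close> is of the same kind
  because \<open>|ln \<delta>| \<le> v + 1\<close>, whence \<open>2 * cq\<close> in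
  \<open>K\<close>; and \<mu> cancels in differences, so \<open>K\<close> is independent of
  it.\<close>

lemma level_weight_moderate:
  fixes \<alpha> \<tau> p q :: "real^'n::finite \<Rightarrow> real"
  assumes "log_hoelder_loc \<alpha>" "log_hoelder_loc \<tau>" "log_hoelder_loc (\<lambda>x. 1 / p x)" "log_hoelder_loc (\<lambda>x. 1 / q x)"
  obtains K where "0 \<le> K" "\<And>v \<delta> \<mu>. \<lbrakk>1 / 2 ^ v \<le> \<delta>; \<delta> \<le> 2; 0 < \<mu>\<rbrakk> \<Longrightarrow>
      moderate_weight K v (level_weight (\<lambda>x. \<alpha> x + real CARD('n) * \<tau> x - real CARD('n) / p x) q v \<delta> \<mu>)"
proof -
  let ?n = "real CARD('n)"
  define l where "l v x y = 1 + ln (1 + 2 ^ v * dist x y)" for v :: nat and x y :: "real^'n"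
  obtain ca where ca: "0 \<le> ca" "\<And>v x y. real v * \<bar>\<alpha> x - \<alpha> y\<bar> \<le> ca * l v x y"
    using log_hoelder_loc_scale[OF assms(1)] unfolding l_def by metis
  obtain ct where ct: "0 \<le> ct" "\<And>v x y. real v * \<bar>\<tau> x - \<tau> y\<bar> \<le> ct * l v x y"
    using log_hoelder_loc_scale[OF assms(2)] unfolding l_def by metis
  obtain cp where cp: "0 \<le> cp" "\<And>v x y. real v * \<bar>1 / p x - 1 / p y\<bar> \<le> cp * l v x y"
    using log_hoelder_loc_scale[OF assms(3)] unfolding l_def by metis
  obtain cq where cq: "0 \<le> cq" "\<And>x y. \<bar>1 / q x - 1 / q y\<bar> \<le> cq" "\<And>v x y. real v * \<bar>1 / q x - 1 / q y\<bar> \<le> cq * l v x y"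
    using log_hoelder_loc_scale[OF assms(4)] unfolding l_def by metis
  define K where "K = ca + ?n * ct + ?n * cp + 2 * cq"
  define \<sigma> where "\<sigma> x = \<alpha> x + ?n * \<tau> x - ?n / p x" for x
  have \<sigma>c: "continuous_on UNIV \<sigma>"
  proof -
    define ip where "ip x = 1 / p x" for x
    have "continuous_on UNIV ip" using log_hoelder_loc_continuous[OF assms(3)] by (simp add: ip_def[abs_def])
    then have "continuous_on UNIV (\<lambda>x. \<alpha> x + ?n * \<tau> x - ?n * ip x)"
      using log_hoelder_loc_continuous[OF assms(1)] log_hoelder_loc_continuous[OF assms(2)] by (intro continuous_intros)
    then show ?thesis by (simp add: \<sigma>_def[abs_def] ip_def)
  qed
  have l1: "1 \<le> l v x y" for v x y
    unfolding l_def using ln_ge_zero[of "1 + 2 ^ v * dist x y"] by simp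
  show ?thesis
  proof (rule that[of K])
    show "0 \<le> K" unfolding K_def using ca(1) ct(1) cp(1) cq(1) by (intro add_nonneg_nonneg mult_nonneg_nonneg) auto
    fix v and \<delta> \<mu> :: real assume \<delta>: "1 / 2 ^ v \<le> \<delta>" "\<delta> \<le> 2" and \<mu>: "0 < \<mu>"
    have \<delta>0: "0 < \<delta>" using \<delta>(1) by (rule less_le_trans[rotated]) simp
    define E where "E x = real v * ln 2 * \<sigma> x - ln \<mu> - ln \<delta> * (1 / q x)" for x
    have w: "level_weight \<sigma> q v \<delta> \<mu> x = exp (E x)" for x
      using \<mu> \<delta>0 by (simp add: level_weight_def E_def powr_def exp_diff mult_ac)
    have Ed: "E x - E y \<le> K * l v x y" for x y
    proof -
      have "\<bar>ln \<delta>\<bar> \<le> real v + 1"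
      proof -
        have "ln (1 / 2 ^ v) \<le> ln \<delta>" using \<delta> \<delta>0 by (subst ln_le_cancel_iff) auto
        then have "- (real v * ln 2) \<le> ln \<delta>" by (simp add: ln_div ln_realpow)
        moreover have "real v * ln 2 \<le> real v * 1" using ln_2_less_1 by (intro mult_left_mono) auto
        moreover have "ln \<delta> \<le> ln 2" using \<delta> \<delta>0 by (subst ln_le_cancel_iff) auto
        ultimately show ?thesis using ln_2_less_1 by (simp add: abs_le_iff)
      qed
      then have "\<bar>ln \<delta>\<bar> * \<bar>1 / q x - 1 / q y\<bar> \<le> (real v + 1) * \<bar>1 / q x - 1 / q y\<bar>"
        by (intro mult_right_mono) auto
      also have "\<dots> \<le> cq * l v x y + cq * l v x y"
        using cq(3)[of v x y] cq(2)[of x y] mult_left_mono[OF l1 cq(1), of v x y] by (simp add: distrib_right)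
      finally have 1: "\<bar>ln \<delta>\<bar> * \<bar>1 / q x - 1 / q y\<bar> \<le> 2 * cq * l v x y" by simp
      have "real v * ln 2 * (\<sigma> x - \<sigma> y) \<le> real v * ln 2 * \<bar>\<sigma> x - \<sigma> y\<bar>" by (intro mult_left_mono) auto
      also have "\<dots> \<le> real v * 1 * \<bar>\<sigma> x - \<sigma> y\<bar>" using ln_2_less_1 by (intro mult_right_mono mult_left_mono) auto
      also have "\<bar>\<sigma> x - \<sigma> y\<bar> \<le> \<bar>\<alpha> x - \<alpha> y\<bar> + ?n * \<bar>\<tau> x - \<tau> y\<bar> + ?n * \<bar>1 / p x - 1 / p y\<bar>"
      proof -
        have "\<sigma> x - \<sigma> y = (\<alpha> x - \<alpha> y) + ?n * (\<tau> x - \<tau> y) - ?n * (1 / p x - 1 / p y)"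
          by (simp add: \<sigma>_def algebra_simps)
        then have "\<bar>\<sigma> x - \<sigma> y\<bar> \<le> \<bar>\<alpha> x - \<alpha> y\<bar> + \<bar>?n * (\<tau> x - \<tau> y)\<bar> + \<bar>?n * (1 / p x - 1 / p y)\<bar>" by linarith
        then show ?thesis by (simp add: abs_mult)
      qed
      then have "real v * 1 * \<bar>\<sigma> x - \<sigma> y\<bar> \<le> real v * (\<bar>\<alpha> x - \<alpha> y\<bar> + ?n * \<bar>\<tau> x - \<tau> y\<bar> + ?n * \<bar>1 / p x - 1 / p y\<bar>)"
        by (simp add: mult_left_mono)
      also have "\<dots> = real v * \<bar>\<alpha> x - \<alpha> y\<bar> + ?n * (real v * \<bar>\<tau> x - \<tau> y\<bar>) + ?n * (real v * \<bar>1 / p x - 1 / p y\<bar>)"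
        by (simp only: distrib_left mult.left_commute)
      also have "\<dots> \<le> ca * l v x y + ?n * (ct * l v x y) + ?n * (cp * l v x y)"
        by (intro add_mono mult_left_mono ca ct cp) auto
      finally have 2: "real v * ln 2 * (\<sigma> x - \<sigma> y) \<le> ca * l v x y + ?n * (ct * l v x y) + ?n * (cp * l v x y)" .
      have "E x - E y = real v * ln 2 * (\<sigma> x - \<sigma> y) - ln \<delta> * (1 / q x - 1 / q y)"
        by (simp add: E_def algebra_simps)
      also have "\<dots> \<le> real v * ln 2 * (\<sigma> x - \<sigma> y) + \<bar>ln \<delta>\<bar> * \<bar>1 / q x - 1 / q y\<bar>"
        using abs_ge_minus_self[of "ln \<delta> * (1 / q x - 1 / q y)"] by (simp add: abs_mult)
      also have "\<dots> \<le> K * l v x y"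
        using 1 2 by (simp add: K_def distrib_right mult.assoc)
      finally show ?thesis .
    qed
    show "moderate_weight K v (level_weight (\<lambda>x. \<alpha> x + ?n * \<tau> x - ?n / p x) q v \<delta> \<mu>)"
      unfolding \<sigma>_def[symmetric] moderate_weight_def
    proof (intro conjI allI)
      have "continuous_on UNIV E"
        unfolding E_def
        by (intro continuous_on_diff continuous_on_mult continuous_on_const \<sigma>c log_hoelder_loc_continuous[OF assms(4)])
      then have "E \<in> borel_measurable borel" by (rule borel_measurable_continuous_onI)
      then show "level_weight \<sigma> q v \<delta> \<mu> \<in> borel_measurable borel"
        unfolding w[abs_def] by measurable
      show "0 < level_weight \<sigma> q v \<delta> \<mu> x" for x by (simp add: w)
      fix x y :: "real^'n"
      have pos: "0 < 1 + 2 ^ v * dist x y" by (intro add_pos_nonneg) auto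
      have "exp (E x) = exp (E x - E y) * exp (E y)" by (simp add: exp_add[symmetric])
      also have "\<dots> \<le> exp (K * l v x y) * exp (E y)" using Ed by simp
      also have "exp (K * l v x y) = exp K * (1 + 2 ^ v * dist x y) powr K"
        using pos by (simp add: l_def powr_def distrib_left exp_add)
      finally show "level_weight \<sigma> q v \<delta> \<mu> x \<le> exp K * (1 + 2 ^ v * dist x y) powr K * level_weight \<sigma> q v \<delta> \<mu> y"
        by (simp add: w)
    qed
  qed
qed

section \<open>The embedding\<close>

text \<open>The half-open cube contains an open box of this volume, and a closed box around it makes
  its measure finite. Under the power \<open>- \<tau>\<close> this lower bound becomes an upper
  bound.\<close>

lemma measure_dyadic_cube_ge:
  fixes m :: "'n::finite \<Rightarrow> int"
  shows "(2 powr (- real_of_int k)) ^ CARD('n) \<le> measure lborel (dyadic_cube k m :: (real^'n) set)"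
proof -
  define h where "h = 2 powr (- real_of_int k)"
  have h: "0 < h" "2 powr real_of_int k = 1 / h" by (simp_all add: h_def powr_minus divide_inverse)
  define a b :: "real^'n" where "a = (\<chi> i. m i * h)" and "b = (\<chi> i. (real_of_int (m i) + 1) * h)"
  have iff: "x \<in> (dyadic_cube k m :: (real^'n) set) \<longleftrightarrow> (\<forall>i. a $ i \<le> x $ i \<and> x $ i < b $ i)" for x
  proof -
    have "c \<le> 1 / h * s \<longleftrightarrow> c * h \<le> s" "1 / h * s < c \<longleftrightarrow> s < c * h" for c s
      using h(1) by (simp_all add: field_simps)
    then show ?thesis by (simp only: dyadic_cube_def a_def b_def h(2) mem_Collect_eq vec_lambda_beta)
  qed
  have sub: "box a b \<subseteq> dyadic_cube k m" "dyadic_cube k m \<subseteq> cbox a b"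
    by (auto simp: iff mem_box_cart less_imp_le)
  have eq: "(dyadic_cube k m :: (real^'n) set) = (\<Inter>i. {x. a $ i \<le> x $ i} \<inter> {x. x $ i < b $ i})"
    by (auto simp: iff)
  have sets: "dyadic_cube k m \<in> sets (lborel :: (real^'n) measure)"
    unfolding eq
    by (intro sets.finite_INT) (auto intro!: borel_closed borel_open closed_Collect_le open_Collect_less continuous_intros)
  have "emeasure lborel (dyadic_cube k m :: (real^'n) set) < \<infinity>"
    by (rule order_le_less_trans[OF emeasure_mono[OF sub(2)] emeasure_lborel_cbox_finite]) simp
  then have "dyadic_cube k m \<in> fmeasurable (lborel :: (real^'n) measure)"
    using sets by (simp add: fmeasurable_def)
  then have "measure lborel (box a b) \<le> measure lborel (dyadic_cube k m :: (real^'n) set)"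
    by (intro measure_mono_fmeasurable sub) simp_all
  moreover have "measure lborel (box a b) = h ^ CARD('n)"
  proof -
    have "measure lborel (box a b) = (\<Prod>c\<in>Basis. (b - a) \<bullet> c)"
      using h by (subst measure_lborel_box) (auto simp: a_def b_def Basis_vec_def inner_axis)
    also have "\<dots> = (\<Prod>c\<in>(Basis :: (real^'n) set). h)"
      by (rule prod.cong) (auto simp: a_def b_def Basis_vec_def inner_axis algebra_simps)
    finally show ?thesis by simp
  qed
  ultimately show ?thesis by (simp add: h_def)
qed

text \<open>Here \<open>g\<close> is any function dominated by \<open>2^(v \<sigma>) * |u|\<close>,
  which hides the cube \<open>P\<close>. The factor \<open>2^(v n / p1)\<close> split off from the
  weight becomes \<open>2^(v n)\<close> under the exponent \<open>p1\<close>, the very factor in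
  front of the \<open>p2\<close>-integral.\<close>

lemma nn_integral_level_bound:
  fixes p1 p2 q \<sigma> :: "real^'n::finite \<Rightarrow> real" and u g :: "real^'n \<Rightarrow> complex" and C \<delta> \<mu> :: real and v :: nat
  defines "W \<equiv> \<lambda>x. level_weight (\<lambda>x. \<sigma> x - real CARD('n) / p1 x) q v \<delta> \<mu> x * cmod (u x)"
  assumes C: "1 \<le> C" and sup: "\<And>x. W x \<le> C" and \<mu>: "0 < \<mu>" and \<delta>: "0 < \<delta>"
    and p1: "\<And>x. 0 < p1 x" and p2: "\<And>x. 0 < p2 x" and p12: "AE x in lebesgue. p2 x \<le> p1 x"
    and g: "AE x in lebesgue. cmod (g x) \<le> 2 powr (real v * \<sigma> x) * cmod (u x)"
    and H: "ennreal ((2 ^ v) ^ CARD('n)) * (\<integral>\<^sup>+ x. ennreal (W x powr p2 x) \<partial>lebesgue) \<le> 1"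
    and Wm: "(\<lambda>x. ennreal (W x powr p2 x)) \<in> borel_measurable lebesgue"
  shows "(\<integral>\<^sup>+ x. ennreal ((cmod (g x) / (C * \<mu> * \<delta> powr (1 / q x))) powr p1 x) \<partial>lebesgue) \<le> 1"
proof -
  let ?N = "(2::real) powr (real v * real CARD('n))"
  have N: "(2 ^ v) ^ CARD('n) = ?N"
    by (simp add: powr_powr[symmetric] powr_realpow)
  have "AE x in lebesgue. ennreal ((cmod (g x) / (C * \<mu> * \<delta> powr (1 / q x))) powr p1 x) \<le> ennreal ?N * ennreal (W x powr p2 x)"
    using p12 g
  proof eventually_elim
    case (elim x)
    have W0: "0 \<le> W x" using \<mu> by (simp add: W_def level_weight_def)
    have pos: "0 < \<mu> * \<delta> powr (1 / q x)" using \<mu> \<delta> by simp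
    have "cmod (g x) / (C * \<mu> * \<delta> powr (1 / q x)) \<le> (2 powr (real v * \<sigma> x) * cmod (u x)) / (C * \<mu> * \<delta> powr (1 / q x))"
      using elim(2) C \<mu> by (intro divide_right_mono) auto
    also have "\<dots> = 2 powr (real v * (real CARD('n) / p1 x)) * (W x / C)"
      unfolding W_def level_weight_def right_diff_distrib powr_diff by (simp add: field_simps)
    finally have "(cmod (g x) / (C * \<mu> * \<delta> powr (1 / q x))) powr p1 x \<le> (2 powr (real v * (real CARD('n) / p1 x)) * (W x / C)) powr p1 x"
      using p1[of x] C \<mu> by (intro powr_mono2) auto
    also have "\<dots> = ?N * (W x / C) powr p1 x"
      using p1[of x] W0 C by (subst powr_mult) (simp_all add: powr_powr)
    \<comment> \<open>By the sup bound \<open>W x / C\<close> lies in \<open>[0, 1]\<close>, where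
      the larger exponent gives the smaller power.\<close>
    also have "\<dots> \<le> ?N * (W x / C) powr p2 x"
      using elim(1) W0 C sup[of x] by (intro mult_left_mono powr_mono') auto
    also have "\<dots> \<le> ?N * W x powr p2 x"
    proof (intro mult_left_mono powr_mono2)
      show "W x / C \<le> W x" using W0 C mult_left_mono[of 1 C "W x"] by (simp add: divide_le_eq)
    qed (use W0 C p2[of x] in auto)
    finally show ?case
      by (simp add: ennreal_mult[symmetric] ennreal_leI)
  qed
  then have "(\<integral>\<^sup>+ x. ennreal ((cmod (g x) / (C * \<mu> * \<delta> powr (1 / q x))) powr p1 x) \<partial>lebesgue)
      \<le> (\<integral>\<^sup>+ x. ennreal ?N * ennreal (W x powr p2 x) \<partial>lebesgue)"
    by (rule nn_integral_mono_AE)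
  also have "\<dots> = ennreal ?N * (\<integral>\<^sup>+ x. ennreal (W x powr p2 x) \<partial>lebesgue)"
    by (rule nn_integral_cmult[OF Wm])
  also have "\<dots> \<le> 1" using H by (simp add: N)
  finally show ?thesis .
qed

lemma le_mult_Inf_ennreal:
  fixes A :: "ennreal set"
  assumes "0 < c" "\<And>a. a \<in> A \<Longrightarrow> x \<le> ennreal c * a"
  shows "x \<le> ennreal c * Inf A"
proof -
  have one: "ennreal (1 / c) * ennreal c = 1" "ennreal c * ennreal (1 / c) = 1"
    using assms(1) by (simp_all add: ennreal_mult[symmetric])
  have "ennreal (1 / c) * x \<le> Inf A"
  proof (rule Inf_greatest)
    fix a assume "a \<in> A"
    then have "ennreal (1 / c) * x \<le> ennreal (1 / c) * (ennreal c * a)" by (intro mult_left_mono assms) auto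
    also have "\<dots> = a" by (simp only: mult.assoc[symmetric] one mult_1)
    finally show "ennreal (1 / c) * x \<le> a" .
  qed
  then have "ennreal c * (ennreal (1 / c) * x) \<le> ennreal c * Inf A" by (rule mult_left_mono) simp
  then show ?thesis by (simp only: mult.assoc[symmetric] one mult_1)
qed

theorem theorem4p5:
  fixes \<alpha> \<tau> p1 p2 q :: "real^'n::finite \<Rightarrow> real"
    and Phi phi :: "real^'n \<Rightarrow> complex"
  assumes "admissible_pair Phi phi"
    and "log_hoelder_loc \<alpha>" and "log_hoelder_loc \<tau>" and "ess_inf \<tau> > 0"
    and "p1 \<in> P0_log" and "p2 \<in> P0_log" and "q \<in> P0_log"
    and "ess_sup q < \<infinity>"
    and "ess_sup (\<lambda>x. p2 x - p1 x) \<le> 0"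
  shows "besov_space (\<lambda>x. \<alpha> x + real CARD('n) * \<tau> x + real CARD('n) / p2 x - real CARD('n) / p1 x)
            p2 q Phi phi \<subseteq> btype_space \<alpha> \<tau> p1 q Phi phi
       \<and> (\<exists>C::real. 0 < C \<and>
            (\<forall>f \<in> besov_space (\<lambda>x. \<alpha> x + real CARD('n) * \<tau> x + real CARD('n) / p2 x - real CARD('n) / p1 x)
                     p2 q Phi phi.
               btype_norm \<alpha> \<tau> p1 q Phi phi f
                 \<le> ennreal C * besov_norm (\<lambda>x. \<alpha> x + real CARD('n) * \<tau> x + real CARD('n) / p2 x - real CARD('n) / p1 x)
                                  p2 q Phi phi f))"
proof -
  let ?n = "real CARD('n)"
  define s where "s x = \<alpha> x + ?n * \<tau> x + ?n / p2 x - ?n / p1 x" for x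
  define \<sigma> where "\<sigma> x = \<alpha> x + ?n * \<tau> x" for x
  note p1 = P0_logD[OF assms(5)] and p2 = P0_logD[OF assms(6)] and q = P0_logD[OF assms(7)]
  from p2(4) obtain R where R: "1 \<le> R" "\<And>x. 1 / p2 x \<le> R" by blast
  from q(4) obtain Q where Q: "1 \<le> Q" "\<And>x. 1 / q x \<le> Q" by blast
  \<comment> \<open>\<open>R \<ge> 1\<close> bounds \<open>1 / p2\<close> everywhere, so
    \<open>r\<close> lies below both 1 and \<open>p2\<close>.\<close>
  define r where "r = 1 / R"
  have r: "0 < r" "r \<le> 1" using R(1) by (simp_all add: r_def)
  have rp: "r \<le> p2 x" for x
    using R(1) R(2)[of x] p2(1)[of x] by (simp add: r_def field_simps)
  obtain K where K: "0 \<le> K" and mw: "\<And>v \<delta> \<mu>. \<lbrakk>1 / 2 ^ v \<le> \<delta>; \<delta> \<le> 2; 0 < \<mu>\<rbrakk> \<Longrightarrow>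
      moderate_weight K v (level_weight (\<lambda>x. \<sigma> x - ?n / p1 x) q v \<delta> \<mu>)"
    unfolding \<sigma>_def by (rule level_weight_moderate[OF assms(2,3) p1(2) q(2)]) blast
  obtain C where C: "1 \<le> C" and sup: "\<And>v T w p x. \<lbrakk>T \<in> tempered; moderate_weight K v w; p \<in> borel_measurable borel; \<And>x. r \<le> p x;
       ennreal ((2 ^ v) ^ CARD('n)) * (\<integral>\<^sup>+ x. ennreal ((w x * cmod (conv (phi_v Phi phi v) T x)) powr p x) \<partial>lborel) \<le> 1\<rbrakk>
     \<Longrightarrow> w x * cmod (conv (phi_v Phi phi v) T x) \<le> C"
    by (rule nikolskii_sup_bound[OF assms(1) K r]) blast
  \<comment> \<open>Replacing \<open>\<delta> v\<close> by \<open>\<delta> v / 3\<close> in the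
    denominator loses the factor \<open>3 powr (1 / q x)\<close>, at most
    \<open>3 powr Q\<close>.\<close>
  define C' where "C' = C * 3 powr Q"
  have C': "0 < C'" using C by (simp add: C'_def)
  have p12: "AE x in lebesgue. p2 x \<le> p1 x"
  proof -
    have "AE x in lebesgue. ereal (p2 x - p1 x) \<le> ess_sup (\<lambda>x. p2 x - p1 x)"
      unfolding ess_sup_def by (rule esssup_AE)
    then show ?thesis
    proof eventually_elim
      case (elim x)
      then have "ereal (p2 x - p1 x) \<le> 0" using assms(9) by (rule order_trans)
      then show ?case by (simp add: zero_ereal_def)
    qed
  qed
  have \<tau>0: "AE x in lebesgue. 0 \<le> \<tau> x"
  proof -
    have "AE x in lebesgue. ereal (- \<tau> x) \<le> esssup lebesgue (\<lambda>x. ereal (- \<tau> x))"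
      by (rule esssup_AE)
    then show ?thesis
    proof eventually_elim
      case (elim x)
      also have "esssup lebesgue (\<lambda>x. ereal (- \<tau> x)) \<le> 0"
        using assms(4) by (simp add: ess_inf_def ereal_less_uminus_reorder)
      finally show ?case by (simp add: zero_ereal_def)
    qed
  qed
  have main: "btype_norm \<alpha> \<tau> p1 q Phi phi f \<le> ennreal C' * besov_norm s p2 q Phi phi f"
    if f: "f \<in> tempered" for f
  proof -
    define u where "u v = conv (phi_v Phi phi v) f" for v
    have um [measurable]: "u v \<in> borel_measurable borel" for v
      unfolding u_def by (rule conv_measurable[OF assms(1) f])
    define I where "I \<mu> v lam = (\<integral>\<^sup>+ x. ennreal ((cmod (complex_of_real (2 powr (real v * s x)) * u v x) / (\<mu> * lam powr (1 / q x))) powr p2 x) \<partial>lebesgue)"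
      for \<mu> :: real and v :: nat and lam :: real
    define L where "L \<mu> v = Inf (ennreal ` {lam. 0 < lam \<and> I \<mu> v lam \<le> 1})" for \<mu> v
    show ?thesis
      unfolding besov_norm_def mixed_norm_def
    \<comment> \<open>It is enough to treat each \<mu> admissible for the Besov norm; if there is
      none, the infimum is infinite.\<close>
    proof (rule le_mult_Inf_ennreal[OF C'])
      fix a assume "a \<in> ennreal ` {\<mu>. 0 < \<mu> \<and>
         (\<Sum>v. if v \<in> UNIV then
            Inf (ennreal ` {lam. 0 < lam \<and>
              (\<integral>\<^sup>+ x. ennreal ((cmod (complex_of_real (2 powr (real v * s x)) * conv (phi_v Phi phi v) f x) / (\<mu> * lam powr (1 / q x))) powr p2 x) \<partial>lebesgue) \<le> 1})
          else 0) \<le> 1}"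
      then obtain \<mu> where a: "a = ennreal \<mu>" and \<mu>: "0 < \<mu>" and sum: "(\<Sum>v. L \<mu> v) \<le> 1"
        by (auto simp: L_def I_def u_def)
      have L1: "L \<mu> v \<le> 1" for v
        using sum_le_suminf[of "L \<mu>" "{v}"] sum by (simp add: order_trans)
      define \<delta> where "\<delta> v = enn2real (L \<mu> v) + 1 / 2 ^ v" for v
      have Lr: "L \<mu> v = ennreal (enn2real (L \<mu> v))" for v
        using L1[of v] by (simp add: ennreal_enn2real order_le_less_trans)
      have \<delta>: "0 < \<delta> v" "1 / 2 ^ v \<le> \<delta> v" "\<delta> v \<le> 2" for v
      proof -
        show "0 < \<delta> v" "1 / 2 ^ v \<le> \<delta> v" by (simp_all add: \<delta>_def add_nonneg_pos)
        have "enn2real (L \<mu> v) \<le> 1" using enn2real_mono[OF L1[of v]] by simp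
        moreover have "1 / 2 ^ v \<le> (1::real)" by simp
        ultimately show "\<delta> v \<le> 2" unfolding \<delta>_def by linarith
      qed
      have \<delta>sum: "(\<Sum>v. ennreal (\<delta> v)) \<le> 3"
      proof -
        have "(\<Sum>v. ennreal (\<delta> v)) = (\<Sum>v. L \<mu> v + ennreal (1 / 2 ^ v))"
          unfolding \<delta>_def by (intro suminf_cong) (subst (2) Lr, simp)
        also have "\<dots> = (\<Sum>v. L \<mu> v) + (\<Sum>v. ennreal (1 / 2 ^ v))"
          by (simp add: suminf_add[symmetric])
        also have "(\<Sum>v. ennreal (1 / 2 ^ v)) = 2"
        proof -
          have "(\<lambda>v. 1 / 2 ^ v :: real) sums 2"
            using geometric_sums[of "1 / 2 :: real"] by (simp add: power_one_over)
          then show ?thesis by (subst suminf_ennreal2) (auto simp: sums_iff)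
        qed
        finally show ?thesis using add_right_mono[OF sum, of 2] by simp
      qed
      \<comment> \<open>\<open>\<delta> v\<close> lies strictly above the infimum, so some
        admissible \<open>lam\<close> lies below it, and the integrand decreases in
        \<open>lam\<close>.\<close>
      have feasible: "I \<mu> v (\<delta> v) \<le> 1" for v
      proof -
        have "L \<mu> v < ennreal (\<delta> v)"
          by (subst Lr) (simp add: \<delta>_def ennreal_lessI add_nonneg_pos)
        then obtain lam where lam: "0 < lam" "I \<mu> v lam \<le> 1" "ennreal lam < ennreal (\<delta> v)"
          unfolding L_def Inf_less_iff by blast
        then have le: "lam \<le> \<delta> v" by (simp add: ennreal_less_iff less_imp_le)
        have "I \<mu> v (\<delta> v) \<le> I \<mu> v lam"
          unfolding I_def
          using p2(1) q(1) \<mu> lam(1) le \<delta>(1)[of v]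
          by (intro nn_integral_mono ennreal_leI powr_mono2 divide_left_mono mult_left_mono mult_pos_pos) (auto intro: less_imp_le)
        with lam(2) show ?thesis by (rule order_trans[rotated])
      qed
      have level: "(\<integral>\<^sup>+ x. ennreal ((cmod (g x) / (C * \<mu> * \<delta> v powr (1 / q x))) powr p1 x) \<partial>lebesgue) \<le> 1"
        if g: "AE x in lebesgue. cmod (g x) \<le> 2 powr (real v * \<sigma> x) * cmod (u v x)" for v g
      proof -
        let ?w = "level_weight (\<lambda>x. \<sigma> x - ?n / p1 x) q v (\<delta> v) \<mu>"
        note mwv = mw[OF \<delta>(2,3) \<mu>, of v]
        have wm [measurable]: "?w \<in> borel_measurable borel" using mwv by (simp add: moderate_weight_def)
        have Wm: "(\<lambda>x. ennreal ((?w x * cmod (u v x)) powr p2 x)) \<in> borel_measurable borel"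
          using p2(3) by measurable
        \<comment> \<open>Since \<open>s = n / p2 + (\<sigma> - n / p1)\<close>, the Besov integrand
          at \<open>\<delta> v\<close> is exactly the modular of the Nikolskii bound.\<close>
        have eq: "ennreal ((2 ^ v) ^ CARD('n)) * ennreal ((?w x * cmod (u v x)) powr p2 x)
            = ennreal ((cmod (complex_of_real (2 powr (real v * s x)) * u v x) / (\<mu> * \<delta> v powr (1 / q x))) powr p2 x)" for x
        proof -
          have "2 powr (real v * s x) = 2 powr (real v * (?n / p2 x)) * 2 powr (real v * (\<sigma> x - ?n / p1 x))"
            unfolding powr_add[symmetric] by (simp add: s_def \<sigma>_def algebra_simps)
          then have "cmod (complex_of_real (2 powr (real v * s x)) * u v x) / (\<mu> * \<delta> v powr (1 / q x))
              = 2 powr (real v * (?n / p2 x)) * (?w x * cmod (u v x))"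
            by (simp add: norm_mult level_weight_def)
          also have "\<dots> powr p2 x = 2 powr (real v * ?n) * (?w x * cmod (u v x)) powr p2 x"
            using p2(1)[of x] mwv by (subst powr_mult) (auto simp: powr_powr moderate_weight_def less_imp_le)
          also have "2 powr (real v * ?n) = (2 ^ v) ^ CARD('n)"
            by (simp add: powr_powr[symmetric] powr_realpow)
          finally show ?thesis by (simp add: ennreal_mult)
        qed
        have H: "ennreal ((2 ^ v) ^ CARD('n)) * (\<integral>\<^sup>+ x. ennreal ((?w x * cmod (u v x)) powr p2 x) \<partial>lborel) \<le> 1"
        proof -
          have "ennreal ((2 ^ v) ^ CARD('n)) * (\<integral>\<^sup>+ x. ennreal ((?w x * cmod (u v x)) powr p2 x) \<partial>lborel)
              = (\<integral>\<^sup>+ x. ennreal ((2 ^ v) ^ CARD('n)) * ennreal ((?w x * cmod (u v x)) powr p2 x) \<partial>lborel)"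
            using Wm by (subst nn_integral_cmult) auto
          also have "\<dots> = I \<mu> v (\<delta> v)"
            unfolding I_def eq[symmetric] using Wm by (subst nn_integral_completion) auto
          finally show ?thesis using feasible[of v] by simp
        qed
        have supw: "?w x * cmod (u v x) \<le> C" for x
          using sup[OF f mwv p2(3) rp, of x] H by (simp add: u_def)
        show ?thesis
        proof (rule nn_integral_level_bound[OF C supw \<mu> \<delta>(1) p1(1) p2(1) p12 g])
          show "ennreal ((2 ^ v) ^ CARD('n)) * (\<integral>\<^sup>+ x. ennreal ((?w x * cmod (u v x)) powr p2 x) \<partial>lebesgue) \<le> 1"
            using H by (simp add: nn_integral_completion)
          show "(\<lambda>x. ennreal ((?w x * cmod (u v x)) powr p2 x)) \<in> borel_measurable lebesgue"
            by (rule measurable_completion) (use Wm in simp)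
        qed
      qed
      have "mixed_norm p1 q {nat k..}
          (\<lambda>v x. complex_of_real (2 powr (real v * \<alpha> x) * measure lborel (dyadic_cube k m) powr (- \<tau> x)
              * indicator (dyadic_cube k m) x) * conv (phi_v Phi phi v) f x) \<le> ennreal (C' * \<mu>)" for k m
        unfolding mixed_norm_def
      proof (intro Inf_lower image_eqI[OF refl] CollectI conjI)
        show "0 < C' * \<mu>" using C' \<mu> by simp
        define g where "g v x = complex_of_real (2 powr (real v * \<alpha> x) * measure lborel (dyadic_cube k m) powr (- \<tau> x)
              * indicator (dyadic_cube k m) x) * conv (phi_v Phi phi v) f x" for v x
        \<comment> \<open>From \<open>v \<ge> nat k\<close> follows \<open>v \<ge> k\<close> also
          for negative \<open>k\<close>, so the cube has measure at least \<open>2^(-v n)\<close>.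
          As \<open>\<tau> \<ge> 0\<close> almost everywhere, its power \<open>- \<tau>\<close> is
          at most \<open>2^(v n \<tau>)\<close>.\<close>
        have gle: "AE x in lebesgue. cmod (g v x) \<le> 2 powr (real v * \<sigma> x) * cmod (u v x)" if v: "nat k \<le> v" for v
          using \<tau>0
        proof eventually_elim
          case (elim x)
          let ?m = "measure lborel (dyadic_cube k m :: (real^'n) set)"
          have "2 powr (- (real v * ?n)) = (2 powr (- real v)) ^ CARD('n)"
            by (simp add: powr_realpow[symmetric] powr_powr)
          also have "\<dots> \<le> (2 powr (- real_of_int k)) ^ CARD('n)"
            using v by (intro power_mono powr_mono) auto
          also have "\<dots> \<le> ?m" by (rule measure_dyadic_cube_ge)
          finally have "?m powr (- \<tau> x) \<le> (2 powr (- (real v * ?n))) powr (- \<tau> x)"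
            using elim by (intro powr_mono2') auto
          also have "\<dots> = 2 powr (real v * (?n * \<tau> x))" by (simp add: powr_powr mult.assoc)
          finally have "2 powr (real v * \<alpha> x) * ?m powr (- \<tau> x) \<le> 2 powr (real v * \<alpha> x) * 2 powr (real v * (?n * \<tau> x))"
            by (intro mult_left_mono) auto
          also have "\<dots> = 2 powr (real v * \<sigma> x)"
            unfolding powr_add[symmetric] by (simp add: \<sigma>_def distrib_left)
          finally have *: "2 powr (real v * \<alpha> x) * ?m powr (- \<tau> x) \<le> 2 powr (real v * \<sigma> x)" .
          have "cmod (g v x) = 2 powr (real v * \<alpha> x) * ?m powr (- \<tau> x) * indicator (dyadic_cube k m) x * cmod (u v x)"
            by (simp add: g_def u_def norm_mult)
          also have "\<dots> \<le> 2 powr (real v * \<alpha> x) * ?m powr (- \<tau> x) * 1 * cmod (u v x)"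
            by (intro mult_right_mono mult_left_mono) (auto split: split_indicator)
          also have "\<dots> \<le> 2 powr (real v * \<sigma> x) * cmod (u v x)"
            using * by (simp add: mult_right_mono)
          finally show ?case .
        qed
        \<comment> \<open>Thus \<open>\<delta> v / 3\<close> is admissible in the inner infimum of
          the target norm at \<open>C' * \<mu>\<close>, and these numbers add up to at most
          1.\<close>
        have lev: "(\<integral>\<^sup>+ x. ennreal ((cmod (g v x) / (C' * \<mu> * (\<delta> v / 3) powr (1 / q x))) powr p1 x) \<partial>lebesgue) \<le> 1"
          if v: "nat k \<le> v" for v
        proof (rule order_trans[OF nn_integral_mono level[OF gle[OF v]]])
          fix x
          have "3 powr (1 / q x) \<le> 3 powr Q" using Q by (intro powr_mono) auto
          then have "\<delta> v powr (1 / q x) \<le> 3 powr Q * (\<delta> v powr (1 / q x) / 3 powr (1 / q x))"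
            using mult_right_mono[of "3 powr (1 / q x)" "3 powr Q" "\<delta> v powr (1 / q x)"] by (simp add: field_simps)
          also have "\<dots> = 3 powr Q * (\<delta> v / 3) powr (1 / q x)"
            using \<delta>(1)[of v] by (simp add: powr_divide)
          finally have "C * \<mu> * \<delta> v powr (1 / q x) \<le> C' * \<mu> * (\<delta> v / 3) powr (1 / q x)"
            using C \<mu> mult_left_mono[of "\<delta> v powr (1 / q x)" _ "C * \<mu>"] by (simp add: C'_def mult_ac)
          then show "ennreal ((cmod (g v x) / (C' * \<mu> * (\<delta> v / 3) powr (1 / q x))) powr p1 x)
              \<le> ennreal ((cmod (g v x) / (C * \<mu> * \<delta> v powr (1 / q x))) powr p1 x)"
            using C C' \<mu> \<delta>(1)[of v] p1(1)[of x]
            by (intro ennreal_leI powr_mono2 divide_left_mono) (auto intro: less_imp_le)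
        qed
        have "(\<Sum>v. if v \<in> {nat k..} then Inf (ennreal ` {lam. 0 < lam \<and>
              (\<integral>\<^sup>+ x. ennreal ((cmod (g v x) / (C' * \<mu> * lam powr (1 / q x))) powr p1 x) \<partial>lebesgue) \<le> 1}) else 0)
            \<le> (\<Sum>v. ennreal (1 / 3) * ennreal (\<delta> v))"
        proof (rule suminf_le[OF _ summableI summableI])
          fix v
          show "(if v \<in> {nat k..} then Inf (ennreal ` {lam. 0 < lam \<and>
              (\<integral>\<^sup>+ x. ennreal ((cmod (g v x) / (C' * \<mu> * lam powr (1 / q x))) powr p1 x) \<partial>lebesgue) \<le> 1}) else 0)
            \<le> ennreal (1 / 3) * ennreal (\<delta> v)"
          proof (cases "nat k \<le> v")
            case True
            have "ennreal (1 / 3) * ennreal (\<delta> v) = ennreal (\<delta> v / 3)"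
              using \<delta>(1)[of v] by (simp add: ennreal_mult[symmetric])
            then show ?thesis
              using True lev[OF True] \<delta>(1)[of v] by (simp add: Inf_lower)
          qed simp
        qed
        also have "\<dots> = ennreal (1 / 3) * (\<Sum>v. ennreal (\<delta> v))" by (rule ennreal_suminf_cmult)
        also have "\<dots> \<le> ennreal (1 / 3) * 3" by (intro mult_left_mono \<delta>sum) simp
        also have "\<dots> = 1"
          using ennreal_mult[of "1 / 3" 3] by simp
        finally show "(\<Sum>v. if v \<in> {nat k..} then Inf (ennreal ` {lam. 0 < lam \<and>
              (\<integral>\<^sup>+ x. ennreal ((cmod (complex_of_real (2 powr (real v * \<alpha> x) * measure lborel (dyadic_cube k m) powr (- \<tau> x)
              * indicator (dyadic_cube k m) x) * conv (phi_v Phi phi v) f x) / (C' * \<mu> * lam powr (1 / q x))) powr p1 x) \<partial>lebesgue) \<le> 1}) else 0) \<le> 1"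
          unfolding g_def .
      qed
      then show "btype_norm \<alpha> \<tau> p1 q Phi phi f \<le> ennreal C' * a"
        unfolding btype_norm_def a using C' \<mu> by (intro SUP_least) (simp add: ennreal_mult)
    qed
  qed
  show ?thesis
    unfolding s_def[symmetric]
  proof (intro conjI exI[of _ C'] ballI subsetI C')
    show "btype_norm \<alpha> \<tau> p1 q Phi phi f \<le> ennreal C' * besov_norm s p2 q Phi phi f"
      if "f \<in> besov_space s p2 q Phi phi" for f
      using that main by (simp add: besov_space_def)
    show "f \<in> btype_space \<alpha> \<tau> p1 q Phi phi" if "f \<in> besov_space s p2 q Phi phi" for f
    proof -
      from that have f: "f \<in> tempered" "besov_norm s p2 q Phi phi f < \<infinity>" by (auto simp: besov_space_def)
      then have "ennreal C' * besov_norm s p2 q Phi phi f < \<infinity>" by (simp add: ennreal_mult_less_top)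
      with main[OF f(1)] f(1) show ?thesis by (simp add: btype_space_def order_le_less_trans)
    qed
  qed
qed

end
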